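(* Let $\mathcal{M}$ be a connected, oriented, complete Riemannian manifold of dimension $n\ge2$ whose Riemannian curvature tensor is bounded, let $\sigma,\kappa>0$, and let $\mathcal{L}=\frac{\sigma^2}{2}\Delta^v+\kappa\xi$ be the generator of the velocity spherical Brownian motion on $T^1\mathcal{M}$. Then there exist $a,b,c,d>0$ with $b^2<ac$ and $K\in\mathbb{R}$ such that for every smooth $f:T^1\mathcal{M}\to\mathbb{R}$, $$a\,\Gamma_2^{v}(f)-2b\,\Gamma_2^{v,\tilde h}(f)+c\,\Gamma_2^{\tilde h}(f)+d\,\Gamma_2^{\xi}(f)\ \ge\ -K\|\nabla^vf\|^2+\|\nabla^hf\|^2 .$$
   Context: Let $O\mathcal{M}$ be the orthonormal frame bundle of $\mathcal{M}$, with elements $(x,\mathbf{e})$, $\mathbf{e}=(e^0,\dots,e^{n-1})$ an orthonormal frame of $T_x\mathcal{M}$, and $\pi:O\mathcal{M}\to T^1\mathcal{M}$, $\pi(x,\mathbf{e})=(x,e^0)$. In local coordinates $(x_k)$, with $e^j_k$ the coordinates of $e^j$ and $\Gamma^l_{ij}$ the Christoffel symbols, define the vector fields on $O\mathcal{M}$ $$V_i=\sum_{k}\left(e^i_k\partial_{e^0_k}-e^0_k\partial_{e^i_k}\right)\ (1\le i\le n-1),\qquad H_{i}=\sum_k e^{i}_k\partial_{x_k}-\sum_{k,l,p,q}\Gamma^l_{pq}e^k_pe^{i}_q\partial_{e^k_l}\ (0\le i\le n-1).$$ The operator $\mathcal{L}$ on $T^1\mathcal{M}$ is characterized by $(\mathcal{L}f)\circ\pi=\left(\frac{\sigma^2}{2}\sum_{i=1}^{n-1}V_i^2+\kappa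 H_0\right)(f\circ\pi)$ ($\Delta^v$ is the vertical Laplacian on the spherical fibers and $\xi$ the generator of the geodesic flow). For smooth $f,g$ on $T^1\mathcal{M}$, writing $Wf$ for $W(f\circ\pi)$ (the sums below descend to $T^1\mathcal{M}$): $$\Gamma^v(f,g)=\sum_{i=1}^{n-1}V_if\,V_ig,\quad \Gamma^{v,\tilde h}(f,g)=\tfrac12\sum_{i=1}^{n-1}\left(H_if\,V_ig+H_ig\,V_if\right),\quad \Gamma^{\tilde h}(f,g)=\sum_{i=1}^{n-1}H_if\,H_ig,\quad \Gamma^\xi(f,g)=H_0f\,H_0g.$$ For each of these forms $\Gamma^\bullet$, $\Gamma^\bullet_2(f,g)=\frac12\left(\mathcal{L}\Gamma^\bullet(f,g)-\Gamma^\bullet(\mathcal{L}f,g)-\Gamma^\bullet(f,\mathcal{L}g)\right)$ and $\Gamma_2^\bullet(f)=\Gamma_2^\bullet(f,f)$. Finally $\|\nabla^vf\|^2=\sum_{i=1}^{n-1}(V_if)^2$ and $\|\nabla^hf\|^2=\sum_{i=0}^{n-1}(H_if)^2$. The curvature tensor $R$ is bounded if $\sup_{x}\sup_{u,v,w,h\in T_x^1\mathcal{M}}|\langle u,R(v,w)h\rangle_x|<\infty$. *)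

theory Defs
  imports "HOL-Analysis.Analysis"
begin

section \<open>Smooth functions\<close>

text \<open>For open \<open>S\<close> in a Euclidean space this is the usual \<open>C^k\<close>.\<close>

primrec Ck_on :: "nat \<Rightarrow> 'v::real_normed_vector set \<Rightarrow> ('v \<Rightarrow> 'w::real_normed_vector) \<Rightarrow> bool" where
  "Ck_on 0 S h \<longleftrightarrow> continuous_on S h"
| "Ck_on (Suc k) S h \<longleftrightarrow>
     (\<forall>x\<in>S. h differentiable (at x)) \<and> (\<forall>v. Ck_on k S (\<lambda>x. frechet_derivative h (at x) v))"

definition smooth_on :: "'v::real_normed_vector set \<Rightarrow> ('v \<Rightarrow> 'w::real_normed_vector) \<Rightarrow> bool" where
  "smooth_on S h \<longleftrightarrow> (\<forall>k. Ck_on k S h)"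

text \<open>Smoothness on a subset that need not be open (an embedded submanifold, below): existence of
  smooth extensions near every point.\<close>

definition smooth_on_subset :: "'v::real_normed_vector set \<Rightarrow> ('v \<Rightarrow> 'w::real_normed_vector) \<Rightarrow> bool" where
  "smooth_on_subset S h \<longleftrightarrow>
     (\<forall>p\<in>S. \<exists>W h'. open W \<and> p \<in> W \<and> smooth_on W h' \<and> (\<forall>q\<in>W \<inter> S. h' q = h q))"

section \<open>Manifolds and tangent vectors\<close>

text \<open>A chart is a domain together with a coordinate map. The dimension is \<open>CARD('n)\<close>. The type
  \<open>'n\<close> indexes both coordinates and members of frames; its element \<open>0\<close> marks the distinguished
  frame vector \<open>e^0\<close>, so that the index range \<open>1 \<le> i \<le> n - 1\<close> becomes \<open>UNIV - {0}\<close>.\<close>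

type_synonym ('a, 'n) chart = "'a set \<times> ('a \<Rightarrow> real ^ 'n)"

abbreviation cdom :: "('a, 'n) chart \<Rightarrow> 'a set" where "cdom \<equiv> fst"
abbreviation cmap :: "('a, 'n) chart \<Rightarrow> 'a \<Rightarrow> real ^ 'n" where "cmap \<equiv> snd"

definition cinv :: "('a, 'n) chart \<Rightarrow> real ^ 'n \<Rightarrow> 'a" where
  "cinv c = inv_into (cdom c) (cmap c)"

definition transition :: "('a, 'n) chart \<Rightarrow> ('a, 'n) chart \<Rightarrow> real ^ 'n \<Rightarrow> real ^ 'n" where
  "transition c c' = cmap c' \<circ> cinv c"

definition smooth_manifold :: "'a topology \<Rightarrow> ('a, 'n::finite) chart set \<Rightarrow> bool" where
  "smooth_manifold M A \<longleftrightarrow>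
     Hausdorff_space M \<and> second_countable M \<and> topspace M = (\<Union>c\<in>A. cdom c) \<and>
     (\<forall>c\<in>A. openin M (cdom c) \<and> open (cmap c ` cdom c) \<and>
        homeomorphic_map (subtopology M (cdom c)) (top_of_set (cmap c ` cdom c)) (cmap c)) \<and>
     (\<forall>c\<in>A. \<forall>c'\<in>A. smooth_on (cmap c ` (cdom c \<inter> cdom c')) (transition c c'))"

text \<open>An oriented manifold is one given by an atlas whose coordinate changes preserve orientation.\<close>

definition oriented_atlas :: "('a, 'n::finite) chart set \<Rightarrow> bool" where
  "oriented_atlas A \<longleftrightarrow>
     (\<forall>c\<in>A. \<forall>c'\<in>A. \<forall>x\<in>cdom c \<inter> cdom c'.
        0 < det (matrix (frechet_derivative (transition c c') (at (cmap c x)))))"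

definition chart_at :: "('a, 'n) chart set \<Rightarrow> 'a \<Rightarrow> ('a, 'n) chart" where
  "chart_at A x = (SOME c. c \<in> A \<and> x \<in> cdom c)"

text \<open>A tangent vector at \<open>x\<close> is the family of its coordinate vectors in all charts around \<open>x\<close>,
  related by the derivatives of the coordinate changes; it is \<open>0\<close> on all other charts. Thus
  \<open>v c $ k\<close> is the \<open>k\<close>-th coordinate of \<open>v\<close> in the chart \<open>c\<close>.\<close>

type_synonym ('a, 'n) tvec = "('a, 'n) chart \<Rightarrow> real ^ 'n"

definition tangent_space :: "('a, 'n::finite) chart set \<Rightarrow> 'a \<Rightarrow> ('a, 'n) tvec set" where
  "tangent_space A x =
     {v. (\<forall>c. \<not> (c \<in> A \<and> x \<in> cdom c) \<longrightarrow> v c = 0) \<and>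
         (\<forall>c\<in>A. \<forall>c'\<in>A. x \<in> cdom c \<inter> cdom c' \<longrightarrow>
            v c' = frechet_derivative (transition c c') (at (cmap c x)) (v c))}"

text \<open>The tangent vector \<open>\<Sum>k. u $ k \<partial>/\<partial>x_k\<close> at \<open>x\<close>, in the chart \<open>c\<close>.\<close>

definition tvec_of :: "('a, 'n::finite) chart set \<Rightarrow> ('a, 'n) chart \<Rightarrow> 'a \<Rightarrow> real ^ 'n \<Rightarrow> ('a, 'n) tvec" where
  "tvec_of A c x u =
     (\<lambda>c'. if c' \<in> A \<and> x \<in> cdom c' then frechet_derivative (transition c c') (at (cmap c x)) u else 0)"

section \<open>Riemannian metrics, Christoffel symbols, curvature\<close>

text \<open>\<open>g x\<close> is only meaningful on \<open>tangent_space A x\<close>.\<close>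

type_synonym ('a, 'n) metric = "'a \<Rightarrow> ('a, 'n) tvec \<Rightarrow> ('a, 'n) tvec \<Rightarrow> real"

definition metric_matrix ::
  "('a, 'n::finite) chart set \<Rightarrow> ('a, 'n) metric \<Rightarrow> ('a, 'n) chart \<Rightarrow> real ^ 'n \<Rightarrow> real ^ 'n ^ 'n" where
  "metric_matrix A g c y =
     (\<chi> k l. g (cinv c y) (tvec_of A c (cinv c y) (axis k 1)) (tvec_of A c (cinv c y) (axis l 1)))"

definition riemannian_metric :: "('a, 'n::finite) chart set \<Rightarrow> ('a, 'n) metric \<Rightarrow> bool" where
  "riemannian_metric A g \<longleftrightarrow>
     (\<forall>c\<in>A. \<forall>x\<in>cdom c.
        bilinear (\<lambda>u v. g x (tvec_of A c x u) (tvec_of A c x v)) \<and>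
        (\<forall>u v. g x (tvec_of A c x u) (tvec_of A c x v) = g x (tvec_of A c x v) (tvec_of A c x u)) \<and>
        (\<forall>u. u \<noteq> 0 \<longrightarrow> 0 < g x (tvec_of A c x u) (tvec_of A c x u))) \<and>
     (\<forall>c\<in>A. \<forall>k l. smooth_on (cmap c ` cdom c) (\<lambda>y. metric_matrix A g c y $ k $ l))"

definition partial :: "'n \<Rightarrow> (real ^ 'n \<Rightarrow> real) \<Rightarrow> real ^ 'n::finite \<Rightarrow> real" where
  "partial k h y = frechet_derivative h (at y) (axis k 1)"

text \<open>\<open>christoffel A g c l p q y\<close> is \<open>\<Gamma>^l_{pq}\<close> at the point with coordinates \<open>y\<close> in the chart \<open>c\<close>.\<close>

definition christoffel ::
  "('a, 'n::finite) chart set \<Rightarrow> ('a, 'n) metric \<Rightarrow> ('a, 'n) chart \<Rightarrow> 'n \<Rightarrow> 'n \<Rightarrow> 'n \<Rightarrow> real ^ 'n \<Rightarrow> real" where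
  "christoffel A g c l p q y =
     (let G = metric_matrix A g c in
      (1 / 2) * (\<Sum>m\<in>UNIV. matrix_inv (G y) $ l $ m *
        (partial p (\<lambda>z. G z $ m $ q) y + partial q (\<lambda>z. G z $ p $ m) y
          - partial m (\<lambda>z. G z $ p $ q) y)))"

text \<open>The \<open>l\<close>-th component of \<open>R(\<partial>_i, \<partial>_j) \<partial>_k\<close>, for
  \<open>R(X, Y) = \<nabla>_X \<nabla>_Y - \<nabla>_Y \<nabla>_X - \<nabla>_{[X, Y]}\<close>.\<close>

definition curvature_coeff ::
  "('a, 'n::finite) chart set \<Rightarrow> ('a, 'n) metric \<Rightarrow> ('a, 'n) chart \<Rightarrow> 'n \<Rightarrow> 'n \<Rightarrow> 'n \<Rightarrow> 'n \<Rightarrow> real ^ 'n \<Rightarrow> real" where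
  "curvature_coeff A g c l k i j y =
     (let \<Gamma> = christoffel A g c in
      partial i (\<Gamma> l j k) y - partial j (\<Gamma> l i k) y
        + (\<Sum>m\<in>UNIV. \<Gamma> l i m y * \<Gamma> m j k y - \<Gamma> l j m y * \<Gamma> m i k y))"

text \<open>The tangent vector \<open>R(v, w) h\<close>. It does not depend on the chart, \<open>R\<close> being a tensor.\<close>

definition curvature ::
  "('a, 'n::finite) chart set \<Rightarrow> ('a, 'n) metric \<Rightarrow> 'a \<Rightarrow>
   ('a, 'n) tvec \<Rightarrow> ('a, 'n) tvec \<Rightarrow> ('a, 'n) tvec \<Rightarrow> ('a, 'n) tvec" where
  "curvature A g x v w h =
     (let c = chart_at A x in
      tvec_of A c x (\<chi> l. \<Sum>k\<in>UNIV. \<Sum>i\<in>UNIV. \<Sum>j\<in>UNIV.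
        curvature_coeff A g c l k i j (cmap c x) * (h c $ k) * (v c $ i) * (w c $ j)))"

definition unit_tangent_space ::
  "('a, 'n::finite) chart set \<Rightarrow> ('a, 'n) metric \<Rightarrow> 'a \<Rightarrow> ('a, 'n) tvec set" where
  "unit_tangent_space A g x = {v \<in> tangent_space A x. g x v v = 1}"

definition bounded_curvature ::
  "'a topology \<Rightarrow> ('a, 'n::finite) chart set \<Rightarrow> ('a, 'n) metric \<Rightarrow> bool" where
  "bounded_curvature M A g \<longleftrightarrow>
     (\<exists>B. \<forall>x\<in>topspace M. \<forall>u\<in>unit_tangent_space A g x. \<forall>v\<in>unit_tangent_space A g x.
        \<forall>w\<in>unit_tangent_space A g x. \<forall>h\<in>unit_tangent_space A g x.
          \<bar>g x u (curvature A g x v w h)\<bar> \<le> B)"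

definition geodesic ::
  "'a topology \<Rightarrow> ('a, 'n::finite) chart set \<Rightarrow> ('a, 'n) metric \<Rightarrow> (real \<Rightarrow> 'a) \<Rightarrow> bool" where
  "geodesic M A g \<gamma> \<longleftrightarrow>
     continuous_map euclideanreal M \<gamma> \<and>
     (\<forall>c\<in>A. \<forall>t. \<gamma> t \<in> cdom c \<longrightarrow>
        (let \<gamma>' = (\<lambda>s. vector_derivative (cmap c \<circ> \<gamma>) (at s)) in
         (cmap c \<circ> \<gamma>) differentiable (at t) \<and>
         (\<gamma>' has_vector_derivative
            (\<chi> l. - (\<Sum>p\<in>UNIV. \<Sum>q\<in>UNIV. christoffel A g c l p q (cmap c (\<gamma> t)) * \<gamma>' t $ p * \<gamma>' t $ q)))
           (at t)))"

definition geodesically_complete ::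
  "'a topology \<Rightarrow> ('a, 'n::finite) chart set \<Rightarrow> ('a, 'n) metric \<Rightarrow> bool" where
  "geodesically_complete M A g \<longleftrightarrow>
     (\<forall>x\<in>topspace M. \<forall>v\<in>tangent_space A x. \<exists>\<gamma>. geodesic M A g \<gamma> \<and> \<gamma> 0 = x \<and>
        (\<forall>c\<in>A. x \<in> cdom c \<longrightarrow> vector_derivative (cmap c \<circ> \<gamma>) (at 0) = v c))"

section \<open>Unit tangent bundle and orthonormal frame bundle\<close>

definition unit_tangent_bundle ::
  "('a, 'n::finite) chart set \<Rightarrow> ('a, 'n) metric \<Rightarrow> ('a \<times> ('a, 'n) tvec) set" where
  "unit_tangent_bundle A g = (SIGMA x:(\<Union>c\<in>A. cdom c). unit_tangent_space A g x)"

definition frame_bundle ::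
  "('a, 'n::finite) chart set \<Rightarrow> ('a, 'n) metric \<Rightarrow> ('a \<times> ('n \<Rightarrow> ('a, 'n) tvec)) set" where
  "frame_bundle A g =
     (SIGMA x:(\<Union>c\<in>A. cdom c).
        {e. (\<forall>j. e j \<in> tangent_space A x) \<and> (\<forall>i j. g x (e i) (e j) = (if i = j then 1 else 0))})"

definition frame_proj :: "'a \<times> ('n::{finite,zero} \<Rightarrow> ('a, 'n) tvec) \<Rightarrow> 'a \<times> ('a, 'n) tvec" where
  "frame_proj p = (fst p, snd p 0)"

text \<open>A smooth function on the unit tangent bundle is a function that is smooth in the bundle
  coordinates \<open>(y, u)\<close> of every chart, which range over the hypersurface of unit vectors. Only the
  values of \<open>f\<close> on the unit tangent bundle matter.\<close>

definition smooth_unit_tangent ::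
  "('a, 'n::finite) chart set \<Rightarrow> ('a, 'n) metric \<Rightarrow> ('a \<times> ('a, 'n) tvec \<Rightarrow> real) \<Rightarrow> bool" where
  "smooth_unit_tangent A g f \<longleftrightarrow>
     (\<forall>c\<in>A. smooth_on_subset
        {(y, u). y \<in> cmap c ` cdom c \<and> tvec_of A c (cinv c y) u \<in> unit_tangent_space A g (cinv c y)}
        (\<lambda>(y, u). f (cinv c y, tvec_of A c (cinv c y) u)))"

text \<open>Coordinates on the frame bundle: \<open>E $ j $ k\<close> is the \<open>k\<close>-th coordinate \<open>e^j_k\<close> of \<open>e^j\<close>.\<close>

type_synonym 'n fcoords = "(real ^ 'n) \<times> (real ^ 'n ^ 'n)"

definition frame_coords ::
  "('a, 'n::finite) chart \<Rightarrow> 'a \<times> ('n \<Rightarrow> ('a, 'n) tvec) \<Rightarrow> 'n fcoords" where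
  "frame_coords c p = (cmap c (fst p), \<chi> j. snd p j c)"

definition frame_param ::
  "('a, 'n::finite) chart set \<Rightarrow> ('a, 'n) chart \<Rightarrow>
   'n fcoords \<Rightarrow> 'a \<times> ('n \<Rightarrow> ('a, 'n) tvec)" where
  "frame_param A c P = (cinv c (fst P), \<lambda>j. tvec_of A c (cinv c (fst P)) (snd P $ j))"

text \<open>The derivative of a function \<open>F\<close> on the frame bundle at \<open>p\<close> in the direction with
  coordinates \<open>X\<close> in the chart \<open>chart_at A (fst p)\<close>. The frame bundle is a proper submanifold of the
  coordinate space \<open>(y, E)\<close>; the derivative is therefore taken within its coordinate image. It is
  determined by \<open>F\<close> in the directions tangent to the frame bundle, which are the only ones used.\<close>

definition frame_deriv ::
  "('a, 'n::finite) chart set \<Rightarrow> ('a, 'n) metric \<Rightarrow> ('a \<times> ('n \<Rightarrow> ('a, 'n) tvec) \<Rightarrow> real) \<Rightarrow>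
   'a \<times> ('n \<Rightarrow> ('a, 'n) tvec) \<Rightarrow> 'n fcoords \<Rightarrow> real" where
  "frame_deriv A g F p X =
     (let c = chart_at A (fst p) in
      frechet_derivative (F \<circ> frame_param A c)
        (at (frame_coords c p) within frame_coords c ` {p \<in> frame_bundle A g. fst p \<in> cdom c}) X)"

definition V_coords :: "'n::{finite,zero} \<Rightarrow> 'n fcoords \<Rightarrow> 'n fcoords" where
  "V_coords i = (\<lambda>(y, E). (0, \<chi> j. if j = 0 then E $ i else if j = i then - (E $ 0) else 0))"

definition H_coords ::
  "('a, 'n::finite) chart set \<Rightarrow> ('a, 'n) metric \<Rightarrow> ('a, 'n) chart \<Rightarrow> 'n \<Rightarrow>
   'n fcoords \<Rightarrow> 'n fcoords" where
  "H_coords A g c i =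
     (\<lambda>(y, E). (E $ i, \<chi> k l. - (\<Sum>p\<in>UNIV. \<Sum>q\<in>UNIV. christoffel A g c l p q y * E $ k $ p * E $ i $ q)))"

definition V ::
  "('a, 'n::{finite,zero}) chart set \<Rightarrow> ('a, 'n) metric \<Rightarrow> 'n \<Rightarrow>
   ('a \<times> ('n \<Rightarrow> ('a, 'n) tvec) \<Rightarrow> real) \<Rightarrow> 'a \<times> ('n \<Rightarrow> ('a, 'n) tvec) \<Rightarrow> real" where
  "V A g i F p = frame_deriv A g F p (V_coords i (frame_coords (chart_at A (fst p)) p))"

definition H ::
  "('a, 'n::finite) chart set \<Rightarrow> ('a, 'n) metric \<Rightarrow> 'n \<Rightarrow>
   ('a \<times> ('n \<Rightarrow> ('a, 'n) tvec) \<Rightarrow> real) \<Rightarrow> 'a \<times> ('n \<Rightarrow> ('a, 'n) tvec) \<Rightarrow> real" where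
  "H A g i F p =
     (let c = chart_at A (fst p) in frame_deriv A g F p (H_coords A g c i (frame_coords c p)))"

text \<open>\<open>descend A g F\<close> is the function \<open>h\<close> on the unit tangent bundle with \<open>h \<circ> frame_proj = F\<close> on the
  frame bundle, for \<open>F\<close> constant on the fibres of \<open>frame_proj\<close>.\<close>

definition descend ::
  "('a, 'n::{finite,zero}) chart set \<Rightarrow> ('a, 'n) metric \<Rightarrow>
   ('a \<times> ('n \<Rightarrow> ('a, 'n) tvec) \<Rightarrow> real) \<Rightarrow> 'a \<times> ('a, 'n) tvec \<Rightarrow> real" where
  "descend A g F q = (THE r. \<forall>p\<in>frame_bundle A g. frame_proj p = q \<longrightarrow> r = F p)"

section \<open>The generator and the carre du champ forms\<close>

definition generator ::
  "('a, 'n::{finite,zero}) chart set \<Rightarrow> ('a, 'n) metric \<Rightarrow> real \<Rightarrow> real \<Rightarrow>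
   ('a \<times> ('a, 'n) tvec \<Rightarrow> real) \<Rightarrow> 'a \<times> ('a, 'n) tvec \<Rightarrow> real" where
  "generator A g \<sigma> \<kappa> f = descend A g (\<lambda>p.
     \<sigma>\<^sup>2 / 2 * (\<Sum>i\<in>UNIV - {0}. V A g i (V A g i (f \<circ> frame_proj)) p) + \<kappa> * H A g 0 (f \<circ> frame_proj) p)"

definition Gamma_v ::
  "('a, 'n::{finite,zero}) chart set \<Rightarrow> ('a, 'n) metric \<Rightarrow>
   ('a \<times> ('a, 'n) tvec \<Rightarrow> real) \<Rightarrow> ('a \<times> ('a, 'n) tvec \<Rightarrow> real) \<Rightarrow> 'a \<times> ('a, 'n) tvec \<Rightarrow> real" where
  "Gamma_v A g f h = descend A g (\<lambda>p.
     \<Sum>i\<in>UNIV - {0}. V A g i (f \<circ> frame_proj) p * V A g i (h \<circ> frame_proj) p)"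

definition Gamma_vh ::
  "('a, 'n::{finite,zero}) chart set \<Rightarrow> ('a, 'n) metric \<Rightarrow>
   ('a \<times> ('a, 'n) tvec \<Rightarrow> real) \<Rightarrow> ('a \<times> ('a, 'n) tvec \<Rightarrow> real) \<Rightarrow> 'a \<times> ('a, 'n) tvec \<Rightarrow> real" where
  "Gamma_vh A g f h = descend A g (\<lambda>p.
     1 / 2 * (\<Sum>i\<in>UNIV - {0}. H A g i (f \<circ> frame_proj) p * V A g i (h \<circ> frame_proj) p
                             + H A g i (h \<circ> frame_proj) p * V A g i (f \<circ> frame_proj) p))"

definition Gamma_h ::
  "('a, 'n::{finite,zero}) chart set \<Rightarrow> ('a, 'n) metric \<Rightarrow>
   ('a \<times> ('a, 'n) tvec \<Rightarrow> real) \<Rightarrow> ('a \<times> ('a, 'n) tvec \<Rightarrow> real) \<Rightarrow> 'a \<times> ('a, 'n) tvec \<Rightarrow> real" where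
  "Gamma_h A g f h = descend A g (\<lambda>p.
     \<Sum>i\<in>UNIV - {0}. H A g i (f \<circ> frame_proj) p * H A g i (h \<circ> frame_proj) p)"

definition Gamma_xi ::
  "('a, 'n::{finite,zero}) chart set \<Rightarrow> ('a, 'n) metric \<Rightarrow>
   ('a \<times> ('a, 'n) tvec \<Rightarrow> real) \<Rightarrow> ('a \<times> ('a, 'n) tvec \<Rightarrow> real) \<Rightarrow> 'a \<times> ('a, 'n) tvec \<Rightarrow> real" where
  "Gamma_xi A g f h = descend A g (\<lambda>p.
     H A g 0 (f \<circ> frame_proj) p * H A g 0 (h \<circ> frame_proj) p)"

definition Gamma2 ::
  "(('q \<Rightarrow> real) \<Rightarrow> 'q \<Rightarrow> real) \<Rightarrow> (('q \<Rightarrow> real) \<Rightarrow> ('q \<Rightarrow> real) \<Rightarrow> 'q \<Rightarrow> real) \<Rightarrow>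
   ('q \<Rightarrow> real) \<Rightarrow> ('q \<Rightarrow> real) \<Rightarrow> 'q \<Rightarrow> real" where
  "Gamma2 L \<Gamma> f h q = 1 / 2 * (L (\<Gamma> f h) q - \<Gamma> (L f) h q - \<Gamma> f (L h) q)"

definition grad_v_sq ::
  "('a, 'n::{finite,zero}) chart set \<Rightarrow> ('a, 'n) metric \<Rightarrow>
   ('a \<times> ('a, 'n) tvec \<Rightarrow> real) \<Rightarrow> 'a \<times> ('a, 'n) tvec \<Rightarrow> real" where
  "grad_v_sq A g f = descend A g (\<lambda>p. \<Sum>i\<in>UNIV - {0}. (V A g i (f \<circ> frame_proj) p)\<^sup>2)"

definition grad_h_sq ::
  "('a, 'n::{finite,zero}) chart set \<Rightarrow> ('a, 'n) metric \<Rightarrow>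
   ('a \<times> ('a, 'n) tvec \<Rightarrow> real) \<Rightarrow> 'a \<times> ('a, 'n) tvec \<Rightarrow> real" where
  "grad_h_sq A g f = descend A g (\<lambda>p. \<Sum>i\<in>UNIV. (H A g i (f \<circ> frame_proj) p)\<^sup>2)"

end

theory Submission
  imports Defs
begin

text \<open>All operators lift to the orthonormal frame bundle, where they are made from the fields \<open>V_i\<close> and
\<open>H_i\<close>. For a function \<open>F = f \<circ> \<pi>\<close> lifted from the unit tangent bundle, the inequality rests only on the
relations \<open>[V_i, H_0] = H_i\<close>, \<open>[V_i, H_i] = - H_0\<close>, \<open>[V_i, H_j] = 0\<close> for other \<open>j\<close>, \<open>V_i V_j F = V_j V_i F\<close>,
\<open>[V_j, V_i] V_j F = V_i F\<close> and \<open>[H_0, H_i] F = - \<Sum>k. \<langle>R(e^0, e^i) e^0, e^k\<rangle> V_k F\<close>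
(\<open>lie_V_H\<close>, \<open>lie_V_V\<close>, \<open>lie_V_V_V\<close>, \<open>lie_H_H\<close>). Since \<open>L\<close> is a diffusion operator, each \<open>\<Gamma>\<^sub>2\<close> is a sum of
squares (or products) of second derivatives \<open>V_j V_i F\<close>, \<open>V_j H_i F\<close>, \<open>V_j H_0 F\<close>, plus first derivatives times
brackets with \<open>L\<close> (\<open>Gamma2_sum_eq\<close>). The bracket \<open>[L, V_i]\<close> contains \<open>- \<kappa> H_i\<close>, so the mixed
term \<open>- 2 b \<Gamma>\<^sub>2^{v,h}\<close> produces \<open>b \<kappa> \<Sum>i. (H_i F)^2\<close>; this is how the degenerate operator
controls the horizontal directions. The direction \<open>H_0\<close> comes from \<open>\<Gamma>\<^sub>2^\<xi>\<close>, whose bracket contains the trace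
of \<open>V_j H_i F\<close>; the trace is absorbed by the positive form that \<open>b^2 < a c\<close> leaves in \<open>V_j H_i F\<close>. The curvature
occurs only in \<open>[H_0, H_i] F\<close>, multiplied by vertical derivatives, so its bound enters \<open>K\<close> alone.
Completing squares with explicit constants finishes the argument (\<open>quadratic_bound\<close>, \<open>Gamma2_bound\<close>).

The remaining work reduces the statement to such a computation on an open set of coordinates \<open>(y, E)\<close>.
The derivatives along the frame fields are taken within the coordinate image of the frame bundle, a proper
submanifold, and in a chart that is chosen anew at each point. They agree with Lie derivatives of a smooth local extension
in any single chart (\<open>rep_V\<close>, \<open>rep_H\<close>) for two reasons. The fields are
velocities of curves of orthonormal frames, so that the derivative is determined
(\<open>frame_tangent_curve\<close>, \<open>frechet_derivative_frame_set\<close>). And they are compatible with coordinate changes; for \<open>H_i\<close> this is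
the transformation law of the Christoffel symbols, which follows from the uniqueness of the symmetric
metric connection (\<open>Gam_transform\<close>).

Finally, an expression on the frame bundle defines a function of unit vectors if it is invariant under the
orthogonal matrices that fix \<open>e^0\<close>. These permute the \<open>V_i\<close> and the \<open>H_i\<close>, \<open>i \<noteq> 0\<close>, linearly, so every
contraction over \<open>i \<noteq> 0\<close> is invariant (\<open>op_rotate\<close>, \<open>rotation_contract\<close>), and every unit vector extends to a frame
(\<open>frame_proj_surj\<close>).\<close>

section \<open>Calculus of smooth functions\<close>

abbreviation der :: "('v::real_normed_vector \<Rightarrow> 'w::real_normed_vector) \<Rightarrow> 'v \<Rightarrow> 'v \<Rightarrow> 'w" where
  "der f x \<equiv> frechet_derivative f (at x)"

lemma der_eqI: "(f has_derivative f') (at x) \<Longrightarrow> der f x = f'"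
  by (metis frechet_derivative_at)

lemma Ck_on_cong:
  assumes "open S" "\<And>x. x \<in> S \<Longrightarrow> h x = h' x" "Ck_on k S h"
  shows "Ck_on k S h'"
  using assms(2,3)
proof (induction k arbitrary: h h')
  case 0 then show ?case by (simp cong: continuous_on_cong)
next
  case (Suc k)
  have h: "(h has_derivative der h x) (at x)" if "x \<in> S" for x
    using that Suc.prems(2) frechet_derivative_works by auto
  have h': "(h' has_derivative der h x) (at x)" if "x \<in> S" for x
    using has_derivative_transform_within_open[OF h[OF that] \<open>open S\<close> that] Suc.prems(1) by blast
  have "der h x v = der h' x v" if "x \<in> S" for x v
    using der_eqI[OF h'[OF that]] by simp
  moreover have "Ck_on k S (\<lambda>x. der h x v)" for v
    using Suc.prems(2) by simp
  ultimately have "Ck_on k S (\<lambda>x. der h' x v)" for v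
    by (rule Suc.IH)
  moreover have "\<forall>x\<in>S. h' differentiable (at x)" 
    using h' unfolding differentiable_def by blast
  ultimately show ?case unfolding Ck_on.simps by blast
qed

lemma Ck_on_SucI:
  assumes "open S" and "\<And>x. x \<in> S \<Longrightarrow> (h has_derivative h' x) (at x)"
    and "\<And>v. Ck_on k S (\<lambda>x. h' x v)"
  shows "Ck_on (Suc k) S h"
proof -
  have "h' x v = der h x v" if "x \<in> S" for x v
    using der_eqI[OF assms(2)[OF that]] by simp
  then have "Ck_on k S (\<lambda>x. der h x v)" for v
    by (rule Ck_on_cong[OF assms(1) _ assms(3)[of v]]) 
  moreover have "\<forall>x\<in>S. h differentiable (at x)" 
    using assms(2) unfolding differentiable_def by blast
  ultimately show ?thesis unfolding Ck_on.simps by blast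
qed

lemma Ck_on_SucD:
  "Ck_on (Suc k) S h \<Longrightarrow> x \<in> S \<Longrightarrow> (h has_derivative der h x) (at x)"
  "Ck_on (Suc k) S h \<Longrightarrow> Ck_on k S (\<lambda>x. der h x v)"
  by (auto simp flip: frechet_derivative_works)

lemma Ck_on_Suc_weaken: "Ck_on (Suc k) S h \<Longrightarrow> Ck_on k S h"
proof (induction k arbitrary: h)
  case 0 then show ?case
    by (auto intro!: continuous_at_imp_continuous_on differentiable_imp_continuous_within)
next
  case (Suc k)
  have "\<forall>x\<in>S. h differentiable (at x)" using Suc.prems by simp
  moreover have "Ck_on k S (\<lambda>x. der h x v)" for v
    by (rule Suc.IH[OF Ck_on_SucD(2)[OF Suc.prems]])
  ultimately show ?case unfolding Ck_on.simps by blast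
qed

lemma Ck_on_subset: "Ck_on k S h \<Longrightarrow> T \<subseteq> S \<Longrightarrow> Ck_on k T h"
  by (induction k arbitrary: h) (auto intro: continuous_on_subset)

lemma Ck_on_const: "open S \<Longrightarrow> Ck_on k S (\<lambda>x. c)"
proof (induction k arbitrary: c)
  case (Suc k) 
  show ?case
    by (rule Ck_on_SucI[where h' = "\<lambda>x v. 0"]) (simp_all add: Suc)
qed simp

lemma Ck_on_linear_compose:
  assumes "open S" "bounded_linear L" "Ck_on k S f"
  shows "Ck_on k S (\<lambda>x. L (f x))"
  using assms(3)
proof (induction k arbitrary: f)
  case 0 then show ?case by (simp add: bounded_linear.continuous_on[OF assms(2)])
next
  case (Suc k)
  show ?case
  proof (rule Ck_on_SucI[OF \<open>open S\<close>])
    show "((\<lambda>x. L (f x)) has_derivative (\<lambda>v. L (der f x v))) (at x)" if "x \<in> S" for x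
      using bounded_linear.has_derivative[OF assms(2) Ck_on_SucD(1)[OF Suc.prems that]] .
    show "Ck_on k S (\<lambda>x. L (der f x v))" for v
      by (rule Suc.IH[OF Ck_on_SucD(2)[OF Suc.prems]])
  qed
qed

lemma Ck_on_linear: 
  assumes "open S" "bounded_linear L" shows "Ck_on k S L"
proof (induction k)
  case 0 then show ?case using linear_continuous_on[OF assms(2)] by simp
next
  case (Suc k)
  show ?case
    by (rule Ck_on_SucI[where h' = "\<lambda>x. L"])
      (simp_all add: assms bounded_linear_imp_has_derivative Ck_on_const)
qed

lemma Ck_on_add:
  assumes "open S" "Ck_on k S f" "Ck_on k S g"
  shows "Ck_on k S (\<lambda>x. f x + g x)"
  using assms(2,3)
proof (induction k arbitrary: f g)
  case 0 then show ?case by (simp add: continuous_on_add)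
next
  case (Suc k)
  show ?case
  proof (rule Ck_on_SucI[OF \<open>open S\<close>])
    show "((\<lambda>x. f x + g x) has_derivative (\<lambda>v. der f x v + der g x v)) (at x)" if "x \<in> S" for x
      using Ck_on_SucD(1)[OF Suc.prems(1) that] Ck_on_SucD(1)[OF Suc.prems(2) that] 
      by (rule has_derivative_add)
    show "Ck_on k S (\<lambda>x. der f x v + der g x v)" for v
      by (rule Suc.IH[OF Suc.prems[THEN Ck_on_SucD(2)]])
  qed
qed

lemma Ck_on_bilinear:
  assumes "open S" "bounded_bilinear \<beta>" "Ck_on k S f" "Ck_on k S g"
  shows "Ck_on k S (\<lambda>x. \<beta> (f x) (g x))"
  using assms(3,4)
proof (induction k arbitrary: f g)
  case 0 then show ?case by (simp add: bounded_bilinear.continuous_on[OF assms(2)])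
next
  case (Suc k)
  show ?case
  proof (rule Ck_on_SucI[OF \<open>open S\<close>])
    show "((\<lambda>x. \<beta> (f x) (g x)) has_derivative (\<lambda>v. \<beta> (f x) (der g x v) + \<beta> (der f x v) (g x))) (at x)"
      if "x \<in> S" for x
      using Ck_on_SucD(1)[OF Suc.prems(1) that] Ck_on_SucD(1)[OF Suc.prems(2) that]
      by (rule bounded_bilinear.FDERIV[OF assms(2)])
    show "Ck_on k S (\<lambda>x. \<beta> (f x) (der g x v) + \<beta> (der f x v) (g x))" for v
      using Suc.prems[THEN Ck_on_SucD(2)] Suc.prems[THEN Ck_on_Suc_weaken]
      by (intro Ck_on_add[OF \<open>open S\<close>] Suc.IH)
  qed
qed

lemma Ck_on_sum:
  assumes "open S" "\<And>i. i \<in> I \<Longrightarrow> Ck_on k S (f i)"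
  shows "Ck_on k S (\<lambda>x. \<Sum>i\<in>I. f i x)"
  using assms(2) by (induction I rule: infinite_finite_induct) 
     (auto intro!: Ck_on_const Ck_on_add \<open>open S\<close>)

lemma linear_eq_sum_Basis:
  fixes L :: "'b::euclidean_space \<Rightarrow> 'c::real_vector"
  assumes "linear L" shows "L w = (\<Sum>b\<in>Basis. (w \<bullet> b) *\<^sub>R L b)"
  using linear_sum[OF assms, of "\<lambda>b. (w \<bullet> b) *\<^sub>R b" Basis] 
  by (simp add: euclidean_representation linear_cmul[OF assms])

text \<open>The chain rule contains the derivative of \<open>g\<close> in the direction \<open>Df(x) v\<close>, which varies with \<open>x\<close>. Expanding
it in a basis leaves derivatives in fixed directions, to which the induction hypothesis applies.\<close>

lemma Ck_on_compose:
  fixes g :: "'b::euclidean_space \<Rightarrow> 'c::real_normed_vector"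
  assumes "open S" "Ck_on k T g" "Ck_on k S f" "f ` S \<subseteq> T"
  shows "Ck_on k S (\<lambda>x. g (f x))"
  using assms(2,3)
proof (induction k arbitrary: g)
  case 0 with assms(4) show ?case by (auto intro: continuous_on_compose2)
next
  case (Suc k)
  show ?case
  proof (rule Ck_on_SucI[OF \<open>open S\<close>])
    fix x assume x: "x \<in> S"
    with assms(4) have fx: "f x \<in> T" by auto
    have g: "(g has_derivative der g (f x)) (at (f x))"
      by (rule Ck_on_SucD(1)[OF Suc.prems(1) fx])
    have f: "(f has_derivative der f x) (at x)" by (rule Ck_on_SucD(1)[OF Suc.prems(2) x])
    have *: "der g (f x) w = (\<Sum>b\<in>Basis. (w \<bullet> b) *\<^sub>R der g (f x) b)" for w
      by (rule linear_eq_sum_Basis[OF has_derivative_linear[OF g]])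
    show "((\<lambda>x. g (f x)) has_derivative (\<lambda>v. \<Sum>b\<in>Basis. (der f x v \<bullet> b) *\<^sub>R der g (f x) b)) (at x)"
      using has_derivative_compose[OF f g] unfolding *[of "der f x _"] .
  next
    fix v
    have f: "Ck_on k S f" by (rule Ck_on_Suc_weaken[OF Suc.prems(2)])
    show "Ck_on k S (\<lambda>x. \<Sum>b\<in>Basis. (der f x v \<bullet> b) *\<^sub>R der g (f x) b)"
    proof (intro Ck_on_sum[OF \<open>open S\<close>] Ck_on_bilinear[OF \<open>open S\<close> bounded_bilinear_scaleR])
      show "Ck_on k S (\<lambda>x. der f x v \<bullet> b)" for b
        by (rule Ck_on_linear_compose[OF \<open>open S\<close> bounded_linear_inner_left Ck_on_SucD(2)[OF Suc.prems(2)]])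
      show "Ck_on k S (\<lambda>x. der g (f x) b)" for b
        by (rule Suc.IH[OF Ck_on_SucD(2)[OF Suc.prems(1)] f])
    qed
  qed
qed

lemma Ck_on_inverse:
  fixes f :: "'v::real_normed_vector \<Rightarrow> real"
  assumes "open S" "Ck_on k S f" "\<And>x. x \<in> S \<Longrightarrow> f x \<noteq> 0"
  shows "Ck_on k S (\<lambda>x. inverse (f x))"
  using assms(2)
proof (induction k)
  case 0 with assms(3) show ?case by (auto intro: continuous_on_inverse)
next
  case (Suc k)
  show ?case
  proof (rule Ck_on_SucI[OF \<open>open S\<close>])
    show "((\<lambda>x. inverse (f x)) has_derivative (\<lambda>v. - (inverse (f x) * der f x v * inverse (f x)))) (at x)"
      if "x \<in> S" for x
      using assms(3)[OF that] Ck_on_SucD(1)[OF Suc.prems that] by (rule Deriv.has_derivative_inverse)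
    show "Ck_on k S (\<lambda>x. - (inverse (f x) * der f x v * inverse (f x)))" for v
      using Ck_on_SucD(2)[OF Suc.prems] Suc.IH[OF Ck_on_Suc_weaken[OF Suc.prems]]
      by (intro Ck_on_linear_compose[OF \<open>open S\<close> bounded_linear_minus[OF bounded_linear_ident]]
          Ck_on_bilinear[OF \<open>open S\<close> bounded_bilinear_mult])
  qed
qed

lemma smooth_on_cong: "open S \<Longrightarrow> (\<And>x. x \<in> S \<Longrightarrow> f x = g x) \<Longrightarrow> smooth_on S f \<Longrightarrow> smooth_on S g"
  unfolding smooth_on_def using Ck_on_cong by blast
lemma smooth_on_antimono: "smooth_on S f \<Longrightarrow> T \<subseteq> S \<Longrightarrow> smooth_on T f"
  unfolding smooth_on_def using Ck_on_subset by blast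
lemma smooth_on_const: "open S \<Longrightarrow> smooth_on S (\<lambda>x. c)"
  by (simp add: smooth_on_def Ck_on_const)
lemma smooth_on_linear: "open S \<Longrightarrow> bounded_linear L \<Longrightarrow> smooth_on S L"
  by (simp add: smooth_on_def Ck_on_linear)
lemma smooth_on_linear_compose:
  "open S \<Longrightarrow> bounded_linear L \<Longrightarrow> smooth_on S f \<Longrightarrow> smooth_on S (\<lambda>x. L (f x))"
  by (simp add: smooth_on_def Ck_on_linear_compose)
lemma smooth_on_add:
  "open S \<Longrightarrow> smooth_on S f \<Longrightarrow> smooth_on S g \<Longrightarrow> smooth_on S (\<lambda>x. f x + g x)"
  by (simp add: smooth_on_def Ck_on_add)
lemma smooth_on_bilinear:
  "open S \<Longrightarrow> bounded_bilinear \<beta> \<Longrightarrow> smooth_on S f \<Longrightarrow> smooth_on S g \<Longrightarrow> smooth_on S (\<lambda>x. \<beta> (f x) (g x))"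
  by (simp add: smooth_on_def Ck_on_bilinear)
lemma smooth_on_minus:
  "open S \<Longrightarrow> smooth_on S f \<Longrightarrow> smooth_on S (\<lambda>x. - f x)"
  by (rule smooth_on_linear_compose[OF _ bounded_linear_minus[OF bounded_linear_ident]])
lemma smooth_on_diff:
  "open S \<Longrightarrow> smooth_on S f \<Longrightarrow> smooth_on S g \<Longrightarrow> smooth_on S (\<lambda>x. f x - g x)"
  using smooth_on_add[of S f "\<lambda>x. - g x"] by (simp add: smooth_on_minus)
lemma smooth_on_mult:
  fixes f g :: "'v::real_normed_vector \<Rightarrow> real"
  shows "open S \<Longrightarrow> smooth_on S f \<Longrightarrow> smooth_on S g \<Longrightarrow> smooth_on S (\<lambda>x. f x * g x)"
  by (rule smooth_on_bilinear[OF _ bounded_bilinear_mult])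
lemma smooth_on_scaleR:
  "open S \<Longrightarrow> smooth_on S f \<Longrightarrow> smooth_on S g \<Longrightarrow> smooth_on S (\<lambda>x. f x *\<^sub>R g x)"
  by (rule smooth_on_bilinear[OF _ bounded_bilinear_scaleR])
lemma smooth_on_sum:
  "open S \<Longrightarrow> (\<And>i. i \<in> I \<Longrightarrow> smooth_on S (f i)) \<Longrightarrow> smooth_on S (\<lambda>x. \<Sum>i\<in>I. f i x)"
  by (simp add: smooth_on_def Ck_on_sum)
lemma smooth_on_prod:
  fixes f :: "'i \<Rightarrow> 'v::real_normed_vector \<Rightarrow> real"
  assumes "open S" "\<And>i. i \<in> I \<Longrightarrow> smooth_on S (f i)" shows "smooth_on S (\<lambda>x. \<Prod>i\<in>I. f i x)"
  using assms(2) by (induction I rule: infinite_finite_induct) 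
     (auto intro!: smooth_on_const smooth_on_mult \<open>open S\<close>)
lemma smooth_on_compose:
  fixes g :: "'b::euclidean_space \<Rightarrow> 'c::real_normed_vector"
  shows "open S \<Longrightarrow> smooth_on T g \<Longrightarrow> smooth_on S f \<Longrightarrow> f ` S \<subseteq> T \<Longrightarrow> smooth_on S (\<lambda>x. g (f x))"
  unfolding smooth_on_def using Ck_on_compose by blast
lemma smooth_on_inverse:
  fixes f :: "'v::real_normed_vector \<Rightarrow> real"
  shows "open S \<Longrightarrow> smooth_on S f \<Longrightarrow> (\<And>x. x \<in> S \<Longrightarrow> f x \<noteq> 0) \<Longrightarrow> smooth_on S (\<lambda>x. inverse (f x))"
  by (simp add: smooth_on_def Ck_on_inverse)

lemma smooth_on_has_derivative:
  "smooth_on S f \<Longrightarrow> x \<in> S \<Longrightarrow> (f has_derivative der f x) (at x)"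
  unfolding smooth_on_def using Ck_on_SucD(1) by blast
lemma smooth_on_der: "smooth_on S f \<Longrightarrow> smooth_on S (\<lambda>x. der f x v)"
  unfolding smooth_on_def using Ck_on_SucD(2) by blast
lemma smooth_on_linear_der: "smooth_on S f \<Longrightarrow> x \<in> S \<Longrightarrow> linear (der f x)"
  by (rule has_derivative_linear[OF smooth_on_has_derivative])

lemma smooth_on_der_field:
  fixes f :: "'v::euclidean_space \<Rightarrow> 'w::real_normed_vector"
  assumes "open S" "smooth_on S f" "smooth_on S X"
  shows "smooth_on S (\<lambda>x. der f x (X x))"
proof (rule smooth_on_cong[OF \<open>open S\<close>])
  show "(\<Sum>b\<in>Basis. (X x \<bullet> b) *\<^sub>R der f x b) = der f x (X x)" if "x \<in> S" for x
    by (rule linear_eq_sum_Basis[symmetric, OF smooth_on_linear_der[OF assms(2) that]])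
  show "smooth_on S (\<lambda>x. \<Sum>b\<in>Basis. (X x \<bullet> b) *\<^sub>R der f x b)"
    by (intro smooth_on_sum smooth_on_scaleR assms smooth_on_der smooth_on_linear_compose[OF _ bounded_linear_inner_left])
qed

lemma smooth_on_Pair:
  assumes "open S" "smooth_on S f" "smooth_on S g" shows "smooth_on S (\<lambda>x. (f x, g x))"
proof -
  have 1: "bounded_linear (\<lambda>x::'b. (x, 0::'c))" 
    by (intro bounded_linear_Pair bounded_linear_ident bounded_linear_zero)
  have 2: "bounded_linear (\<lambda>x::'c. (0::'b, x))" 
    by (intro bounded_linear_Pair bounded_linear_ident bounded_linear_zero)
  show ?thesis
    using smooth_on_add[OF assms(1) smooth_on_linear_compose[OF assms(1) 1 assms(2)] 
        smooth_on_linear_compose[OF assms(1) 2 assms(3)]] by simp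
qed

lemma linear_axis: "linear (axis i :: 'b::real_vector \<Rightarrow> 'b ^ 'n::finite)"
  by (auto intro!: linearI simp: axis_def vec_eq_iff)

lemma smooth_on_vec_lambda:
  fixes f :: "'n::finite \<Rightarrow> 'v::real_normed_vector \<Rightarrow> 'b::euclidean_space"
  assumes "open S" "\<And>i. smooth_on S (f i)" shows "smooth_on S (\<lambda>x. \<chi> i. f i x)"
proof -
  have "(\<chi> i. f i x) = (\<Sum>i\<in>UNIV. axis i (f i x))" for x
    by (simp add: vec_eq_iff axis_def if_distrib sum.delta cong: if_cong)
  then show ?thesis
    using smooth_on_sum[of S UNIV "\<lambda>i x. axis i (f i x)", OF assms(1) 
      smooth_on_linear_compose[OF assms(1) linear_linear[THEN iffD2, OF linear_axis] assms(2)]] by simp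
qed

lemma smooth_on_vec_nth: "open S \<Longrightarrow> smooth_on S f \<Longrightarrow> smooth_on S (\<lambda>x. f x $ i)"
  by (rule smooth_on_linear_compose[OF _ bounded_linear_vec_nth])

lemma smooth_on_det:
  fixes M :: "'v::real_normed_vector \<Rightarrow> real ^ 'n ^ 'n"
  assumes "open S" "smooth_on S M" shows "smooth_on S (\<lambda>x. det (M x))"
  unfolding det_def by (intro smooth_on_sum smooth_on_prod smooth_on_mult smooth_on_const smooth_on_vec_nth assms)

text \<open>Cramer's rule expresses the entries of the inverse as quotients of determinants.\<close>

lemma smooth_on_matrix_inv:
  fixes M :: "'v::real_normed_vector \<Rightarrow> real ^ 'n ^ 'n"
  assumes "open S" "smooth_on S M" "\<And>x. x \<in> S \<Longrightarrow> invertible (M x)"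
  shows "smooth_on S (\<lambda>x. matrix_inv (M x) $ l $ m)"
proof (rule smooth_on_cong[OF \<open>open S\<close>])
  fix x assume "x \<in> S"
  then have inv: "invertible (M x)" by (rule assms)
  then have d: "det (M x) \<noteq> 0" by (simp add: invertible_det_nz)
  have "M x ** matrix_inv (M x) = mat 1"
    by (rule someI2_ex[OF inv[unfolded invertible_def], of "\<lambda>A'. M x ** A' = mat 1", folded matrix_inv_def]) auto
  then have "M x *v (matrix_inv (M x) *v axis m 1) = axis m 1"
    by (simp add: matrix_vector_mul_assoc)
  then have "matrix_inv (M x) *v axis m 1 = (\<chi> k. det(\<chi> i j. if j=k then axis m 1 $ i else M x $i$j) / det (M x))"
    using cramer[OF d] by blast
  then have "(matrix_inv (M x) *v axis m 1) $ l = det(\<chi> i j. if j=l then axis m 1 $ i else M x $i$j) / det (M x)"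
    by simp
  then show "det(\<chi> i j. if j=l then axis m 1 $ i else M x $i$j) * inverse (det (M x)) = matrix_inv (M x) $ l $ m"
    by (simp add: matrix_vector_mult_basis column_def divide_inverse)
next
  have "smooth_on S (\<lambda>x. if j = l then axis m 1 $ i else M x $ i $ j)" for i j
    using assms by (cases "j = l") (auto intro!: smooth_on_const smooth_on_vec_nth)
  then show "smooth_on S (\<lambda>x. det(\<chi> i j. if j=l then axis m 1 $ i else M x $i$j) * inverse (det (M x)))"
    using assms by (intro smooth_on_mult smooth_on_det smooth_on_inverse smooth_on_vec_lambda)
      (auto simp: invertible_det_nz)
qed

section \<open>Second derivatives and Lie derivatives\<close>

lemma has_vector_derivative_line:
  assumes "smooth_on S f" "p + s *\<^sub>R u \<in> S"
  shows "((\<lambda>s. f (p + s *\<^sub>R u)) has_vector_derivative der f (p + s *\<^sub>R u) u) (at s)"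
proof -
  have "((\<lambda>s. p + s *\<^sub>R u) has_derivative (\<lambda>h. h *\<^sub>R u)) (at s)"
    by (auto intro!: derivative_eq_intros)
  from has_derivative_compose[OF this smooth_on_has_derivative[OF assms]]
  show ?thesis
    by (simp add: has_vector_derivative_def linear_cmul[OF smooth_on_linear_der[OF assms]])
qed

text \<open>The left side of the equation is symmetric in \<open>u\<close> and \<open>v\<close>, and the mean value theorem, applied along \<open>u\<close> and
then along \<open>v\<close>, turns it into a mixed second derivative near \<open>x\<close>. Letting \<open>h\<close> tend to \<open>0\<close> gives the symmetry of the
second derivative.\<close>

lemma second_difference_mvt:
  fixes f :: "'v::real_normed_vector \<Rightarrow> real"
  assumes "smooth_on S f" "ball x r \<subseteq> S" "0 < h" "h * (norm u + norm v) < r"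
  obtains s t where "0 < s" "s < h" "0 < t" "t < h"
    "f (x + h *\<^sub>R u + h *\<^sub>R v) - f (x + h *\<^sub>R u) - f (x + h *\<^sub>R v) + f x
      = h\<^sup>2 * der (\<lambda>y. der f y u) (x + s *\<^sub>R u + t *\<^sub>R v) v"
proof -
  have inS: "x + s *\<^sub>R u + t *\<^sub>R v \<in> S" if "0 \<le> s" "s \<le> h" "0 \<le> t" "t \<le> h" for s t
  proof -
    have "norm (s *\<^sub>R u + t *\<^sub>R v) \<le> s * norm u + t * norm v"
      using that norm_triangle_ineq[of "s *\<^sub>R u" "t *\<^sub>R v"] by simp
    also have "\<dots> \<le> h * norm u + h * norm v"
      using that by (intro add_mono mult_right_mono) auto
    also have "\<dots> < r" using assms(4) by (simp add: algebra_simps)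
    finally have "x + (s *\<^sub>R u + t *\<^sub>R v) \<in> ball x r" 
      unfolding mem_ball dist_commute[of x] by (simp add: dist_norm)
    then show ?thesis using assms(2) by (auto simp: add.assoc)
  qed
  have "DERIV (\<lambda>s. f ((x + h *\<^sub>R v) + s *\<^sub>R u) - f (x + s *\<^sub>R u)) s :> der f ((x + h *\<^sub>R v) + s *\<^sub>R u) u - der f (x + s *\<^sub>R u) u"
    if "0 \<le> s" "s \<le> h" for s
    unfolding has_real_derivative_iff_has_vector_derivative
    using inS[of s h] inS[of s 0] that assms(3)
    by (intro has_vector_derivative_diff has_vector_derivative_line[OF assms(1)]) (auto simp: algebra_simps)
  from MVT2[OF assms(3) this] obtain s where s: "0 < s" "s < h"
    and eq1: "(f ((x + h *\<^sub>R v) + h *\<^sub>R u) - f (x + h *\<^sub>R u)) - (f (x + h *\<^sub>R v) - f x)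
       = h * (der f ((x + h *\<^sub>R v) + s *\<^sub>R u) u - der f (x + s *\<^sub>R u) u)"
    by auto
  have "DERIV (\<lambda>t. der f ((x + s *\<^sub>R u) + t *\<^sub>R v) u) t :> der (\<lambda>y. der f y u) (x + s *\<^sub>R u + t *\<^sub>R v) v"
    if "0 \<le> t" "t \<le> h" for t
    unfolding has_real_derivative_iff_has_vector_derivative
    using inS[of s t] that s
    by (intro has_vector_derivative_line[where f = "\<lambda>y. der f y u", OF smooth_on_der[OF assms(1)]]) auto
  from MVT2[OF assms(3) this] obtain t where t: "0 < t" "t < h"
    and eq2: "der f ((x + s *\<^sub>R u) + h *\<^sub>R v) u - der f (x + s *\<^sub>R u) u = h * der (\<lambda>y. der f y u) (x + s *\<^sub>R u + t *\<^sub>R v) v"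
    by auto
  have "f (x + h *\<^sub>R u + h *\<^sub>R v) - f (x + h *\<^sub>R u) - f (x + h *\<^sub>R v) + f x
     = h * (h * der (\<lambda>y. der f y u) (x + s *\<^sub>R u + t *\<^sub>R v) v)"
    unfolding eq2[symmetric] using eq1 by (simp add: algebra_simps)
  then show thesis using that[OF s t] by (simp add: power2_eq_square mult.assoc)
qed

lemma second_derivative_symmetric_real:
  fixes f :: "'v::real_normed_vector \<Rightarrow> real"
  assumes "open S" "smooth_on S f" "x \<in> S"
  shows "der (\<lambda>y. der f y u) x v = der (\<lambda>y. der f y v) x u"
proof (rule ccontr)
  let ?a = "\<lambda>x. der (\<lambda>y. der f y u) x v" and ?b = "\<lambda>x. der (\<lambda>y. der f y v) x u"
  assume ne: "?a x \<noteq> ?b x"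
  define e where "e = \<bar>?a x - ?b x\<bar> / 2"
  have e: "0 < e" using ne by (simp add: e_def)
  have cont: "continuous (at x) (\<lambda>y. der (\<lambda>y. der f y u) y v)" for u v
    using has_derivative_continuous[OF smooth_on_has_derivative[OF smooth_on_der[OF smooth_on_der[OF assms(2)]] assms(3)]] .
  obtain d1 where d1: "d1 > 0" "\<And>y. dist y x < d1 \<Longrightarrow> dist (?a y) (?a x) < e"
    using cont[of u v, unfolded continuous_at_eps_delta, rule_format, OF e] by auto
  obtain d2 where d2: "d2 > 0" "\<And>y. dist y x < d2 \<Longrightarrow> dist (?b y) (?b x) < e"
    using cont[of v u, unfolded continuous_at_eps_delta, rule_format, OF e] by auto
  obtain r0 where r0: "r0 > 0" "ball x r0 \<subseteq> S" using assms(1,3) openE by blast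
  define r where "r = min r0 (min d1 d2)"
  have r: "r > 0" "ball x r \<subseteq> S" using r0 d1 d2 by (auto simp: r_def)
  define h where "h = r / (2 * (norm u + norm v + 1))"
  have den: "2 * (norm u + norm v + 1) > 0" by (simp add: add_nonneg_pos)
  have h: "0 < h" "h * (norm u + norm v) < r"
  proof -
    show "0 < h" using r den by (simp add: h_def)
    have "h * (norm u + norm v) \<le> h * (norm u + norm v + 1)" using \<open>0 < h\<close> by simp
    also have "\<dots> = r / 2" using den by (simp add: h_def field_simps)
    also have "\<dots> < r" using r by simp
    finally show "h * (norm u + norm v) < r" .
  qed
  have near: "dist (x + s *\<^sub>R u' + t *\<^sub>R v') x < r" 
    if "0 < s" "s < h" "0 < t" "t < h" "h * (norm u' + norm v') < r" for s t u' v'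
  proof -
    have "norm (s *\<^sub>R u' + t *\<^sub>R v') \<le> s * norm u' + t * norm v'"
      using that norm_triangle_ineq[of "s *\<^sub>R u'" "t *\<^sub>R v'"] by simp
    also have "\<dots> \<le> h * norm u' + h * norm v'"
      using that by (intro add_mono mult_right_mono) auto
    finally show ?thesis using that(5) by (simp add: dist_norm algebra_simps)
  qed
  obtain s t where st: "0 < s" "s < h" "0 < t" "t < h"
    "f (x + h *\<^sub>R u + h *\<^sub>R v) - f (x + h *\<^sub>R u) - f (x + h *\<^sub>R v) + f x = h\<^sup>2 * ?a (x + s *\<^sub>R u + t *\<^sub>R v)"
    by (rule second_difference_mvt[OF assms(2) r(2) h])
  have h': "h * (norm v + norm u) < r" using h by (simp add: add.commute)
  obtain s' t' where st': "0 < s'" "s' < h" "0 < t'" "t' < h"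
    "f (x + h *\<^sub>R v + h *\<^sub>R u) - f (x + h *\<^sub>R v) - f (x + h *\<^sub>R u) + f x = h\<^sup>2 * ?b (x + s' *\<^sub>R v + t' *\<^sub>R u)"
    by (rule second_difference_mvt[OF assms(2) r(2) h(1) h'])
  have "h\<^sup>2 * ?a (x + s *\<^sub>R u + t *\<^sub>R v) = h\<^sup>2 * ?b (x + s' *\<^sub>R v + t' *\<^sub>R u)"
    using st(5) st'(5) by (simp add: algebra_simps)
  then have eq: "?a (x + s *\<^sub>R u + t *\<^sub>R v) = ?b (x + s' *\<^sub>R v + t' *\<^sub>R u)" using h by simp
  have "dist (?a (x + s *\<^sub>R u + t *\<^sub>R v)) (?a x) < e"
    using near[OF st(1-4) h(2)] by (intro d1) (simp add: r_def)
  moreover have "dist (?b (x + s' *\<^sub>R v + t' *\<^sub>R u)) (?b x) < e"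
    using near[OF st'(1-4) h'] by (intro d2) (simp add: r_def)
  ultimately show False using eq unfolding dist_real_def e_def by argo
qed

lemma der_linear_compose:
  assumes "bounded_linear L" "(f has_derivative f') (at x)"
  shows "der (\<lambda>y. L (f y)) x v = L (f' v)"
  using der_eqI[OF bounded_linear.has_derivative[OF assms]] by simp

text \<open>The vector-valued case follows from the scalar one by testing against all vectors \<open>b\<close>.\<close>

lemma second_derivative_symmetric:
  fixes f :: "'v::real_normed_vector \<Rightarrow> 'w::real_inner"
  assumes "open S" "smooth_on S f" "x \<in> S"
  shows "der (\<lambda>y. der f y u) x v = der (\<lambda>y. der f y v) x u"
proof -
  have *: "der (\<lambda>y. der (\<lambda>y. f y \<bullet> b) y u) x v = der (\<lambda>y. der f y u) x v \<bullet> b" for b u v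
  proof -
    have "der (\<lambda>y. f y \<bullet> b) y u = der f y u \<bullet> b" if "y \<in> S" for y
      by (rule der_linear_compose[OF bounded_linear_inner_left smooth_on_has_derivative[OF assms(2) that]])
    note eq = this
    have "((\<lambda>y. der f y u \<bullet> b) has_derivative (\<lambda>v. der (\<lambda>y. der f y u) x v \<bullet> b)) (at x)"
      by (rule bounded_linear.has_derivative[OF bounded_linear_inner_left
            smooth_on_has_derivative[OF smooth_on_der[OF assms(2)] assms(3)]])
    then have "((\<lambda>y. der (\<lambda>y. f y \<bullet> b) y u) has_derivative (\<lambda>v. der (\<lambda>y. der f y u) x v \<bullet> b)) (at x)"
      by (rule has_derivative_transform_within_open[OF _ assms(1,3)]) (rule eq[symmetric])
    from der_eqI[OF this] show ?thesis by simp
  qed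
  have "der (\<lambda>y. der f y u) x v \<bullet> b = der (\<lambda>y. der f y v) x u \<bullet> b" for b
    unfolding *[symmetric] 
    by (rule second_derivative_symmetric_real[OF assms(1) smooth_on_linear_compose[OF assms(1) bounded_linear_inner_left assms(2)] assms(3)])
  then show ?thesis using vector_eq_rdot by blast
qed

text \<open>With base point and direction both varying, one formula covers the derivative of a Lie derivative and the
derivative of a coordinate change acting on tangent vectors.\<close>

lemma has_derivative_der:
  fixes f :: "'v::euclidean_space \<Rightarrow> 'w::real_normed_vector"
  assumes "open S" "smooth_on S f" "y \<in> S"
  shows "((\<lambda>p. der f (fst p) (snd p)) has_derivative 
     (\<lambda>q. der (\<lambda>x. der f x w) y (fst q) + der f y (snd q))) (at (y, w))"
proof -
  have lin: "der f x z = (\<Sum>b\<in>Basis. (z \<bullet> b) *\<^sub>R der f x b)" if "x \<in> S" for x z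
    by (rule linear_eq_sum_Basis[OF smooth_on_linear_der[OF assms(2) that]])
  have d: "((\<lambda>x. der f x b) has_derivative der (\<lambda>x. der f x b) y) (at y)" for b
    by (rule smooth_on_has_derivative[OF smooth_on_der[OF assms(2)] assms(3)])
  have "((\<lambda>p. \<Sum>b\<in>Basis. (snd p \<bullet> b) *\<^sub>R der f (fst p) b) has_derivative
     (\<lambda>q. \<Sum>b\<in>Basis. (w \<bullet> b) *\<^sub>R der (\<lambda>x. der f x b) y (fst q) + (snd q \<bullet> b) *\<^sub>R der f y b)) (at (y, w))"
  proof (rule has_derivative_sum)
    fix b :: 'v
    have 1: "((\<lambda>p. snd p \<bullet> b) has_derivative (\<lambda>q. snd q \<bullet> b)) (at (y, w))"
      by (rule has_derivative_inner_left[OF has_derivative_snd[OF has_derivative_ident]])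
    have 2: "((\<lambda>p. der f (fst p) b) has_derivative (\<lambda>q. der (\<lambda>x. der f x b) y (fst q))) (at (y, w))"
      using has_derivative_compose[OF has_derivative_fst[OF has_derivative_ident], of _ _ "(y, w)" UNIV] d
      by auto
    show "((\<lambda>p. (snd p \<bullet> b) *\<^sub>R der f (fst p) b) has_derivative
       (\<lambda>q. (w \<bullet> b) *\<^sub>R der (\<lambda>x. der f x b) y (fst q) + (snd q \<bullet> b) *\<^sub>R der f y b)) (at (y, w))"
      using has_derivative_scaleR[OF 1 2] by simp
  qed
  moreover have "der (\<lambda>x. der f x w) y v = (\<Sum>b\<in>Basis. (w \<bullet> b) *\<^sub>R der (\<lambda>x. der f x b) y v)" for v
  proof -
    have "((\<lambda>x. \<Sum>b\<in>Basis. (w \<bullet> b) *\<^sub>R der f x b) has_derivative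
       (\<lambda>v. \<Sum>b\<in>Basis. (w \<bullet> b) *\<^sub>R der (\<lambda>x. der f x b) y v)) (at y)"
      by (rule has_derivative_sum[OF has_derivative_scaleR_right[OF d]])
    then have "((\<lambda>x. der f x w) has_derivative
       (\<lambda>v. \<Sum>b\<in>Basis. (w \<bullet> b) *\<^sub>R der (\<lambda>x. der f x b) y v)) (at y)"
      by (rule has_derivative_transform_within_open[OF _ assms(1,3)]) (simp add: lin[symmetric])
    from der_eqI[OF this] show ?thesis by simp
  qed
  ultimately have "((\<lambda>p. \<Sum>b\<in>Basis. (snd p \<bullet> b) *\<^sub>R der f (fst p) b) has_derivative
     (\<lambda>q. der (\<lambda>x. der f x w) y (fst q) + der f y (snd q))) (at (y, w))"
    using lin[OF assms(3), symmetric] by (simp add: sum.distrib)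
  then show ?thesis
    by (rule has_derivative_transform_within_open[where s = "S \<times> UNIV"]) 
      (use assms lin[symmetric] in \<open>auto intro: open_Times\<close>)
qed

definition lie :: "('v::real_normed_vector \<Rightarrow> 'v) \<Rightarrow> ('v \<Rightarrow> 'w::real_normed_vector) \<Rightarrow> 'v \<Rightarrow> 'w" where
  "lie X h x = der h x (X x)"

lemma smooth_on_lie:
  fixes f :: "'v::euclidean_space \<Rightarrow> 'w::real_normed_vector"
  shows "open S \<Longrightarrow> smooth_on S X \<Longrightarrow> smooth_on S f \<Longrightarrow> smooth_on S (lie X f)"
  unfolding lie_def by (rule smooth_on_der_field)

lemma lie_cong:
  assumes "open S" "smooth_on S f" "\<And>x. x \<in> S \<Longrightarrow> f x = g x" "x \<in> S"
  shows "lie X f x = lie X g x"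
  unfolding lie_def
  using has_derivative_transform_within_open[OF smooth_on_has_derivative[OF assms(2,4)] assms(1,4,3)]
  by (simp add: der_eqI)

lemma lie_add: 
  assumes "smooth_on S f" "smooth_on S g" "x \<in> S"
  shows "lie X (\<lambda>x. f x + g x) x = lie X f x + lie X g x"
  unfolding lie_def 
  using der_eqI[OF has_derivative_add[OF assms(1,2)[THEN smooth_on_has_derivative, OF assms(3)]]] by simp

lemma lie_mult: 
  fixes f g :: "'v::real_normed_vector \<Rightarrow> real"
  assumes "smooth_on S f" "smooth_on S g" "x \<in> S"
  shows "lie X (\<lambda>x. f x * g x) x = lie X f x * g x + f x * lie X g x"
  unfolding lie_def 
  by (subst der_eqI[OF has_derivative_mult[OF assms(1,2)[THEN smooth_on_has_derivative, OF assms(3)]]]) simp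

lemma lie_cmult: 
  fixes f :: "'v::real_normed_vector \<Rightarrow> real"
  assumes "smooth_on S f" "x \<in> S"
  shows "lie X (\<lambda>x. c * f x) x = c * lie X f x"
  unfolding lie_def 
  by (rule der_linear_compose[OF bounded_linear_mult_right smooth_on_has_derivative[OF assms]])

lemma lie_sum: 
  assumes "\<And>i. i \<in> I \<Longrightarrow> smooth_on S (f i)" "x \<in> S"
  shows "lie X (\<lambda>x. \<Sum>i\<in>I. f i x) x = (\<Sum>i\<in>I. lie X (f i) x)"
  unfolding lie_def 
  by (subst der_eqI[OF has_derivative_sum[OF smooth_on_has_derivative[OF assms]]]) simp_all

text \<open>Both iterated derivatives contain the second derivative of \<open>f\<close> in the directions \<open>X\<close> and \<open>Y\<close>, which cancels by
symmetry. What remains is the derivative along the Lie bracket of the fields.\<close>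

lemma lie_commutator:
  fixes f :: "'v::euclidean_space \<Rightarrow> real"
  assumes "open S" "smooth_on S f" "smooth_on S X" "smooth_on S Y" "x \<in> S"
  shows "lie X (lie Y f) x - lie Y (lie X f) x = der f x (der Y x (X x) - der X x (Y x))"
proof -
  have *: "lie X (lie Y f) x = der (\<lambda>y. der f y (Y x)) x (X x) + der f x (der Y x (X x))" 
    if Y: "smooth_on S Y" for X Y
  proof -
    have "((\<lambda>y. (y, Y y)) has_derivative (\<lambda>v. (v, der Y x v))) (at x)"
      by (intro has_derivative_Pair has_derivative_ident smooth_on_has_derivative[OF Y assms(5)])
    from has_derivative_compose[OF this has_derivative_der[OF assms(1,2,5)]]
    show ?thesis unfolding lie_def by (subst der_eqI) auto
  qed
  show ?thesis
    unfolding *[OF assms(4)] *[OF assms(3)]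
    by (simp add: linear_diff[OF smooth_on_linear_der[OF assms(2,5)]]
      second_derivative_symmetric_real[OF assms(1,2,5), of "Y x" "X x"])
qed

section \<open>Metric and Christoffel symbols in a chart\<close>

text \<open>Metrics are handled as the forms \<open>u \<bullet> (B *v v)\<close>; bilinearity gives their derivatives by the product rule.\<close>

lemma bounded_bilinear_matrix_vector_mult:
  "bounded_bilinear ((*v) :: real ^ 'n::finite ^ 'm::finite \<Rightarrow> real ^ 'n \<Rightarrow> real ^ 'm)"
  unfolding bilinear_conv_bounded_bilinear[symmetric] bilinear_def
  by (auto intro!: linearI simp: matrix_vector_mult_add_rdistrib vec.add vec.scale 
      matrix_vector_mult_def vec_eq_iff sum.distrib distrib_right sum_distrib_left algebra_simps)

lemma matrix_form_commute:
  fixes B :: "real ^ 'n::finite ^ 'n"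
  assumes "transpose B = B" shows "u \<bullet> (B *v v) = v \<bullet> (B *v u)"
  by (metis assms dot_lmul_matrix inner_commute transpose_matrix_vector)

lemma matrix_form_expand:
  fixes B :: "real ^ 'n::finite ^ 'm::finite"
  shows "u \<bullet> (B *v v) = (\<Sum>i\<in>UNIV. \<Sum>j\<in>UNIV. u $ i * B $ i $ j * v $ j)"
  by (simp add: inner_vec_def matrix_vector_mult_def sum_distrib_left mult.assoc)

lemma vec_linear_expand:
  fixes L :: "real ^ 'n::finite \<Rightarrow> 'c::real_vector"
  assumes "linear L" shows "L u = (\<Sum>k\<in>UNIV. (u $ k) *\<^sub>R L (axis k 1))"
proof -
  have "u = (\<Sum>k\<in>UNIV. (u $ k) *\<^sub>R axis k 1)"
    by (simp add: vec_eq_iff axis_def if_distrib cong: if_cong)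
  then have "L u = L (\<Sum>k\<in>UNIV. (u $ k) *\<^sub>R axis k 1)" by simp
  then show ?thesis by (simp add: linear_sum[OF assms] linear_cmul[OF assms])
qed

type_synonym ('a, 'n) frame_fun = "'a \<times> ('n \<Rightarrow> ('a, 'n) tvec) \<Rightarrow> real"
type_synonym 'n coords = "(real, 'n) vec"

locale riemannian =
  fixes M :: "'a topology" and A :: "('a, 'n::{finite,zero}) chart set" and g :: "('a, 'n) metric"
  assumes manifold: "smooth_manifold M A" and metric: "riemannian_metric A g"
begin

definition overlap :: "('a, 'n) chart \<Rightarrow> ('a, 'n) chart \<Rightarrow> ('n coords) set" where
  "overlap c d = cmap c ` (cdom c \<inter> cdom d)"

abbreviation "U c \<equiv> cmap c ` cdom c"
abbreviation "G \<equiv> metric_matrix A g"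
abbreviation "dtr c d y \<equiv> der (transition c d) y"

lemma inj_cmap: "c \<in> A \<Longrightarrow> inj_on (cmap c) (cdom c)"
  and openin_cdom: "c \<in> A \<Longrightarrow> openin M (cdom c)"
  and open_U: "c \<in> A \<Longrightarrow> open (U c)"
proof -
  assume c: "c \<in> A"
  show o: "openin M (cdom c)" using manifold c unfolding smooth_manifold_def by blast
  show "open (U c)" using manifold c unfolding smooth_manifold_def by blast
  have "homeomorphic_map (subtopology M (cdom c)) (top_of_set (U c)) (cmap c)"
    using manifold c unfolding smooth_manifold_def by blast
  from homeomorphic_imp_injective_map[OF this] show "inj_on (cmap c) (cdom c)"
    using openin_subset[OF o] by (simp add: topspace_subtopology Int_absorb1)
qed

lemma cinv_cmap [simp]: "c \<in> A \<Longrightarrow> x \<in> cdom c \<Longrightarrow> cinv c (cmap c x) = x"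
  by (simp add: cinv_def inj_cmap)

lemma cmap_cinv [simp]: "y \<in> U c \<Longrightarrow> cmap c (cinv c y) = y"
  unfolding cinv_def by (rule f_inv_into_f)

lemma cinv_in_cdom: "y \<in> U c \<Longrightarrow> cinv c y \<in> cdom c"
  unfolding cinv_def by (rule inv_into_into)

lemma open_overlap:
  assumes c: "c \<in> A" and d: "d \<in> A" shows "open (overlap c d)"
proof -
  have h: "homeomorphic_map (subtopology M (cdom c)) (top_of_set (U c)) (cmap c)"
    using manifold c unfolding smooth_manifold_def by blast
  have "openin (subtopology M (cdom c)) (cdom c \<inter> cdom d)"
    using openin_cdom[OF d] by (auto simp: openin_subtopology)
  then have "openin (top_of_set (U c)) (overlap c d)"
    using homeomorphic_imp_open_map[OF h] unfolding open_map_def overlap_def by blast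
  then show ?thesis using open_U[OF c] openin_open_eq by blast
qed

lemma overlap_subset: "overlap c d \<subseteq> U c" by (auto simp: overlap_def)

lemma transition_cmap [simp]: "c \<in> A \<Longrightarrow> x \<in> cdom c \<Longrightarrow> transition c d (cmap c x) = cmap d x"
  by (simp add: transition_def)

lemma smooth_transition: "c \<in> A \<Longrightarrow> d \<in> A \<Longrightarrow> smooth_on (overlap c d) (transition c d)"
  using manifold unfolding smooth_manifold_def overlap_def by blast

lemma has_derivative_transition:
  "c \<in> A \<Longrightarrow> d \<in> A \<Longrightarrow> x \<in> cdom c \<Longrightarrow> x \<in> cdom d \<Longrightarrow>
     (transition c d has_derivative dtr c d (cmap c x)) (at (cmap c x))"
  by (rule smooth_on_has_derivative[OF smooth_transition]) (auto simp: overlap_def)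

lemma linear_dtr:
  "c \<in> A \<Longrightarrow> d \<in> A \<Longrightarrow> x \<in> cdom c \<Longrightarrow> x \<in> cdom d \<Longrightarrow> linear (dtr c d (cmap c x))"
  by (rule has_derivative_linear[OF has_derivative_transition])

lemma dtr_chain:
  assumes c: "c \<in> A" "x \<in> cdom c" and d: "d \<in> A" "x \<in> cdom d" and e: "e \<in> A" "x \<in> cdom e"
  shows "dtr d e (cmap d x) (dtr c d (cmap c x) u) = dtr c e (cmap c x) u"
proof -
  have "((\<lambda>y. transition d e (transition c d y)) has_derivative 
      (\<lambda>u. dtr d e (cmap d x) (dtr c d (cmap c x) u))) (at (cmap c x))"
    using has_derivative_compose[OF has_derivative_transition[OF c(1) d(1) c(2) d(2)], of "transition d e"]
      has_derivative_transition[OF d(1) e(1) d(2) e(2)] c by simp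
  then have "(transition c e has_derivative 
      (\<lambda>u. dtr d e (cmap d x) (dtr c d (cmap c x) u))) (at (cmap c x))"
  proof (rule has_derivative_transform_within_open[OF _ open_overlap[OF c(1) d(1)]])
    show "cmap c x \<in> overlap c d" using c d by (auto simp: overlap_def)
    show "transition d e (transition c d y) = transition c e y" if "y \<in> overlap c d" for y
      using that c d by (auto simp: overlap_def)
  qed
  from der_eqI[OF this] show ?thesis by simp
qed

lemma dtr_self:
  assumes c: "c \<in> A" "x \<in> cdom c" shows "dtr c c (cmap c x) u = u"
proof -
  have "(transition c c has_derivative (\<lambda>u. u)) (at (cmap c x))"
    by (rule has_derivative_transform_within_open[OF has_derivative_ident open_overlap[OF c(1) c(1)]])
      (use c in \<open>auto simp: overlap_def\<close>)
  from der_eqI[OF this] show ?thesis by simp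
qed

lemma tvec_of_nth:
  "d \<in> A \<Longrightarrow> x \<in> cdom d \<Longrightarrow> tvec_of A c x u d = dtr c d (cmap c x) u"
  by (simp add: tvec_of_def)

lemma tvec_of_in_tangent_space: "c \<in> A \<Longrightarrow> x \<in> cdom c \<Longrightarrow> tvec_of A c x u \<in> tangent_space A x"
  by (auto simp: tangent_space_def tvec_of_def dtr_chain)

lemma tangent_space_trans:
  "v \<in> tangent_space A x \<Longrightarrow> c \<in> A \<Longrightarrow> x \<in> cdom c \<Longrightarrow> d \<in> A \<Longrightarrow> x \<in> cdom d \<Longrightarrow>
     v d = dtr c d (cmap c x) (v c)"
  unfolding tangent_space_def by blast

lemma tvec_of_tangent:
  assumes "v \<in> tangent_space A x" "c \<in> A" "x \<in> cdom c" shows "tvec_of A c x (v c) = v"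
proof
  fix d show "tvec_of A c x (v c) d = v d"
  proof (cases "d \<in> A \<and> x \<in> cdom d")
    case True
    then show ?thesis using tangent_space_trans[OF assms, of d] by (simp add: tvec_of_def)
  next
    case False
    then have "v d = 0" using assms(1) unfolding tangent_space_def by blast
    with False show ?thesis by (simp only: tvec_of_def if_False)
  qed
qed

lemma tvec_of_trans:
  assumes "c \<in> A" "x \<in> cdom c" "d \<in> A" "x \<in> cdom d" 
  shows "tvec_of A d x (dtr c d (cmap c x) u) = tvec_of A c x u"
  using assms by (auto simp: tvec_of_def dtr_chain)

lemma metric_coords:
  assumes "c \<in> A" "x \<in> cdom c"
  shows "g x (tvec_of A c x u) (tvec_of A c x v) = u \<bullet> (G c (cmap c x) *v v)"
proof -
  let ?b = "\<lambda>u v. g x (tvec_of A c x u) (tvec_of A c x v)"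
  have "bilinear ?b" using metric assms unfolding riemannian_metric_def by blast
  then have l: "linear (?b u)" "linear (\<lambda>u. ?b u v)" for u v by (auto simp: bilinear_def)
  have "?b u v = (\<Sum>k\<in>UNIV. u $ k * (\<Sum>l\<in>UNIV. v $ l * ?b (axis k 1) (axis l 1)))"
    using vec_linear_expand[OF l(2), of u v] vec_linear_expand[OF l(1), of _ v] by simp
  also have "\<dots> = u \<bullet> (G c (cmap c x) *v v)"
    using assms by (simp add: matrix_form_expand metric_matrix_def sum_distrib_left mult_ac)
  finally show ?thesis .
qed

lemma metric_tangent:
  assumes "c \<in> A" "x \<in> cdom c" "u \<in> tangent_space A x" "v \<in> tangent_space A x"
  shows "g x u v = u c \<bullet> (G c (cmap c x) *v v c)"
  using metric_coords[OF assms(1,2), of "u c" "v c"] assms by (simp add: tvec_of_tangent)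

lemma G_sym: "c \<in> A \<Longrightarrow> y \<in> U c \<Longrightarrow> transpose (G c y) = G c y"
  using metric cinv_in_cdom[of y c]
  by (auto simp: riemannian_metric_def vec_eq_iff transpose_def metric_matrix_def)

lemma G_pos: assumes "c \<in> A" "y \<in> U c" "u \<noteq> 0" shows "0 < u \<bullet> (G c y *v u)"
proof -
  have "0 < g (cinv c y) (tvec_of A c (cinv c y) u) (tvec_of A c (cinv c y) u)"
    using metric assms cinv_in_cdom[of y c] unfolding riemannian_metric_def by blast
  then show ?thesis using metric_coords[OF assms(1) cinv_in_cdom[OF assms(2)], of u u] assms by simp
qed

lemma G_cancel:
  assumes "c \<in> A" "y \<in> U c" "\<And>w. w \<bullet> (G c y *v u) = 0" shows "u = 0"
  using G_pos[OF assms(1,2), of u] assms(3)[of u] by force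

lemma G_invertible: assumes "c \<in> A" "y \<in> U c" shows "invertible (G c y)"
proof -
  have "u = 0" if "G c y *v u = 0" for u
    using G_cancel[OF assms, of u] that by simp
  then show ?thesis by (simp add: invertible_left_inverse matrix_left_invertible_ker)
qed

lemma G_inv: assumes "c \<in> A" "y \<in> U c" shows "G c y ** matrix_inv (G c y) = mat 1"
  by (rule someI2_ex[OF G_invertible[OF assms, unfolded invertible_def], 
        of "\<lambda>A'. G c y ** A' = mat 1", folded matrix_inv_def]) auto

lemma smooth_G: assumes "c \<in> A" shows "smooth_on (U c) (G c)"
proof -
  have "smooth_on (U c) (\<lambda>y. \<chi> k l. G c y $ k $ l)"
    using metric assms unfolding riemannian_metric_def
    by (intro smooth_on_vec_lambda open_U) auto
  then show ?thesis by simp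
qed

abbreviation "dG c y \<equiv> der (G c) y"

lemma has_derivative_G: "c \<in> A \<Longrightarrow> y \<in> U c \<Longrightarrow> (G c has_derivative dG c y) (at y)"
  by (rule smooth_on_has_derivative[OF smooth_G])

lemma linear_dG: "c \<in> A \<Longrightarrow> y \<in> U c \<Longrightarrow> linear (dG c y)"
  by (rule has_derivative_linear[OF has_derivative_G])

lemma partial_G: 
  assumes "c \<in> A" "y \<in> U c" shows "partial p (\<lambda>z. G c z $ i $ j) y = dG c y (axis p 1) $ i $ j"
  unfolding partial_def
  by (rule der_linear_compose[OF bounded_linear_compose[OF bounded_linear_vec_nth bounded_linear_vec_nth]
      has_derivative_G[OF assms]])

lemma dG_sym: assumes "c \<in> A" "y \<in> U c" shows "transpose (dG c y w) = dG c y w"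
proof -
  have "(G c has_derivative (\<lambda>w. transpose (dG c y w))) (at y)"
  proof (rule has_derivative_transform_within_open[OF _ open_U[OF assms(1)] assms(2)])
    have "linear (transpose :: ('n coords, 'n) vec \<Rightarrow> _)"
      by (auto intro!: linearI simp: transpose_def vec_eq_iff)
    then show "((\<lambda>z. transpose (G c z)) has_derivative (\<lambda>w. transpose (dG c y w))) (at y)"
      by (intro bounded_linear.has_derivative[OF _ has_derivative_G[OF assms]]) (simp add: linear_linear)
  qed (simp add: G_sym assms)
  from der_eqI[OF this] show ?thesis by metis
qed

text \<open>As a bilinear map the Christoffel symbols satisfy index-free identities, and the horizontal field \<open>H_i\<close> becomes
\<open>(E_i, - Gam E_k E_i)\<close>.\<close>

definition Gam :: "('a, 'n) chart \<Rightarrow> 'n coords \<Rightarrow> 'n coords \<Rightarrow> 'n coords \<Rightarrow> 'n coords" where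
  "Gam c y u v = (\<chi> l. \<Sum>p\<in>UNIV. \<Sum>q\<in>UNIV. christoffel A g c l p q y * u $ p * v $ q)"

lemma smooth_christoffel:
  assumes "c \<in> A" shows "smooth_on (U c) (christoffel A g c l p q)"
proof -
  note o = open_U[OF assms]
  have pd: "smooth_on (U c) (\<lambda>y. partial k (\<lambda>z. G c z $ i $ j) y)" for i j k
    unfolding partial_def
    by (intro smooth_on_der smooth_on_vec_nth[OF o] smooth_G assms)
  show ?thesis
    unfolding christoffel_def[abs_def] Let_def
    by (intro smooth_on_mult[OF o] smooth_on_const[OF o] smooth_on_sum[OF o] smooth_on_diff[OF o] 
        smooth_on_add[OF o] pd smooth_on_matrix_inv[OF o] smooth_G assms G_invertible)
qed

text \<open>Lowering the index \<open>l\<close> with the metric cancels the inverse matrix in the definition of the Christoffel symbols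
and leaves the Koszul formula. Symmetry and compatibility with the metric are consequences of it.\<close>

lemma koszul:
  assumes c: "c \<in> A" and y: "y \<in> U c"
  shows "w \<bullet> (G c y *v Gam c y u v) = 
    (w \<bullet> (dG c y u *v v) + u \<bullet> (dG c y v *v w) - u \<bullet> (dG c y w *v v)) / 2"
proof -
  let ?S = "\<lambda>f. \<Sum>i\<in>UNIV. \<Sum>p\<in>UNIV. \<Sum>q\<in>UNIV. w $ i * u $ p * v $ q * (f i p q :: real)"
  define D where "D p = dG c y (axis p 1)" for p
  define K where "K m p q = D p $ m $ q + D q $ p $ m - D m $ p $ q" for m p q
  have chr: "christoffel A g c l p q y = (1/2) * (\<Sum>m\<in>UNIV. matrix_inv (G c y) $ l $ m * K m p q)" for l p q
    unfolding christoffel_def Let_def K_def D_def partial_G[OF c y] ..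
  have low: "(\<Sum>l\<in>UNIV. G c y $ i $ l * christoffel A g c l p q y) = K i p q / 2" for i p q
  proof -
    have "(\<Sum>l\<in>UNIV. G c y $ i $ l * christoffel A g c l p q y) 
       = (G c y *v (matrix_inv (G c y) *v (\<chi> m. K m p q / 2))) $ i"
      unfolding chr by (simp add: matrix_vector_mult_def sum_divide_distrib)
    then show ?thesis by (simp add: matrix_vector_mul_assoc G_inv[OF c y])
  qed
  have dGe: "dG c y u $ i $ j = (\<Sum>p\<in>UNIV. u $ p * D p $ i $ j)" for u i j
    using vec_linear_expand[OF linear_dG[OF c y], of u] by (simp add: D_def sum_component)
  have "w \<bullet> (G c y *v Gam c y u v) 
     = (\<Sum>i\<in>UNIV. \<Sum>l\<in>UNIV. \<Sum>p\<in>UNIV. \<Sum>q\<in>UNIV. w $ i * u $ p * v $ q * (G c y $ i $ l * christoffel A g c l p q y))"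
    unfolding matrix_form_expand Gam_def by (simp add: sum_distrib_left mult_ac)
  also have "\<dots> = (\<Sum>i\<in>UNIV. \<Sum>p\<in>UNIV. \<Sum>l\<in>UNIV. \<Sum>q\<in>UNIV. w $ i * u $ p * v $ q * (G c y $ i $ l * christoffel A g c l p q y))"
    by (rule sum.cong[OF refl sum.swap])
  also have "\<dots> = (\<Sum>i\<in>UNIV. \<Sum>p\<in>UNIV. \<Sum>q\<in>UNIV. \<Sum>l\<in>UNIV. w $ i * u $ p * v $ q * (G c y $ i $ l * christoffel A g c l p q y))"
    by (intro sum.cong[OF refl] sum.swap)
  also have "\<dots> = ?S (\<lambda>i p q. K i p q / 2)"
    by (simp add: sum_distrib_left[symmetric] low)
  also have "\<dots> = (?S (\<lambda>i p q. D p $ i $ q) 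
     + ?S (\<lambda>i p q. D q $ p $ i)
     - ?S (\<lambda>i p q. D i $ p $ q)) / 2"
    unfolding K_def by (simp add: sum.distrib sum_subtractf sum_divide_distrib algebra_simps add_divide_distrib diff_divide_distrib)
  also have "?S (\<lambda>i p q. D p $ i $ q) = w \<bullet> (dG c y u *v v)"
  proof -
    have "w \<bullet> (dG c y u *v v) = (\<Sum>i\<in>UNIV. \<Sum>q\<in>UNIV. \<Sum>p\<in>UNIV. w $ i * u $ p * v $ q * D p $ i $ q)"
      unfolding matrix_form_expand dGe by (simp add: sum_distrib_left sum_distrib_right mult_ac)
    also have "\<dots> = ?S (\<lambda>i p q. D p $ i $ q)"
      by (rule sum.cong[OF refl sum.swap])
    finally show ?thesis by simp
  qed
  also have "?S (\<lambda>i p q. D q $ p $ i) = u \<bullet> (dG c y v *v w)"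
  proof -
    have "u \<bullet> (dG c y v *v w) = (\<Sum>p\<in>UNIV. \<Sum>i\<in>UNIV. \<Sum>q\<in>UNIV. w $ i * u $ p * v $ q * D q $ p $ i)"
      unfolding matrix_form_expand dGe by (simp add: sum_distrib_left sum_distrib_right mult_ac)
    also have "\<dots> = ?S (\<lambda>i p q. D q $ p $ i)"
      by (rule sum.swap)
    finally show ?thesis by simp
  qed
  also have "?S (\<lambda>i p q. D i $ p $ q) = u \<bullet> (dG c y w *v v)"
  proof -
    have "u \<bullet> (dG c y w *v v) = (\<Sum>p\<in>UNIV. \<Sum>q\<in>UNIV. \<Sum>i\<in>UNIV. w $ i * u $ p * v $ q * D i $ p $ q)"
      unfolding matrix_form_expand dGe by (simp add: sum_distrib_left sum_distrib_right mult_ac)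
    also have "\<dots> = (\<Sum>p\<in>UNIV. \<Sum>i\<in>UNIV. \<Sum>q\<in>UNIV. w $ i * u $ p * v $ q * D i $ p $ q)"
      by (rule sum.cong[OF refl sum.swap])
    also have "\<dots> = ?S (\<lambda>i p q. D i $ p $ q)"
      by (rule sum.swap)
    finally show ?thesis by simp
  qed
  finally show ?thesis .
qed

lemma Gam_sym: 
  assumes c: "c \<in> A" and y: "y \<in> U c" shows "Gam c y u v = Gam c y v u"
proof -
  have dGc: "a \<bullet> (dG c y b *v d) = d \<bullet> (dG c y b *v a)" for a b d
    by (rule matrix_form_commute[OF dG_sym[OF c y]])
  have "w \<bullet> (G c y *v Gam c y u v) = w \<bullet> (G c y *v Gam c y v u)" for w
    unfolding koszul[OF c y]
    using dGc[of w u v] dGc[of u v w] dGc[of u w v] by simp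
  then have "Gam c y u v - Gam c y v u = 0"
    by (intro G_cancel[OF c y]) (simp add: vec.diff inner_diff_right)
  then show ?thesis by simp
qed

text \<open>This says that the metric is parallel. It makes the horizontal fields tangent to the set of orthonormal frames.\<close>

lemma Gam_metric:
  assumes c: "c \<in> A" and y: "y \<in> U c" 
  shows "u \<bullet> (dG c y w *v v) = Gam c y u w \<bullet> (G c y *v v) + u \<bullet> (G c y *v Gam c y v w)"
proof -
  have "Gam c y u w \<bullet> (G c y *v v) = v \<bullet> (G c y *v Gam c y w u)"
    unfolding Gam_sym[OF c y, of u w] by (rule matrix_form_commute[OF G_sym[OF c y]])
  moreover have "u \<bullet> (dG c y w *v v) = v \<bullet> (dG c y w *v u)"
    by (rule matrix_form_commute[OF dG_sym[OF c y]])
  ultimately show ?thesis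
    unfolding Gam_sym[OF c y, of v w]
    using koszul[OF c y, of v w u] koszul[OF c y, of u w v] by simp
qed

end

section \<open>Orthonormalisation along a curve\<close>

text \<open>Curves \<open>a i\<close> that start orthonormal and remain so to first order can be made orthonormal near \<open>0\<close> without a
change of their velocities: the projections that Gram-Schmidt subtracts, and the change of the norm, vanish
to first order. In this way a curve of frames with a prescribed velocity is obtained by an elementary construction,
with neither parallel transport nor an implicit function theorem.\<close>

lemma gram_schmidt_curve:
  fixes a :: "'i \<Rightarrow> real \<Rightarrow> real ^ 'n::finite" and S :: "real \<Rightarrow> real ^ 'n ^ 'n"
  assumes "finite I"
    and sym: "\<forall>\<^sub>F t in nhds 0. transpose (S t) = S t"
    and S: "(S has_vector_derivative S') (at 0)"
    and "\<And>i. i \<in> I \<Longrightarrow> (a i has_vector_derivative a' i) (at 0)"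
    and "\<And>i j. i \<in> I \<Longrightarrow> j \<in> I \<Longrightarrow> a i 0 \<bullet> (S 0 *v a j 0) = (if i = j then 1 else 0)"
    and "\<And>i j. i \<in> I \<Longrightarrow> j \<in> I \<Longrightarrow>
      a' i \<bullet> (S 0 *v a j 0) + a i 0 \<bullet> (S' *v a j 0) + a i 0 \<bullet> (S 0 *v a' j) = 0"
  shows "\<exists>e. (\<forall>i\<in>I. e i 0 = a i 0 \<and> (e i has_vector_derivative a' i) (at 0)) \<and>
    (\<forall>\<^sub>F t in nhds 0. \<forall>i\<in>I. \<forall>j\<in>I. e i t \<bullet> (S t *v e j t) = (if i = j then 1 else 0))"
  using assms(1,4-)
proof (induction I)
  case empty then show ?case by simp
next
  case (insert k I)
  have D: "((\<lambda>t. u t \<bullet> (S t *v w t)) has_vector_derivative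
      (u' \<bullet> (S 0 *v w 0) + u 0 \<bullet> (S' *v w 0) + u 0 \<bullet> (S 0 *v w'))) (at 0)"
    if "(u has_vector_derivative u') (at 0)" "(w has_vector_derivative w') (at 0)" for u w u' w'
    using bounded_bilinear.has_vector_derivative[OF bounded_bilinear_inner that(1)
        bounded_bilinear.has_vector_derivative[OF bounded_bilinear_matrix_vector_mult S that(2)]]
    by (simp add: inner_add_right algebra_simps)
  have "\<exists>e. (\<forall>i\<in>I. e i 0 = a i 0 \<and> (e i has_vector_derivative a' i) (at 0)) \<and>
    (\<forall>\<^sub>F t in nhds 0. \<forall>i\<in>I. \<forall>j\<in>I. e i t \<bullet> (S t *v e j t) = (if i = j then 1 else 0))"
    by (rule insert.IH) (use insert.prems in simp_all)
  then obtain e where e: "\<And>i. i \<in> I \<Longrightarrow> e i 0 = a i 0" "\<And>i. i \<in> I \<Longrightarrow> (e i has_vector_derivative a' i) (at 0)"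
    and eo: "\<forall>\<^sub>F t in nhds 0. \<forall>i\<in>I. \<forall>j\<in>I. e i t \<bullet> (S t *v e j t) = (if i = j then 1 else 0)"
    by blast
  define cf where "cf i t = a k t \<bullet> (S t *v e i t)" for i t
  have ak: "(a k has_vector_derivative a' k) (at 0)" using insert.prems by simp
  have cf: "(cf i has_vector_derivative 0) (at 0)" "cf i 0 = 0" if "i \<in> I" for i
    using D[OF ak e(2)[OF that]] insert.prems(2)[of k i] insert.prems(3)[of k i] that insert.hyps
    by (auto simp: cf_def[abs_def] e)
  define w where "w t = a k t - (\<Sum>i\<in>I. cf i t *\<^sub>R e i t)" for t
  have w: "(w has_vector_derivative a' k) (at 0)"
  proof -
    have "((\<lambda>t. cf i t *\<^sub>R e i t) has_vector_derivative 0) (at 0)" if "i \<in> I" for i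
      using bounded_bilinear.has_vector_derivative[OF bounded_bilinear_scaleR cf(1)[OF that] e(2)[OF that]]
        cf(2)[OF that] by simp
    then have "((\<lambda>t. \<Sum>i\<in>I. cf i t *\<^sub>R e i t) has_vector_derivative (\<Sum>i\<in>I. 0)) (at 0)"
      by (rule has_vector_derivative_sum)
    from has_vector_derivative_diff[OF ak this] show ?thesis by (simp add: w_def[abs_def])
  qed
  have w0: "w 0 = a k 0" by (simp add: w_def cf)
  define N where "N t = w t \<bullet> (S t *v w t)" for t
  have N: "(N has_vector_derivative 0) (at 0)"
    using D[OF w w] insert.prems(3)[of k k] by (simp add: N_def[abs_def] w0)
  have N0: "N 0 = 1" using insert.prems(2)[of k k] by (simp add: N_def w0)
  have "((\<lambda>t. 1 / sqrt (N t)) has_real_derivative 0) (at 0)"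
    using N N0 unfolding has_real_derivative_iff_has_vector_derivative[symmetric]
    by (auto intro!: derivative_eq_intros)
  then have r: "((\<lambda>t. 1 / sqrt (N t)) has_vector_derivative 0) (at 0)"
    unfolding has_real_derivative_iff_has_vector_derivative .
  define f where "f t = (1 / sqrt (N t)) *\<^sub>R w t" for t
  have f: "(f has_vector_derivative a' k) (at 0)" "f 0 = a k 0"
    using bounded_bilinear.has_vector_derivative[OF bounded_bilinear_scaleR r w]
    by (simp_all add: f_def[abs_def] N0 w0)
  have "isCont N 0" using N has_vector_derivative_continuous by blast
  then have "(N \<longlongrightarrow> N 0) (nhds 0)" 
    unfolding isCont_def tendsto_at_iff_tendsto_nhds .
  then have pos: "\<forall>\<^sub>F t in nhds 0. 0 < N t" by (rule order_tendstoD) (simp add: N0)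
  let ?e = "e(k := f)"
  have "\<forall>\<^sub>F t in nhds 0. \<forall>i\<in>insert k I. \<forall>j\<in>insert k I. ?e i t \<bullet> (S t *v ?e j t) = (if i = j then 1 else 0)"
    using pos eo sym
  proof eventually_elim
    case (elim t)
    have fe: "f t \<bullet> (S t *v e i t) = 0" if i: "i \<in> I" for i
    proof -
      have "w t \<bullet> (S t *v e i t) = cf i t - (\<Sum>j\<in>I. cf j t * (e j t \<bullet> (S t *v e i t)))"
        unfolding w_def by (simp add: inner_diff_left inner_sum_left cf_def)
      also have "(\<Sum>j\<in>I. cf j t * (e j t \<bullet> (S t *v e i t))) = (\<Sum>j\<in>I. if j = i then cf j t else 0)"
        using elim(2) i by (intro sum.cong) auto
      finally show ?thesis using i insert.hyps by (simp add: f_def)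
    qed
    have ef: "e i t \<bullet> (S t *v f t) = 0" if "i \<in> I" for i
      using fe[OF that] matrix_form_commute[OF elim(3)] by metis
    have "f t \<bullet> (S t *v f t) = (1 / sqrt (N t)) * (1 / sqrt (N t)) * N t"
      unfolding f_def N_def by (simp add: vec.scale scalar_mult_eq_scaleR matrix_vector_mult_scaleR)
    then have ff: "f t \<bullet> (S t *v f t) = 1" using elim(1) by simp
    show ?case using fe ef ff elim(2) insert.hyps by auto
  qed
  moreover have "\<forall>i\<in>insert k I. ?e i 0 = a i 0 \<and> (?e i has_vector_derivative a' i) (at 0)"
    using e f insert.hyps by auto
  ultimately show ?case by blast
qed

lemma has_derivative_vec_lambda:
  fixes f :: "'n::finite \<Rightarrow> 'v::real_normed_vector \<Rightarrow> 'b::euclidean_space"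
  assumes "\<And>i. (f i has_derivative f' i) F"
  shows "((\<lambda>x. \<chi> i. f i x) has_derivative (\<lambda>v. \<chi> i. f' i v)) F"
proof -
  have eq: "(\<chi> i. h i) = (\<Sum>i\<in>UNIV. axis i (h i))" for h :: "'n \<Rightarrow> 'b"
    by (simp add: vec_eq_iff axis_def if_distrib sum.delta cong: if_cong)
  show ?thesis unfolding eq
    by (intro has_derivative_sum bounded_linear.has_derivative[OF linear_linear[THEN iffD2, OF linear_axis] assms])
qed

context riemannian
begin

section \<open>Change of chart\<close>

lemma metric_overlap:
  assumes c: "c \<in> A" and d: "d \<in> A" and y: "y \<in> overlap c d"
  shows "u \<bullet> (G c y *v v) = dtr c d y u \<bullet> (G d (transition c d y) *v dtr c d y v)"
proof -
  obtain x where x: "x \<in> cdom c" "x \<in> cdom d" "y = cmap c x" using y by (auto simp: overlap_def)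
  show ?thesis
    using metric_coords[OF c x(1), of u v] metric_coords[OF d x(2), of "dtr c d y u" "dtr c d y v"]
    by (simp add: x c tvec_of_trans[OF c x(1) d x(2)])
qed

text \<open>The derivative of the reverse coordinate change is a right inverse.\<close>

lemma dtr_surj:
  assumes c: "c \<in> A" and d: "d \<in> A" and y: "y \<in> overlap c d"
  obtains v where "dtr c d y v = w"
proof -
  obtain x where x: "x \<in> cdom c" "x \<in> cdom d" "y = cmap c x" using y by (auto simp: overlap_def)
  have "dtr c d y (dtr d c (cmap d x) w) = w"
    unfolding x(3) by (simp add: dtr_chain dtr_self c d x)
  then show thesis by (rule that)
qed

abbreviation "d2tr c d y u v \<equiv> der (\<lambda>z. dtr c d z u) y v"

text \<open>Let \<open>S\<close> be the difference of the two sides. It is symmetric because the Christoffel symbols and the second derivative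
of the coordinate change are. Differentiating the isometry of the two coordinate metrics, and using that
both are parallel, shows that \<open>\<langle>S u w, D v\<rangle>\<close> is skew in \<open>u\<close> and \<open>v\<close>. A trilinear form that is
symmetric in one pair of arguments and skew in an overlapping one vanishes: this is the uniqueness of the
Levi-Civita connection.\<close>

lemma Gam_transform:
  assumes c: "c \<in> A" and d: "d \<in> A" and y: "y \<in> overlap c d"
  shows "dtr c d y (Gam c y u v) = 
    Gam d (transition c d y) (dtr c d y u) (dtr c d y v) + d2tr c d y u v"
proof -
  let ?\<phi> = "transition c d" and ?D = "dtr c d y" and ?D2 = "d2tr c d y"
  note o = open_overlap[OF c d] and s = smooth_transition[OF c d]
  have yU: "y \<in> U c" using y overlap_subset by blast
  have \<phi>y: "?\<phi> y \<in> U d" using y c by (auto simp: overlap_def)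
  have lin: "linear ?D" by (rule smooth_on_linear_der[OF s y])
  define S where "S u v = ?D (Gam c y u v) - Gam d (?\<phi> y) (?D u) (?D v) - ?D2 u v" for u v
  have sym: "S u v = S v u" for u v
    unfolding S_def Gam_sym[OF c yU, of u v] Gam_sym[OF d \<phi>y, of "?D u"]
      second_derivative_symmetric[OF o s y, of u v] ..
  have dmetric: "u \<bullet> (dG c y w *v v) = ?D2 u w \<bullet> (G d (?\<phi> y) *v ?D v) 
      + ?D u \<bullet> (dG d (?\<phi> y) (?D w) *v ?D v) + ?D u \<bullet> (G d (?\<phi> y) *v ?D2 v w)" for u v w
  proof -
    have 1: "((\<lambda>z. dtr c d z u) has_derivative ?D2 u) (at y)" for u
      by (rule smooth_on_has_derivative[OF smooth_on_der[OF s] y])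
    have 2: "((\<lambda>z. G d (?\<phi> z)) has_derivative (\<lambda>w. dG d (?\<phi> y) (?D w))) (at y)"
      by (rule has_derivative_compose[OF smooth_on_has_derivative[OF s y] has_derivative_G[OF d \<phi>y]])
    have "((\<lambda>z. u \<bullet> (G c z *v v)) has_derivative (\<lambda>w. ?D u \<bullet> (G d (?\<phi> y) *v ?D2 v w + dG d (?\<phi> y) (?D w) *v ?D v)
       + ?D2 u w \<bullet> (G d (?\<phi> y) *v ?D v))) (at y)"
    proof (rule has_derivative_transform_within_open[OF _ o y])
      show "((\<lambda>z. dtr c d z u \<bullet> (G d (?\<phi> z) *v dtr c d z v)) has_derivative 
        (\<lambda>w. ?D u \<bullet> (G d (?\<phi> y) *v ?D2 v w + dG d (?\<phi> y) (?D w) *v ?D v)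
       + ?D2 u w \<bullet> (G d (?\<phi> y) *v ?D v))) (at y)"
        by (rule has_derivative_inner[OF 1 bounded_bilinear.FDERIV[OF bounded_bilinear_matrix_vector_mult 2 1]])
    qed (simp add: metric_overlap[OF c d])
    moreover have "((\<lambda>z. u \<bullet> (G c z *v v)) has_derivative (\<lambda>w. u \<bullet> (dG c y w *v v))) (at y)"
      by (intro has_derivative_inner_right 
          bounded_linear.has_derivative[OF bounded_bilinear.bounded_linear_left[OF bounded_bilinear_matrix_vector_mult] has_derivative_G[OF c yU]])
    ultimately have "(\<lambda>w. u \<bullet> (dG c y w *v v)) = (\<lambda>w. ?D u \<bullet> (G d (?\<phi> y) *v ?D2 v w + dG d (?\<phi> y) (?D w) *v ?D v)
       + ?D2 u w \<bullet> (G d (?\<phi> y) *v ?D v))"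
      by (rule has_derivative_unique[rotated])
    then show ?thesis by (simp add: fun_eq_iff inner_add_right)
  qed
  have skew: "S u w \<bullet> (G d (?\<phi> y) *v ?D v) + ?D u \<bullet> (G d (?\<phi> y) *v S v w) = 0" for u v w
    using dmetric[of u w v] Gam_metric[OF c yU, of u w v] Gam_metric[OF d \<phi>y, of "?D u" "?D w" "?D v"]
      metric_overlap[OF c d y, of "Gam c y u w" v] metric_overlap[OF c d y, of u "Gam c y v w"]
    unfolding S_def by (simp add: inner_diff_left inner_diff_right vec.diff matrix_vector_mult_diff_distrib)
  define T where "T u v w = S u v \<bullet> (G d (?\<phi> y) *v ?D w)" for u v w
  have T1: "T u v w = T v u w" for u v w unfolding T_def by (simp add: sym[of u v])
  have T2: "T u w v = - T v w u" for u v w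
    using skew[of u w v] matrix_form_commute[OF G_sym[OF d \<phi>y], of "?D u" "S v w"] unfolding T_def by simp
  have "T u v w = 0" for u v w
    using T1 T2 by (smt (verit))
  then have "w \<bullet> (G d (?\<phi> y) *v S u v) = 0" for w
    using dtr_surj[OF c d y, of w] matrix_form_commute[OF G_sym[OF d \<phi>y], of w "S u v"]
    unfolding T_def by metis
  then have "S u v = 0" by (rule G_cancel[OF d \<phi>y])
  then show ?thesis by (simp add: S_def algebra_simps)
qed

section \<open>Orthonormal frames in coordinates\<close>

abbreviation "FB \<equiv> frame_bundle A g"

text \<open>The coordinate image of the frame bundle over the chart \<open>c\<close>.\<close>

definition frame_set :: "('a, 'n) chart \<Rightarrow> 'n fcoords set" where
  "frame_set c = {P. fst P \<in> U c \<and> 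
     (\<forall>i j. snd P $ i \<bullet> (G c (fst P) *v snd P $ j) = (if i = j then 1 else 0))}"

lemma FB_iff: "p \<in> FB \<longleftrightarrow> fst p \<in> (\<Union>c\<in>A. cdom c) \<and> (\<forall>j. snd p j \<in> tangent_space A (fst p)) \<and>
   (\<forall>i j. g (fst p) (snd p i) (snd p j) = (if i = j then 1 else 0))"
  unfolding frame_bundle_def by (cases p) auto

lemma frame_coords_in:
  assumes "c \<in> A" "p \<in> FB" "fst p \<in> cdom c" shows "frame_coords c p \<in> frame_set c"
  using assms metric_tangent[OF assms(1,3)] 
  by (auto simp: frame_set_def frame_coords_def FB_iff)

lemma frame_param_in:
  assumes c: "c \<in> A" and P: "P \<in> frame_set c"
  shows "frame_param A c P \<in> FB" "fst (frame_param A c P) \<in> cdom c" 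
    "frame_coords c (frame_param A c P) = P"
proof -
  obtain y E where P': "P = (y, E)" by (cases P)
  have y: "y \<in> U c" using P by (auto simp: frame_set_def P')
  note x = cinv_in_cdom[OF y]
  show 1: "fst (frame_param A c P) \<in> cdom c" using x by (simp add: frame_param_def P')
  show "frame_param A c P \<in> FB"
    using P x c y tvec_of_in_tangent_space[OF c x]
    by (auto simp: FB_iff frame_param_def P' metric_coords frame_set_def)
  show "frame_coords c (frame_param A c P) = P"
    using c x y by (simp add: frame_coords_def frame_param_def P' tvec_of_nth dtr_self vec_eq_iff)
      (metis cmap_cinv dtr_self)
qed

lemma frame_coords_image:
  assumes "c \<in> A" shows "frame_coords c ` {p \<in> FB. fst p \<in> cdom c} = frame_set c"
proof (intro equalityI subsetI)
  fix P assume "P \<in> frame_set c"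
  from frame_param_in[OF assms this] show "P \<in> frame_coords c ` {p \<in> FB. fst p \<in> cdom c}"
    by (intro image_eqI[of _ _ "frame_param A c P"]) auto
qed (auto simp: frame_coords_in assms)

text \<open>The vectors \<open>X\<close> annihilated by the differential of the equations of \<open>frame_set\<close> at \<open>P\<close>.\<close>

definition frame_tangent :: "('a, 'n) chart \<Rightarrow> 'n fcoords \<Rightarrow> 'n fcoords \<Rightarrow> bool" where
  "frame_tangent c P X \<longleftrightarrow> (\<forall>i j. snd X $ i \<bullet> (G c (fst P) *v snd P $ j) 
     + snd P $ i \<bullet> (dG c (fst P) (fst X) *v snd P $ j) + snd P $ i \<bullet> (G c (fst P) *v snd X $ j) = 0)"

text \<open>Along the straight line with velocity \<open>X\<close> the frame stays orthonormal to first order, so Gram-Schmidt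
corrects it to a curve in \<open>frame_set\<close> with the same velocity.\<close>

lemma frame_tangent_curve:
  assumes c: "c \<in> A" and P: "P \<in> frame_set c" and X: "frame_tangent c P X"
  obtains \<gamma> where "\<gamma> 0 = P" "(\<gamma> has_vector_derivative X) (at 0)" "\<forall>\<^sub>F t in nhds 0. \<gamma> t \<in> frame_set c"
proof -
  obtain y E where P': "P = (y, E)" by (cases P)
  obtain v Z where X': "X = (v, Z)" by (cases X)
  have y: "y \<in> U c" using P by (auto simp: frame_set_def P')
  have yt: "((\<lambda>t. y + t *\<^sub>R v) has_vector_derivative v) (at 0)"
    by (auto intro!: derivative_eq_intros)
  have "((\<lambda>t. G c (y + t *\<^sub>R v)) has_derivative (\<lambda>s. dG c y (s *\<^sub>R v))) (at 0)"
    using has_derivative_compose[OF yt[unfolded has_vector_derivative_def], of "G c"] has_derivative_G[OF c y]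
    by simp
  then have S: "((\<lambda>t. G c (y + t *\<^sub>R v)) has_vector_derivative dG c y v) (at 0)"
    by (simp add: has_vector_derivative_def linear_cmul[OF linear_dG[OF c y]])
  have "isCont (\<lambda>t. y + t *\<^sub>R v) 0" by (intro continuous_intros)
  then have "((\<lambda>t. y + t *\<^sub>R v) \<longlongrightarrow> y) (nhds 0)" 
    using tendsto_at_iff_tendsto_nhds[of "\<lambda>t. y + t *\<^sub>R v" 0] by (simp add: isCont_def)
  then have inU: "\<forall>\<^sub>F t in nhds 0. y + t *\<^sub>R v \<in> U c"
    by (rule topological_tendstoD[OF _ open_U[OF c]]) (simp add: y)
  then have sym: "\<forall>\<^sub>F t in nhds 0. transpose (G c (y + t *\<^sub>R v)) = G c (y + t *\<^sub>R v)"
    by eventually_elim (rule G_sym[OF c])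
  have "\<exists>e. (\<forall>i\<in>UNIV. e i 0 = E $ i + 0 *\<^sub>R Z $ i \<and> (e i has_vector_derivative Z $ i) (at 0)) \<and>
    (\<forall>\<^sub>F t in nhds 0. \<forall>i\<in>UNIV. \<forall>j\<in>UNIV. e i t \<bullet> (G c (y + t *\<^sub>R v) *v e j t) = (if i = j then 1 else 0))"
  proof (rule gram_schmidt_curve[OF finite sym S, where a = "\<lambda>i t. E $ i + t *\<^sub>R Z $ i"])
    show "((\<lambda>t. E $ i + t *\<^sub>R Z $ i) has_vector_derivative Z $ i) (at 0)" for i
      by (auto intro!: derivative_eq_intros)
  qed (use P X in \<open>auto simp: frame_set_def frame_tangent_def P' X'\<close>)
  then obtain e where e: "\<And>i. e i 0 = E $ i" "\<And>i. (e i has_vector_derivative Z $ i) (at 0)"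
    and eo: "\<forall>\<^sub>F t in nhds 0. \<forall>i j. e i t \<bullet> (G c (y + t *\<^sub>R v) *v e j t) = (if i = j then 1 else 0)"
    by auto
  let ?\<gamma> = "\<lambda>t. (y + t *\<^sub>R v, \<chi> i. e i t)"
  have "((\<lambda>t. \<chi> i. e i t) has_derivative (\<lambda>s. \<chi> i. s *\<^sub>R Z $ i)) (at 0)"
    using e(2) unfolding has_vector_derivative_def by (rule has_derivative_vec_lambda)
  then have "(?\<gamma> has_derivative (\<lambda>s. (s *\<^sub>R v, \<chi> i. s *\<^sub>R Z $ i))) (at 0)"
    using yt unfolding has_vector_derivative_def by (intro has_derivative_Pair)
  moreover have "(\<lambda>s. (s *\<^sub>R v, \<chi> i. s *\<^sub>R Z $ i)) = (\<lambda>s. s *\<^sub>R X)"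
    by (auto simp: X' vec_eq_iff)
  ultimately have "(?\<gamma> has_vector_derivative X) (at 0)" by (simp add: has_vector_derivative_def)
  moreover have "?\<gamma> 0 = P" by (simp add: P' e vec_eq_iff)
  moreover have "\<forall>\<^sub>F t in nhds 0. ?\<gamma> t \<in> frame_set c"
    using inU eo by eventually_elim (simp add: frame_set_def)
  ultimately show thesis using that[of ?\<gamma>] by blast
qed

text \<open>As \<open>frame_set\<close> has no interior, a derivative within it is not unique as a linear map. Its values on velocities of
curves in the set are determined, and these velocities include all tangent vectors.\<close>

lemma frechet_derivative_frame_set:
  fixes F :: "'n fcoords \<Rightarrow> real"
  assumes c: "c \<in> A" and P: "P \<in> frame_set c" and X: "frame_tangent c P X"
    and F: "(F has_derivative D) (at P within frame_set c)"
  shows "frechet_derivative F (at P within frame_set c) X = D X"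
proof -
  obtain \<gamma> where \<gamma>: "\<gamma> 0 = P" "(\<gamma> has_vector_derivative X) (at 0)" "\<forall>\<^sub>F t in nhds 0. \<gamma> t \<in> frame_set c"
    by (rule frame_tangent_curve[OF c P X])
  obtain I where I: "open I" "0 \<in> I" "\<And>t. t \<in> I \<Longrightarrow> \<gamma> t \<in> frame_set c"
    using \<gamma>(3) unfolding eventually_nhds by auto
  have *: "((\<lambda>t. F (\<gamma> t)) has_derivative (\<lambda>s. D (s *\<^sub>R X))) (at 0)" 
    if "(F has_derivative D) (at P within frame_set c)" for D
  proof -
    have "(F has_derivative D) (at (\<gamma> 0) within \<gamma> ` I)"
      unfolding \<gamma>(1) by (rule has_derivative_subset[OF that]) (use I in auto)
    moreover have "(\<gamma> has_derivative (\<lambda>s. s *\<^sub>R X)) (at 0 within I)"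
      using \<gamma>(2) unfolding has_vector_derivative_def by (rule has_derivative_at_withinI)
    ultimately have "((\<lambda>t. F (\<gamma> t)) has_derivative (\<lambda>s. D (s *\<^sub>R X))) (at 0 within I)"
      using has_derivative_in_compose by blast
    then show ?thesis using at_within_open[OF I(2,1)] by simp
  qed
  have "(F has_derivative frechet_derivative F (at P within frame_set c)) (at P within frame_set c)"
    using F frechet_derivative_works differentiable_def by blast
  from has_derivative_unique[OF *[OF this] *[OF F]]
  have "frechet_derivative F (at P within frame_set c) (1 *\<^sub>R X) = D (1 *\<^sub>R X)" by metis
  then show ?thesis by simp
qed

section \<open>Frame fields as Lie derivatives in a chart\<close>

definition chart_change :: "('a, 'n) chart \<Rightarrow> ('a, 'n) chart \<Rightarrow> 'n fcoords \<Rightarrow> 'n fcoords" where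
  "chart_change c d P = (transition c d (fst P), \<chi> k. dtr c d (fst P) (snd P $ k))"

lemma chart_change_coords:
  assumes "c \<in> A" "d \<in> A" "p \<in> FB" "fst p \<in> cdom c" "fst p \<in> cdom d"
  shows "chart_change c d (frame_coords c p) = frame_coords d p"
  using assms tangent_space_trans[of "snd p k" "fst p" c d for k]
  by (simp add: chart_change_def frame_coords_def FB_iff vec_eq_iff)

lemma has_derivative_chart_change:
  assumes c: "c \<in> A" and d: "d \<in> A" and P: "fst P \<in> overlap c d"
  shows "(chart_change c d has_derivative (\<lambda>X. (dtr c d (fst P) (fst X), 
     \<chi> k. d2tr c d (fst P) (snd P $ k) (fst X) + dtr c d (fst P) (snd X $ k)))) (at P)"
proof -
  note o = open_overlap[OF c d] and s = smooth_transition[OF c d]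
  have 1: "((\<lambda>P. (fst P, snd P $ k)) has_derivative (\<lambda>X. (fst X, snd X $ k))) (at P)" for k
    by (intro has_derivative_Pair has_derivative_fst has_derivative_ident
        bounded_linear.has_derivative[OF bounded_linear_vec_nth has_derivative_snd[OF has_derivative_ident]])
  have 2: "((\<lambda>P. dtr c d (fst P) (snd P $ k)) has_derivative 
     (\<lambda>X. d2tr c d (fst P) (snd P $ k) (fst X) + dtr c d (fst P) (snd X $ k))) (at P)" for k
    using has_derivative_compose[OF 1 has_derivative_der[OF o s P]] by simp
  have "((\<lambda>P. transition c d (fst P)) has_derivative (\<lambda>X. dtr c d (fst P) (fst X))) (at P)"
    by (rule has_derivative_compose[OF has_derivative_fst[OF has_derivative_ident] smooth_on_has_derivative[OF s P]])
  from has_derivative_Pair[OF this has_derivative_vec_lambda[OF 2]]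
  show ?thesis by (simp add: chart_change_def[abs_def])
qed

text \<open>What is needed to compute the derivative along \<open>X\<close> in a fixed chart although its definition uses another
chart at every point: smoothness, tangency to the frames, and compatibility with coordinate changes.\<close>

definition natural_field :: "(('a, 'n) chart \<Rightarrow> 'n fcoords \<Rightarrow> 'n fcoords) \<Rightarrow> bool" where
  "natural_field X \<longleftrightarrow> (\<forall>d\<in>A. smooth_on (U d \<times> UNIV) (X d) \<and>
     (\<forall>P\<in>frame_set d. frame_tangent d P (X d P)) \<and>
     (\<forall>c\<in>A. \<forall>P. fst P \<in> overlap d c \<longrightarrow> der (chart_change d c) P (X d P) = X c (chart_change d c P)))"

lemma V_coords_eq: "V_coords i P = (0, \<chi> j. if j = 0 then snd P $ i else if j = i then - (snd P $ 0) else 0)"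
  by (simp add: V_coords_def split_beta)

lemma bounded_linear_V_coords: "bounded_linear (V_coords i :: 'n fcoords \<Rightarrow> 'n fcoords)"
  unfolding linear_linear 
  by (rule linearI) (auto simp: V_coords_eq vec_eq_iff)

lemma H_coords_eq: "H_coords A g c i P = (snd P $ i, \<chi> k. - Gam c (fst P) (snd P $ k) (snd P $ i))"
  by (cases P) (simp add: H_coords_def Gam_def vec_eq_iff)

abbreviation "lieV i \<equiv> lie (V_coords i)"
abbreviation "lieH c i \<equiv> lie (H_coords A g c i)"

lemma natural_V: assumes i: "i \<noteq> 0" shows "natural_field (\<lambda>c. V_coords i)"
proof -
  have 1: "smooth_on (U d \<times> UNIV) (V_coords i :: 'n fcoords \<Rightarrow> 'n fcoords)" if "d \<in> A" for d
    using that by (intro smooth_on_linear bounded_linear_V_coords open_Times open_U open_UNIV)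
  have 2: "frame_tangent d P (V_coords i P)" if d: "d \<in> A" and P: "P \<in> frame_set d" for d P
  proof -
    have "fst P \<in> U d" using P by (simp add: frame_set_def)
    then have "dG d (fst P) 0 = 0" using linear_0[OF linear_dG[OF d]] by blast
    moreover have "snd P $ k \<bullet> (G d (fst P) *v snd P $ j) = (if k = j then 1 else 0)" for k j
      using P by (simp add: frame_set_def)
    moreover have "G d (fst P) *v (- u) = - (G d (fst P) *v u)" for u
      by (simp add: vec.neg)
    ultimately show ?thesis using i
      by (auto simp: frame_tangent_def V_coords_eq)
  qed
  have 3: "der (chart_change d c) P (V_coords i P) = V_coords i (chart_change d c P)"
    if d: "d \<in> A" and c: "c \<in> A" and P: "fst P \<in> overlap d c" for d c P
  proof -
    have l: "linear (dtr d c (fst P))" by (rule smooth_on_linear_der[OF smooth_transition[OF d c] P])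
    have l2: "linear (\<lambda>v. d2tr d c (fst P) u v)" for u
      using smooth_on_linear_der[OF smooth_on_der[OF smooth_transition[OF d c]] P] .
    show ?thesis
      unfolding der_eqI[OF has_derivative_chart_change[OF d c P]]
      by (auto simp: V_coords_eq chart_change_def vec_eq_iff linear_0[OF l] linear_0[OF l2] linear_neg[OF l])
  qed
  show ?thesis unfolding natural_field_def using 1 2 3 by blast
qed

lemma smooth_H_coords: 
  assumes d: "d \<in> A" shows "smooth_on (U d \<times> UNIV) (H_coords A g d i)"
proof -
  have o: "open (U d \<times> (UNIV :: ('n coords, 'n) vec set))" using d by (intro open_Times open_U open_UNIV)
  have Eij: "smooth_on (U d \<times> UNIV) (\<lambda>P::'n fcoords. snd P $ k)" for k
    by (rule smooth_on_linear[OF o bounded_linear_compose[OF bounded_linear_vec_nth bounded_linear_snd]])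
  have chr: "smooth_on (U d \<times> UNIV) (\<lambda>P::'n fcoords. christoffel A g d l p q (fst P))" for l p q
    by (rule smooth_on_compose[OF o smooth_christoffel[OF d] smooth_on_linear[OF o bounded_linear_fst]]) auto
  have "smooth_on (U d \<times> UNIV) (\<lambda>P. (snd P $ i, \<chi> k l. - (\<Sum>p\<in>UNIV. \<Sum>q\<in>UNIV. 
      christoffel A g d l p q (fst P) * snd P $ k $ p * snd P $ i $ q)))"
    by (intro smooth_on_Pair[OF o] smooth_on_vec_lambda[OF o] smooth_on_minus[OF o] smooth_on_sum[OF o]
        smooth_on_mult[OF o] Eij chr smooth_on_vec_nth[OF o])
  moreover have "H_coords A g d i = (\<lambda>P. (snd P $ i, \<chi> k l. - (\<Sum>p\<in>UNIV. \<Sum>q\<in>UNIV. 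
      christoffel A g d l p q (fst P) * snd P $ k $ p * snd P $ i $ q)))"
    by (auto simp: H_coords_def fun_eq_iff)
  ultimately show ?thesis by simp
qed

text \<open>Tangency is the compatibility of the connection with the metric, and compatibility with coordinate changes is the
transformation law of the Christoffel symbols.\<close>

lemma natural_H: "natural_field (\<lambda>c. H_coords A g c i)"
proof -
  have 2: "frame_tangent d P (H_coords A g d i P)" if d: "d \<in> A" and P: "P \<in> frame_set d" for d P
  proof -
    have y: "fst P \<in> U d" using P by (simp add: frame_set_def)
    show ?thesis unfolding frame_tangent_def H_coords_eq
      using Gam_metric[OF d y] by (simp add: vec.neg)
  qed
  have 3: "der (chart_change d c) P (H_coords A g d i P) = H_coords A g c i (chart_change d c P)"
    if d: "d \<in> A" and c: "c \<in> A" and P: "fst P \<in> overlap d c" for d c P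
  proof -
    have l: "linear (dtr d c (fst P))" by (rule smooth_on_linear_der[OF smooth_transition[OF d c] P])
    show ?thesis
      unfolding der_eqI[OF has_derivative_chart_change[OF d c P]]
      by (auto simp: H_coords_eq chart_change_def vec_eq_iff linear_neg[OF l] Gam_transform[OF d c P])
  qed
  show ?thesis unfolding natural_field_def using smooth_H_coords 2 3 by blast
qed

text \<open>\<open>\<Phi>\<close> is defined on an open set of coordinates, not only on the frames, so that partial derivatives, Lie brackets
and the symmetry of second derivatives make sense for it.\<close>

definition rep :: "('a, 'n) chart \<Rightarrow> 'n fcoords set \<Rightarrow> 
    ('a, 'n) frame_fun \<Rightarrow> ('n fcoords \<Rightarrow> real) \<Rightarrow> bool" where
  "rep c W F \<Phi> \<longleftrightarrow> open W \<and> W \<subseteq> U c \<times> UNIV \<and> smooth_on W \<Phi> \<and>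
     (\<forall>p\<in>FB. fst p \<in> cdom c \<longrightarrow> frame_coords c p \<in> W \<longrightarrow> F p = \<Phi> (frame_coords c p))"

lemma chart_at: "p \<in> FB \<Longrightarrow> chart_at A (fst p) \<in> A \<and> fst p \<in> cdom (chart_at A (fst p))"
  unfolding chart_at_def FB_iff by (rule someI_ex) blast

text \<open>At a frame \<open>p\<close> the operator uses the chart \<open>d\<close> chosen at the base point. Near \<open>p\<close> the function \<open>F\<close>, read in the chart \<open>d\<close>,
agrees on frames with \<open>\<Phi>\<close> composed with the coordinate change from \<open>d\<close> to \<open>c\<close>. The chain rule then
moves the field from \<open>d\<close> to \<open>c\<close>. The same \<open>W\<close> serves again, so the lemma can be iterated.\<close>

lemma rep_frame_deriv:
  assumes X: "natural_field X" and c: "c \<in> A" and rep: "rep c W F \<Phi>"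
  shows "rep c W (\<lambda>p. let d = chart_at A (fst p) in frame_deriv A g F p (X d (frame_coords d p))) (lie (X c) \<Phi>)"
proof -
  have W: "open W" "W \<subseteq> U c \<times> UNIV" and \<Phi>: "smooth_on W \<Phi>"
    and F: "\<And>p. p \<in> FB \<Longrightarrow> fst p \<in> cdom c \<Longrightarrow> frame_coords c p \<in> W \<Longrightarrow> F p = \<Phi> (frame_coords c p)"
    using rep by (auto simp: rep_def)
  have "smooth_on W (X c)" using X c W(2) smooth_on_antimono unfolding natural_field_def by blast
  then have 1: "smooth_on W (lie (X c) \<Phi>)" by (intro smooth_on_lie W \<Phi>)
  have 2: "frame_deriv A g F p (X d (frame_coords d p)) = lie (X c) \<Phi> (frame_coords c p)"
    if p: "p \<in> FB" and x: "fst p \<in> cdom c" and PW: "frame_coords c p \<in> W" and d_def: "d = chart_at A (fst p)" for p d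
  proof -
    have d: "d \<in> A" "fst p \<in> cdom d" using chart_at[OF p] by (auto simp: d_def)
    let ?P = "frame_coords c p" and ?Q = "frame_coords d p" and ?T = "chart_change d c"
    have TQ: "?T ?Q = ?P" by (rule chart_change_coords[OF d(1) c p d(2) x])
    have Qo: "fst ?Q \<in> overlap d c" using d x by (auto simp: frame_coords_def overlap_def)
    have Qin: "?Q \<in> frame_set d" by (rule frame_coords_in[OF d(1) p d(2)])
    have dT: "(?T has_derivative der ?T ?Q) (at ?Q)"
      by (subst der_eqI) (rule has_derivative_chart_change[OF d(1) c Qo])+
    have "(\<Phi> has_derivative der \<Phi> (?T ?Q)) (at (?T ?Q))"
      using smooth_on_has_derivative[OF \<Phi> PW] TQ by simp
    from has_derivative_compose[OF dT this]
    have D: "((\<lambda>R. \<Phi> (?T R)) has_derivative (\<lambda>Y. der \<Phi> ?P (der ?T ?Q Y))) (at ?Q within frame_set d)"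
      unfolding TQ by (rule has_derivative_at_withinI)
    have "isCont ?T ?Q" using dT by (rule has_derivative_continuous)
    then have "(?T \<longlongrightarrow> ?P) (at ?Q)" unfolding isCont_def TQ .
    then have e1: "\<forall>\<^sub>F R in at ?Q. ?T R \<in> W" using W(1) PW by (rule topological_tendstoD)
    have "(fst \<longlongrightarrow> fst ?Q) (at ?Q)" by (intro tendsto_fst tendsto_ident_at)
    then have e2: "\<forall>\<^sub>F R in at ?Q. fst R \<in> overlap d c"
      using open_overlap[OF d(1) c] Qo by (rule topological_tendstoD)
    have agree: "\<Phi> (?T R) = F (frame_param A d R)" 
      if "?T R \<in> W" "fst R \<in> overlap d c" "R \<in> frame_set d" for R
    proof -
      let ?q = "frame_param A d R"
      have q: "?q \<in> FB" "fst ?q \<in> cdom d" "frame_coords d ?q = R"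
        using frame_param_in[OF d(1) that(3)] by auto
      have "cmap d (fst ?q) = fst R" using arg_cong[OF q(3), of fst] by (simp add: frame_coords_def)
      then have "cmap d (fst ?q) \<in> overlap d c" using that(2) by simp
      then have qc: "fst ?q \<in> cdom c" 
        using q(2) inj_onD[OF inj_cmap[OF d(1)]] by (auto simp: overlap_def)
      have "frame_coords c ?q = ?T R"
        using chart_change_coords[OF d(1) c q(1,2) qc] q(3) by simp
      then show ?thesis using F[OF q(1) qc] that(1) by simp
    qed
    have "\<forall>\<^sub>F R in at ?Q within frame_set d. \<Phi> (?T R) = F (frame_param A d R)"
      using filter_leD[OF at_le[OF subset_UNIV] e1, of "frame_set d"] 
        filter_leD[OF at_le[OF subset_UNIV] e2, of "frame_set d"]
      unfolding eventually_at_filter by eventually_elim (use agree in blast)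
    then have "((\<lambda>R. F (frame_param A d R)) has_derivative (\<lambda>Y. der \<Phi> ?P (der ?T ?Q Y))) (at ?Q within frame_set d)"
      using D Qin agree[of ?Q] Qo PW TQ
      by (intro has_derivative_transform_eventually[OF D]) auto
    then have "frechet_derivative (F \<circ> frame_param A d) (at ?Q within frame_set d) (X d ?Q) = der \<Phi> ?P (der ?T ?Q (X d ?Q))"
      using X d(1) Qin unfolding natural_field_def comp_def
      by (intro frechet_derivative_frame_set[OF d(1) Qin]) auto
    also have "der ?T ?Q (X d ?Q) = X c ?P"
      using X d(1) c Qo TQ unfolding natural_field_def by metis
    finally show ?thesis
      unfolding frame_deriv_def Let_def d_def[symmetric] frame_coords_image[OF d(1)] lie_def .
  qed
  show ?thesis unfolding rep_def Let_def using W 1 2 by blast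
qed

lemma rep_V: "i \<noteq> 0 \<Longrightarrow> c \<in> A \<Longrightarrow> rep c W F \<Phi> \<Longrightarrow> rep c W (V A g i F) (lieV i \<Phi>)"
  using rep_frame_deriv[OF natural_V] by (simp add: V_def[abs_def] Let_def)

lemma rep_H: "c \<in> A \<Longrightarrow> rep c W F \<Phi> \<Longrightarrow> rep c W (H A g i F) (lieH c i \<Phi>)"
  using rep_frame_deriv[OF natural_H] by (simp add: H_def[abs_def] Let_def)

end

lemma sum3_rotate:
  fixes f :: "'x \<Rightarrow> 'y \<Rightarrow> 'z \<Rightarrow> 'c::comm_monoid_add"
  shows "(\<Sum>a\<in>X. \<Sum>b\<in>Y. \<Sum>c\<in>Z. f a b c) = (\<Sum>c\<in>Z. \<Sum>a\<in>X. \<Sum>b\<in>Y. f a b c)"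
proof -
  have "(\<Sum>a\<in>X. \<Sum>b\<in>Y. \<Sum>c\<in>Z. f a b c) = (\<Sum>a\<in>X. \<Sum>c\<in>Z. \<Sum>b\<in>Y. f a b c)"
    by (intro sum.cong refl sum.swap)
  also have "\<dots> = (\<Sum>c\<in>Z. \<Sum>a\<in>X. \<Sum>b\<in>Y. f a b c)" by (rule sum.swap)
  finally show ?thesis .
qed

context riemannian
begin

section \<open>Commutators of the frame fields\<close>

definition dGam :: "('a, 'n) chart \<Rightarrow> 'n coords \<Rightarrow> 'n coords \<Rightarrow> 'n coords \<Rightarrow> 'n coords \<Rightarrow> 'n coords" where
  "dGam c y w u v = (\<chi> l. \<Sum>p\<in>UNIV. \<Sum>q\<in>UNIV. der (christoffel A g c l p q) y w * u $ p * v $ q)"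

text \<open>The curvature tensor \<open>R(u, v) w\<close>, arranged as it comes out of the bracket of two horizontal fields.\<close>

definition Riem :: "('a, 'n) chart \<Rightarrow> 'n coords \<Rightarrow> 'n coords \<Rightarrow> 'n coords \<Rightarrow> 'n coords \<Rightarrow> 'n coords" where
  "Riem c y u v w = dGam c y u v w - dGam c y v u w + Gam c y u (Gam c y v w) - Gam c y v (Gam c y u w)"

lemma linear_Gam: "linear (Gam c y u)" "linear (\<lambda>u. Gam c y u v)"
  by (auto intro!: linearI simp: Gam_def vec_eq_iff algebra_simps sum.distrib sum_distrib_left)

lemma has_derivative_christoffel:
  "c \<in> A \<Longrightarrow> y \<in> U c \<Longrightarrow> (christoffel A g c l p q has_derivative der (christoffel A g c l p q) y) (at y)"
  by (rule smooth_on_has_derivative[OF smooth_christoffel])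

lemma christoffel_sym:
  assumes "c \<in> A" "y \<in> U c" shows "christoffel A g c l p q y = christoffel A g c l q p y"
proof -
  have *: "Gam c y (axis p 1) (axis q 1) $ l = christoffel A g c l p q y" for p q
    by (simp add: Gam_def axis_def mult_delta_left mult_delta_right)
  show ?thesis using Gam_sym[OF assms, of "axis p 1" "axis q 1"] by (metis *)
qed

lemma dGam_sym:
  assumes "c \<in> A" "y \<in> U c" shows "dGam c y w u v = dGam c y w v u"
proof -
  have "der (christoffel A g c l p q) y = der (christoffel A g c l q p) y" for l p q
    by (rule der_eqI[OF has_derivative_transform_within_open[OF has_derivative_christoffel[OF assms] open_U[OF assms(1)] assms(2)]])
      (rule christoffel_sym[OF assms(1)])
  then show ?thesis unfolding dGam_def vec_eq_iff
    by (subst sum.swap) (simp add: mult_ac)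
qed

text \<open>Three summands, since \<open>Gam\<close> depends on the base point and is bilinear in the two frame vectors.\<close>

lemma has_derivative_Gam:
  assumes c: "c \<in> A" and y: "fst P \<in> U c"
  shows "((\<lambda>P. Gam c (fst P) (snd P $ k) (snd P $ i)) has_derivative (\<lambda>X. 
     dGam c (fst P) (fst X) (snd P $ k) (snd P $ i) + Gam c (fst P) (snd X $ k) (snd P $ i) 
     + Gam c (fst P) (snd P $ k) (snd X $ i))) (at P)"
proof -
  have nth: "((\<lambda>P. snd P $ k $ p) has_derivative (\<lambda>X. snd X $ k $ p)) (at P)" for k p
    by (intro bounded_linear_imp_has_derivative bounded_linear_compose[OF bounded_linear_vec_nth]
        bounded_linear_compose[OF bounded_linear_vec_nth] bounded_linear_snd)
  have chr: "((\<lambda>P. christoffel A g c l p q (fst P)) has_derivative 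
     (\<lambda>X. der (christoffel A g c l p q) (fst P) (fst X))) (at P)" for l p q
    by (rule has_derivative_compose[OF has_derivative_fst[OF has_derivative_ident] has_derivative_christoffel[OF c y]])
  have "((\<lambda>P. Gam c (fst P) (snd P $ k) (snd P $ i)) has_derivative (\<lambda>X. \<chi> l. \<Sum>p\<in>UNIV. \<Sum>q\<in>UNIV.
      christoffel A g c l p q (fst P) * snd P $ k $ p * snd X $ i $ q +
      (christoffel A g c l p q (fst P) * snd X $ k $ p + 
        der (christoffel A g c l p q) (fst P) (fst X) * snd P $ k $ p) * snd P $ i $ q)) (at P)"
    unfolding Gam_def
    by (intro has_derivative_vec_lambda has_derivative_sum)
       (rule has_derivative_mult[OF has_derivative_mult[OF chr nth] nth])
  moreover have "(\<lambda>X. \<chi> l. \<Sum>p\<in>UNIV. \<Sum>q\<in>UNIV.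
      christoffel A g c l p q (fst P) * snd P $ k $ p * snd X $ i $ q +
      (christoffel A g c l p q (fst P) * snd X $ k $ p + 
        der (christoffel A g c l p q) (fst P) (fst X) * snd P $ k $ p) * snd P $ i $ q)
    = (\<lambda>X. dGam c (fst P) (fst X) (snd P $ k) (snd P $ i) + Gam c (fst P) (snd X $ k) (snd P $ i) 
     + Gam c (fst P) (snd P $ k) (snd X $ i))"
    by (simp add: fun_eq_iff vec_eq_iff dGam_def Gam_def sum.distrib distrib_right)
  ultimately show ?thesis by simp
qed

lemma der_H_coords:
  assumes c: "c \<in> A" and y: "fst P \<in> U c"
  shows "der (H_coords A g c i) P X = (snd X $ i, \<chi> k. - (dGam c (fst P) (fst X) (snd P $ k) (snd P $ i) 
     + Gam c (fst P) (snd X $ k) (snd P $ i) + Gam c (fst P) (snd P $ k) (snd X $ i)))"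
proof -
  have "((\<lambda>P. (snd P $ i, \<chi> k. - Gam c (fst P) (snd P $ k) (snd P $ i))) has_derivative (\<lambda>X. 
     (snd X $ i, \<chi> k. - (dGam c (fst P) (fst X) (snd P $ k) (snd P $ i) 
     + Gam c (fst P) (snd X $ k) (snd P $ i) + Gam c (fst P) (snd P $ k) (snd X $ i))))) (at P)"
    by (intro has_derivative_Pair has_derivative_vec_lambda has_derivative_minus has_derivative_Gam[OF c y]
        bounded_linear_imp_has_derivative bounded_linear_compose[OF bounded_linear_vec_nth] bounded_linear_snd)
  then have "(H_coords A g c i has_derivative (\<lambda>X. 
     (snd X $ i, \<chi> k. - (dGam c (fst P) (fst X) (snd P $ k) (snd P $ i) 
     + Gam c (fst P) (snd X $ k) (snd P $ i) + Gam c (fst P) (snd P $ k) (snd X $ i))))) (at P)"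
    by (simp add: H_coords_eq[abs_def])
  from der_eqI[OF this] show ?thesis by simp
qed

lemma der_V_coords: "der (V_coords i) P = (V_coords i :: 'n fcoords \<Rightarrow> 'n fcoords)"
  by (rule der_eqI[OF bounded_linear_imp_has_derivative[OF bounded_linear_V_coords]])

text \<open>\<open>H_j\<close> is the horizontal lift of \<open>e^j\<close>, and \<open>V_i\<close> moves \<open>e^0\<close> towards \<open>e^i\<close> and \<open>e^i\<close> towards \<open>- e^0\<close>.\<close>

lemma bracket_V_H:
  assumes c: "c \<in> A" and y: "fst P \<in> U c" and i: "i \<noteq> 0"
  shows "der (H_coords A g c j) P (V_coords i P) - V_coords i (H_coords A g c j P) =
    (if j = 0 then H_coords A g c i P else if j = i then - H_coords A g c 0 P else 0)"
proof -
  have dG0: "dGam c (fst P) 0 u v = 0" for u v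
    using linear_0[OF has_derivative_linear[OF has_derivative_christoffel[OF c y]]]
    by (simp add: dGam_def vec_eq_iff)
  note lin = linear_0[OF linear_Gam(1)] linear_0[OF linear_Gam(2)] linear_neg[OF linear_Gam(1)]
    linear_neg[OF linear_Gam(2)]
  show ?thesis
    unfolding der_H_coords[OF c y] using i
    by (auto simp: V_coords_eq H_coords_eq dG0 lin vec_eq_iff prod_eq_iff Gam_sym[OF c y, of "snd P $ i" "snd P $ 0"])
qed

text \<open>The symmetry of the connection removes the component along the base; the bracket moves each frame
vector by the curvature.\<close>

lemma bracket_H_H:
  assumes c: "c \<in> A" and y: "fst P \<in> U c"
  shows "der (H_coords A g c j) P (H_coords A g c i P) - der (H_coords A g c i) P (H_coords A g c j P) =
    (0, \<chi> k. - Riem c (fst P) (snd P $ i) (snd P $ j) (snd P $ k))"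
proof -
  note lin = linear_neg[OF linear_Gam(1)] linear_neg[OF linear_Gam(2)]
  let ?E = "\<lambda>k. snd P $ k"
  have s: "dGam c (fst P) (?E a) (?E k) (?E b) = dGam c (fst P) (?E a) (?E b) (?E k)"
    "Gam c (fst P) (Gam c (fst P) (?E k) (?E a)) (?E b) = Gam c (fst P) (?E b) (Gam c (fst P) (?E a) (?E k))" for a b k
    using dGam_sym[OF c y, of "?E a" "?E k" "?E b"] Gam_sym[OF c y, of "Gam c (fst P) (?E k) (?E a)" "?E b"]
      Gam_sym[OF c y, of "?E k" "?E a"] by simp_all
  have s': "Gam c (fst P) (?E j) (?E i) = Gam c (fst P) (?E i) (?E j)" by (rule Gam_sym[OF c y])
  have "- (dGam c (fst P) (?E i) (?E k) (?E j) + Gam c (fst P) (- Gam c (fst P) (?E k) (?E i)) (?E j)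
        + Gam c (fst P) (?E k) (- Gam c (fst P) (?E j) (?E i)))
      - (- (dGam c (fst P) (?E j) (?E k) (?E i) + Gam c (fst P) (- Gam c (fst P) (?E k) (?E j)) (?E i)
        + Gam c (fst P) (?E k) (- Gam c (fst P) (?E i) (?E j))))
      = - Riem c (fst P) (?E i) (?E j) (?E k)" for k
    unfolding s' s(1)[of i k j] s(1)[of j k i] lin s(2)[of k i j] s(2)[of k j i] Riem_def by simp
  then show ?thesis
    unfolding der_H_coords[OF c y] H_coords_eq prod_eq_iff by (simp add: vec_eq_iff s')
qed

lemma Riem_coeff:
  assumes c: "c \<in> A" and y: "y \<in> U c"
  shows "(\<chi> l. \<Sum>k\<in>UNIV. \<Sum>i\<in>UNIV. \<Sum>j\<in>UNIV. curvature_coeff A g c l k i j y * w $ k * u $ i * v $ j)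
    = Riem c y u v w"
proof -
  let ?\<Gamma> = "christoffel A g c"
  let ?d = "\<lambda>l p q i. partial i (?\<Gamma> l p q) y"
  have d: "der (?\<Gamma> l p q) y z = (\<Sum>i\<in>UNIV. z $ i * ?d l p q i)" for l p q z
    unfolding partial_def
    using vec_linear_expand[OF has_derivative_linear[OF has_derivative_christoffel[OF c y]], of l p q z] by simp
  have 1: "dGam c y a b w $ l = (\<Sum>k\<in>UNIV. \<Sum>i\<in>UNIV. \<Sum>j\<in>UNIV. ?d l j k i * w $ k * a $ i * b $ j)" for a b l
  proof -
    have "dGam c y a b w $ l = (\<Sum>j\<in>UNIV. \<Sum>k\<in>UNIV. \<Sum>i\<in>UNIV. ?d l j k i * w $ k * a $ i * b $ j)"
      unfolding dGam_def d by (simp add: sum_distrib_left sum_distrib_right mult_ac)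
    also have "\<dots> = (\<Sum>k\<in>UNIV. \<Sum>i\<in>UNIV. \<Sum>j\<in>UNIV. ?d l j k i * w $ k * a $ i * b $ j)"
      by (rule sum3_rotate[symmetric])
    finally show ?thesis .
  qed
  have 2: "Gam c y a (Gam c y b w) $ l = (\<Sum>k\<in>UNIV. \<Sum>i\<in>UNIV. \<Sum>j\<in>UNIV. 
     (\<Sum>m\<in>UNIV. ?\<Gamma> l i m y * ?\<Gamma> m j k y) * w $ k * a $ i * b $ j)" for a b l
  proof -
    have "Gam c y a (Gam c y b w) $ l = (\<Sum>i\<in>UNIV. \<Sum>m\<in>UNIV. \<Sum>j\<in>UNIV. \<Sum>k\<in>UNIV. 
        ?\<Gamma> l i m y * ?\<Gamma> m j k y * w $ k * a $ i * b $ j)"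
      unfolding Gam_def by (simp add: sum_distrib_left sum_distrib_right mult_ac)
    also have "\<dots> = (\<Sum>i\<in>UNIV. \<Sum>j\<in>UNIV. \<Sum>k\<in>UNIV. \<Sum>m\<in>UNIV. 
        ?\<Gamma> l i m y * ?\<Gamma> m j k y * w $ k * a $ i * b $ j)"
      by (intro sum.cong refl sum3_rotate[symmetric])
    also have "\<dots> = (\<Sum>k\<in>UNIV. \<Sum>i\<in>UNIV. \<Sum>j\<in>UNIV. \<Sum>m\<in>UNIV. 
        ?\<Gamma> l i m y * ?\<Gamma> m j k y * w $ k * a $ i * b $ j)"
      by (rule sum3_rotate)
    finally show ?thesis by (simp add: sum_distrib_right)
  qed
  have 3: "(\<Sum>k\<in>UNIV. \<Sum>i\<in>UNIV. \<Sum>j\<in>UNIV. f k j i * w $ k * u $ i * v $ j)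
    = (\<Sum>k\<in>UNIV. \<Sum>i\<in>UNIV. \<Sum>j\<in>UNIV. f k i j * w $ k * v $ i * u $ j)" for f :: "'n \<Rightarrow> 'n \<Rightarrow> 'n \<Rightarrow> real"
    by (rule sum.cong[OF refl], subst sum.swap) (simp add: mult_ac)
  show ?thesis
    unfolding vec_eq_iff Riem_def curvature_coeff_def Let_def
    using 3[of "\<lambda>k i j. ?d l j k i" for l] 3[of "\<lambda>k i j. (\<Sum>m\<in>UNIV. ?\<Gamma> l i m y * ?\<Gamma> m j k y)" for l]
    by (simp add: 1 2 algebra_simps sum.distrib sum_subtractf)
qed

text \<open>The function \<open>\<langle>e^0, e^0\<rangle>\<close> has vanishing horizontal derivatives at all \<open>(y, E)\<close>, orthonormal or not, because
the metric is parallel. Hence the bracket of two horizontal fields annihilates it too, and that derivative is the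
curvature term.\<close>

lemma Riem_skew:
  fixes P :: "'n fcoords"
  assumes c: "c \<in> A" and y: "fst P \<in> U c"
  shows "snd P $ 0 \<bullet> (G c (fst P) *v Riem c (fst P) (snd P $ i) (snd P $ j) (snd P $ 0)) = 0"
proof -
  let ?W = "U c \<times> (UNIV :: ('n coords, 'n) vec set)"
  have o: "open ?W" using c by (intro open_Times open_U open_UNIV)
  define \<psi> :: "'n fcoords \<Rightarrow> real" where "\<psi> P = snd P $ 0 \<bullet> (G c (fst P) *v snd P $ 0)" for P
  have bl: "bounded_linear (\<lambda>P :: 'n fcoords. snd P $ 0)"
    by (rule bounded_linear_compose[OF bounded_linear_vec_nth bounded_linear_snd])
  have Gs: "smooth_on ?W (\<lambda>P. G c (fst P))"
    by (rule smooth_on_compose[OF o smooth_G[OF c] smooth_on_linear[OF o bounded_linear_fst]]) auto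
  have sm: "smooth_on ?W \<psi>"
    unfolding \<psi>_def[abs_def]
    by (rule smooth_on_bilinear[OF o bounded_bilinear_inner smooth_on_linear[OF o bl]
          smooth_on_bilinear[OF o bounded_bilinear_matrix_vector_mult Gs smooth_on_linear[OF o bl]]])
  have der\<psi>: "der \<psi> Q X = snd Q $ 0 \<bullet> (G c (fst Q) *v snd X $ 0 + dG c (fst Q) (fst X) *v snd Q $ 0) 
      + snd X $ 0 \<bullet> (G c (fst Q) *v snd Q $ 0)" if "Q \<in> ?W" for Q X
  proof -
    have GQ: "((\<lambda>P. G c (fst P)) has_derivative (\<lambda>X. dG c (fst Q) (fst X))) (at Q)"
      using that by (intro has_derivative_compose[OF has_derivative_fst[OF has_derivative_ident] has_derivative_G[OF c]]) auto
    note E = bounded_linear_imp_has_derivative[OF bl, of "at Q"]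
    have "(\<psi> has_derivative (\<lambda>X. snd Q $ 0 \<bullet> (G c (fst Q) *v snd X $ 0 + dG c (fst Q) (fst X) *v snd Q $ 0) 
      + snd X $ 0 \<bullet> (G c (fst Q) *v snd Q $ 0))) (at Q)"
      unfolding \<psi>_def[abs_def]
      by (rule has_derivative_inner[OF E bounded_bilinear.FDERIV[OF bounded_bilinear_matrix_vector_mult GQ E]])
    from der_eqI[OF this] show ?thesis by simp
  qed
  have H0: "lieH c k \<psi> Q = 0" if "Q \<in> ?W" for k Q
  proof -
    have "fst Q \<in> U c" using that by auto
    from Gam_metric[OF c this, of "snd Q $ 0" "snd Q $ k" "snd Q $ 0"]
    show ?thesis unfolding lie_def der\<psi>[OF that]
      by (simp add: H_coords_eq vec.neg inner_add_right inner_diff_right)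
  qed
  have P: "P \<in> ?W" using y by (cases P) auto
  have HH: "lieH c k (lieH c l \<psi>) P = 0" for k l
  proof -
    have "lieH c k (\<lambda>_. 0 :: real) P = lieH c k (lieH c l \<psi>) P"
      by (rule lie_cong[OF o smooth_on_const[OF o] _ P]) (simp add: H0)
    then show ?thesis by (simp add: lie_def)
  qed
  have "0 = der \<psi> P (der (H_coords A g c j) P (H_coords A g c i P) - der (H_coords A g c i) P (H_coords A g c j P))"
    using lie_commutator[OF o sm smooth_H_coords[OF c] smooth_H_coords[OF c] P, of i j] by (simp add: HH)
  also have "\<dots> = - (2 * (snd P $ 0 \<bullet> (G c (fst P) *v Riem c (fst P) (snd P $ i) (snd P $ j) (snd P $ 0))))"
    unfolding bracket_H_H[OF c y] der\<psi>[OF P]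
    using matrix_form_commute[OF G_sym[OF c y], of "snd P $ 0" "Riem c (fst P) (snd P $ i) (snd P $ j) (snd P $ 0)"]
    by (simp add: linear_0[OF linear_dG[OF c y]] vec.neg)
  finally show ?thesis by simp
qed

lemma frame_expand:
  assumes P: "P \<in> frame_set c"
  shows "r = (\<Sum>k\<in>UNIV. (snd P $ k \<bullet> (G c (fst P) *v r)) *\<^sub>R snd P $ k)"
proof -
  let ?E = "snd P" and ?G = "G c (fst P)"
  have "(?E ** ?G ** transpose ?E) $ i $ j = ?E $ i \<bullet> (?G *v ?E $ j)" for i j
    by (simp add: matrix_form_expand matrix_matrix_mult_def transpose_def sum_distrib_right sum_distrib_left)
      (rule sum.swap)
  then have "?E ** ?G ** transpose ?E = mat 1"
    using P by (simp add: frame_set_def vec_eq_iff mat_def)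
  then have "transpose ?E ** (?E ** ?G) = mat 1" using matrix_left_right_inverse by blast
  then have "r = transpose ?E *v (?E *v (?G *v r))" by (simp add: matrix_vector_mul_assoc matrix_mul_assoc)
  also have "\<dots> = (\<Sum>k\<in>UNIV. (?E $ k \<bullet> (?G *v r)) *\<^sub>R ?E $ k)"
    by (simp add: vec_eq_iff matrix_vector_mult_def transpose_def inner_vec_def sum_component mult.commute)
  finally show ?thesis .
qed

text \<open>Functions lifted from the unit tangent bundle are, in coordinates, functions of \<open>(y, e^0)\<close>. Only this
infinitesimal form of the dependence is used.\<close>

definition e0_function :: "'n fcoords set \<Rightarrow> ('n fcoords \<Rightarrow> real) \<Rightarrow> bool" where
  "e0_function W \<Phi> \<longleftrightarrow> (\<forall>P\<in>W. \<forall>X. fst X = 0 \<longrightarrow> snd X $ 0 = 0 \<longrightarrow> der \<Phi> P X = 0)"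

lemma e0_function_cong:
  assumes "smooth_on W \<Phi>" "e0_function W \<Phi>" "P \<in> W" "fst X = fst Y" "snd X $ 0 = snd Y $ 0"
  shows "der \<Phi> P X = der \<Phi> P Y"
proof -
  have "fst (X - Y) = 0" "snd (X - Y) $ 0 = 0" using assms by simp_all
  then have "der \<Phi> P (X - Y) = 0" using assms(2,3) unfolding e0_function_def by blast
  then show ?thesis using linear_diff[OF smooth_on_linear_der[OF assms(1,3)]] by simp
qed

text \<open>The bracket of \<open>V_i\<close> and \<open>V_j\<close> rotates \<open>e^i\<close> and \<open>e^j\<close> and leaves \<open>e^0\<close> fixed.\<close>

lemma lie_V_V:
  assumes W: "open W" and \<Phi>: "smooth_on W \<Phi>" "e0_function W \<Phi>" and P: "P \<in> W"
    and ij: "i \<noteq> 0" "j \<noteq> 0"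
  shows "lieV j (lieV i \<Phi>) P = lieV i (lieV j \<Phi>) P"
proof (cases "i = j")
  case False
  have "der \<Phi> P (V_coords i (V_coords j P) - V_coords j (V_coords i P)) = der \<Phi> P 0"
    using ij False by (intro e0_function_cong[OF \<Phi> P]) (auto simp: V_coords_eq)
  then show ?thesis
    using lie_commutator[OF W \<Phi>(1) smooth_on_linear[OF W bounded_linear_V_coords] smooth_on_linear[OF W bounded_linear_V_coords] P, of j i]
    by (simp add: der_V_coords linear_0[OF smooth_on_linear_der[OF \<Phi>(1) P]])
qed simp

text \<open>Although the bracket of \<open>V_j\<close> and \<open>V_i\<close> annihilates \<open>\<Phi>\<close>, it does not annihilate \<open>V_j \<Phi>\<close>, which depends on \<open>e^j\<close> as well: the
rotation exchanges \<open>e^j\<close> for \<open>e^i\<close>.\<close>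

lemma lie_V_V_V:
  assumes W: "open W" and \<Phi>: "smooth_on W \<Phi>" "e0_function W \<Phi>" and P: "P \<in> W"
    and ij: "i \<noteq> 0" "j \<noteq> 0" "i \<noteq> j"
  shows "lieV j (lieV i (lieV j \<Phi>)) P 
    - lieV i (lieV j (lieV j \<Phi>)) P = lieV i \<Phi> P"
proof -
  let ?V = "V_coords :: 'n \<Rightarrow> 'n fcoords \<Rightarrow> 'n fcoords"
  note sV = smooth_on_linear[OF W bounded_linear_V_coords]
  \<comment> \<open>the bracket of \<open>V_j\<close> and \<open>V_i\<close>, a rotation in the plane of \<open>e^i\<close> and \<open>e^j\<close>\<close>
  define R where "R P = ?V i (?V j P) - ?V j (?V i P)" for P
  have bR: "bounded_linear R" unfolding R_def
    by (intro bounded_linear_sub bounded_linear_compose[OF bounded_linear_V_coords] bounded_linear_V_coords)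
  note sR = smooth_on_linear[OF W bR]
  have derR: "der R P = R" for P by (rule der_eqI[OF bounded_linear_imp_has_derivative[OF bR]])
  have R0: "lie R \<Phi> Q = 0" if "Q \<in> W" for Q
  proof -
    have "der \<Phi> Q (R Q) = der \<Phi> Q 0"
      using ij by (intro e0_function_cong[OF \<Phi> that]) (auto simp: R_def V_coords_eq)
    then show ?thesis by (simp add: lie_def linear_0[OF smooth_on_linear_der[OF \<Phi>(1) that]])
  qed
  have "lie (?V j) (\<lambda>_. 0 :: real) P = lie (?V j) (lie R \<Phi>) P"
    by (rule lie_cong[OF W smooth_on_const[OF W] _ P]) (simp add: R0)
  then have "lie R (lie (?V j) \<Phi>) P = der \<Phi> P (?V j (R P) - R (?V j P))"
    using lie_commutator[OF W \<Phi>(1) sR sV P, of j]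
    by (simp add: der_V_coords derR) (simp add: lie_def)
  also have "\<dots> = der \<Phi> P (?V i P)"
    using ij by (intro e0_function_cong[OF \<Phi> P]) (auto simp: R_def V_coords_eq)
  finally have "lie R (lie (?V j) \<Phi>) P = lie (?V i) \<Phi> P" by (simp add: lie_def)
  then show ?thesis
    using lie_commutator[OF W smooth_on_lie[OF W sV[of j] \<Phi>(1)] sV[of j] sV[of i] P]
    by (simp add: der_V_coords lie_def[of R] R_def)
qed

lemma lie_V_H:
  fixes \<Phi> :: "'n fcoords \<Rightarrow> real"
  assumes c: "c \<in> A" and W: "open W" "W \<subseteq> U c \<times> UNIV" and \<Phi>: "smooth_on W \<Phi>" and P: "P \<in> W" and i: "i \<noteq> 0"
  shows "lieV i (lieH c j \<Phi>) P - lieH c j (lieV i \<Phi>) P =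
    (if j = 0 then lieH c i \<Phi> P else if j = i then - lieH c 0 \<Phi> P else 0)"
proof -
  have y: "fst P \<in> U c" using P W by auto
  note l = smooth_on_linear_der[OF \<Phi> P]
  show ?thesis
    using lie_commutator[OF W(1) \<Phi> smooth_on_linear[OF W(1) bounded_linear_V_coords, of i]
        smooth_on_antimono[OF smooth_H_coords[OF c] W(2)] P, of j]
    by (simp add: der_V_coords bracket_V_H[OF c y i] lie_def linear_neg[OF l] linear_0[OF l])
qed

text \<open>On functions of \<open>(y, e^0)\<close> only the motion \<open>- R(e^0, e^i) e^0\<close> of \<open>e^0\<close> counts. It is orthogonal to \<open>e^0\<close>, hence a
combination of the \<open>e^k\<close> with \<open>k \<noteq> 0\<close>, which are the motions of \<open>e^0\<close> under \<open>V_k\<close>. Expanding it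
requires \<open>P\<close> to be an orthonormal frame.\<close>

lemma lie_H_H:
  assumes c: "c \<in> A" and W: "open W" "W \<subseteq> U c \<times> UNIV" and \<Phi>: "smooth_on W \<Phi>" "e0_function W \<Phi>" 
    and P: "P \<in> W" "P \<in> frame_set c"
  shows "lieH c 0 (lieH c i \<Phi>) P - lieH c i (lieH c 0 \<Phi>) P =
    - (\<Sum>k\<in>UNIV - {0}. (snd P $ k \<bullet> (G c (fst P) *v Riem c (fst P) (snd P $ 0) (snd P $ i) (snd P $ 0))) 
        * lieV k \<Phi> P)"
proof -
  have y: "fst P \<in> U c" using P W by auto
  let ?r = "\<lambda>u. Riem c (fst P) (snd P $ 0) (snd P $ i) u"
  let ?a = "\<lambda>k. snd P $ k \<bullet> (G c (fst P) *v ?r (snd P $ 0))"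
  note l = smooth_on_linear_der[OF \<Phi>(1) P(1)]
  have "?r (snd P $ 0) = (\<Sum>k\<in>UNIV. ?a k *\<^sub>R snd P $ k)" by (rule frame_expand[OF P(2)])
  also have "\<dots> = (\<Sum>k\<in>UNIV - {0}. ?a k *\<^sub>R snd P $ k)"
    by (subst sum.remove[of UNIV 0]) (simp_all add: Riem_skew[OF c y])
  finally have r: "?r (snd P $ 0) = (\<Sum>k\<in>UNIV - {0}. ?a k *\<^sub>R snd P $ k)" .
  have "lieH c 0 (lieH c i \<Phi>) P - lieH c i (lieH c 0 \<Phi>) P
     = der \<Phi> P (0, \<chi> k. - ?r (snd P $ k))"
    using lie_commutator[OF W(1) \<Phi>(1) smooth_on_antimono[OF smooth_H_coords[OF c] W(2)] 
        smooth_on_antimono[OF smooth_H_coords[OF c] W(2)] P(1), of 0 i]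
    unfolding bracket_H_H[OF c y] by simp
  also have "\<dots> = der \<Phi> P (- (\<Sum>k\<in>UNIV - {0}. ?a k *\<^sub>R V_coords k P))"
  proof (rule e0_function_cong[OF \<Phi> P(1)])
    show "snd (0, \<chi> k. - ?r (snd P $ k)) $ 0 = snd (- (\<Sum>k\<in>UNIV - {0}. ?a k *\<^sub>R V_coords k P)) $ 0"
      using r by (simp add: snd_sum sum_component V_coords_eq)
  qed (simp add: fst_sum V_coords_eq)
  also have "\<dots> = - (\<Sum>k\<in>UNIV - {0}. ?a k * lieV k \<Phi> P)"
    by (simp add: linear_neg[OF l] linear_sum[OF l] linear_cmul[OF l] lie_def)
  finally show ?thesis .
qed

lemma curvature_bound:
  assumes p: "p \<in> FB" and c_def: "c = chart_at A (fst p)" and P_def: "P = frame_coords c p"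
    and B: "\<And>x u v w h. x \<in> topspace M \<Longrightarrow> u \<in> unit_tangent_space A g x \<Longrightarrow> v \<in> unit_tangent_space A g x \<Longrightarrow>
      w \<in> unit_tangent_space A g x \<Longrightarrow> h \<in> unit_tangent_space A g x \<Longrightarrow> \<bar>g x u (curvature A g x v w h)\<bar> \<le> B"
  shows "\<bar>snd P $ k \<bullet> (G c (fst P) *v Riem c (fst P) (snd P $ 0) (snd P $ i) (snd P $ 0))\<bar> \<le> B"
proof -
  let ?x = "fst p" and ?e = "snd p"
  have c: "c \<in> A" "?x \<in> cdom c" using chart_at[OF p] by (auto simp: c_def)
  have e: "?e j \<in> unit_tangent_space A g ?x" for j
    using p by (simp add: FB_iff unit_tangent_space_def)
  then have tv: "tvec_of A c ?x (?e j c) = ?e j" for j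
    using tvec_of_tangent[OF _ c] by (simp add: unit_tangent_space_def)
  have x: "?x \<in> topspace M" using p manifold by (simp add: FB_iff smooth_manifold_def)
  have P: "fst P = cmap c ?x" "snd P $ j = ?e j c" for j by (simp_all add: P_def frame_coords_def)
  have "curvature A g ?x (?e 0) (?e i) (?e 0) = tvec_of A c ?x (Riem c (fst P) (snd P $ 0) (snd P $ i) (snd P $ 0))"
    unfolding curvature_def Let_def c_def[symmetric] P using Riem_coeff[OF c(1) imageI[OF c(2)]] by simp
  then have "g ?x (?e k) (curvature A g ?x (?e 0) (?e i) (?e 0)) = 
    snd P $ k \<bullet> (G c (fst P) *v Riem c (fst P) (snd P $ 0) (snd P $ i) (snd P $ 0))"
    using metric_coords[OF c, of "?e k c"] by (simp add: tv P)
  then show ?thesis using B[OF x e e e e, of k 0 i 0] by simp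
qed

end

section \<open>Gamma calculus for fields with the brackets of the frame fields\<close>

definition derivation_on :: "'p set \<Rightarrow> (('p \<Rightarrow> real) \<Rightarrow> bool) \<Rightarrow> (('p \<Rightarrow> real) \<Rightarrow> 'p \<Rightarrow> real) \<Rightarrow> bool" where
  "derivation_on W S D \<longleftrightarrow> (\<forall>u. S u \<longrightarrow> S (D u)) \<and>
     (\<forall>u w. S u \<longrightarrow> S w \<longrightarrow> (\<forall>P\<in>W. D (\<lambda>P. u P + w P) P = D u P + D w P)) \<and>
     (\<forall>u w. S u \<longrightarrow> S w \<longrightarrow> (\<forall>P\<in>W. D (\<lambda>P. u P * w P) P = D u P * w P + u P * D w P)) \<and>
     (\<forall>k u. S u \<longrightarrow> (\<forall>P\<in>W. D (\<lambda>P. k * u P) P = k * D u P)) \<and>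
     (\<forall>u w. S u \<longrightarrow> (\<forall>P\<in>W. u P = w P) \<longrightarrow> (\<forall>P\<in>W. D u P = D w P))"

text \<open>\<open>S\<close> plays the role of the smooth functions on \<open>W\<close>. The relations among the \<open>V_i\<close> and for \<open>[H_0, H_i]\<close> hold only on
lifted functions, or only at frames, and are therefore hypotheses of the lemmas that need them.\<close>

locale frame_fields =
  fixes W :: "'p set" and S :: "('p \<Rightarrow> real) \<Rightarrow> bool"
    and Vf Hf :: "'n::{finite,zero} \<Rightarrow> ('p \<Rightarrow> real) \<Rightarrow> 'p \<Rightarrow> real" and \<sigma> \<kappa> :: real
  assumes S_add: "S u \<Longrightarrow> S w \<Longrightarrow> S (\<lambda>P. u P + w P)"
    and S_mult: "S u \<Longrightarrow> S w \<Longrightarrow> S (\<lambda>P. u P * w P)"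
    and S_const: "S (\<lambda>P. k)"
    and derivation_V: "i \<noteq> 0 \<Longrightarrow> derivation_on W S (Vf i)"
    and derivation_H: "derivation_on W S (Hf i)"
    and V_H: "S u \<Longrightarrow> P \<in> W \<Longrightarrow> i \<noteq> 0 \<Longrightarrow> Vf i (Hf j u) P - Hf j (Vf i u) P =
      (if j = 0 then Hf i u P else if j = i then - Hf 0 u P else 0)"
begin

abbreviation "nonzero \<equiv> UNIV - {0 :: 'n}"

abbreviation "is_deriv \<equiv> derivation_on W S"

lemma is_derivD:
  assumes "is_deriv D"
  shows deriv_S: "S u \<Longrightarrow> S (D u)"
    and deriv_add: "S u \<Longrightarrow> S w \<Longrightarrow> P \<in> W \<Longrightarrow> D (\<lambda>P. u P + w P) P = D u P + D w P"
    and deriv_mult: "S u \<Longrightarrow> S w \<Longrightarrow> P \<in> W \<Longrightarrow> D (\<lambda>P. u P * w P) P = D u P * w P + u P * D w P"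
    and deriv_cmult: "S u \<Longrightarrow> P \<in> W \<Longrightarrow> D (\<lambda>P. k * u P) P = k * D u P"
    and deriv_cong: "S u \<Longrightarrow> (\<And>P. P \<in> W \<Longrightarrow> u P = w P) \<Longrightarrow> P \<in> W \<Longrightarrow> D u P = D w P"
proof -
  note D = assms[unfolded derivation_on_def]
  show "S u \<Longrightarrow> S (D u)" by (rule D[THEN conjunct1, rule_format])
  show "S u \<Longrightarrow> S w \<Longrightarrow> P \<in> W \<Longrightarrow> D (\<lambda>P. u P + w P) P = D u P + D w P"
    by (rule D[THEN conjunct2, THEN conjunct1, rule_format])
  show "S u \<Longrightarrow> S w \<Longrightarrow> P \<in> W \<Longrightarrow> D (\<lambda>P. u P * w P) P = D u P * w P + u P * D w P"
    by (rule D[THEN conjunct2, THEN conjunct2, THEN conjunct1, rule_format])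
  show "S u \<Longrightarrow> P \<in> W \<Longrightarrow> D (\<lambda>P. k * u P) P = k * D u P"
    by (rule D[THEN conjunct2, THEN conjunct2, THEN conjunct2, THEN conjunct1, rule_format])
  show "S u \<Longrightarrow> (\<And>P. P \<in> W \<Longrightarrow> u P = w P) \<Longrightarrow> P \<in> W \<Longrightarrow> D u P = D w P"
    by (rule D[THEN conjunct2, THEN conjunct2, THEN conjunct2, THEN conjunct2, rule_format])
qed

lemma S_cmult: "S u \<Longrightarrow> S (\<lambda>P. k * u P)" by (rule S_mult[OF S_const])

lemma S_sum: "(\<And>i. i \<in> J \<Longrightarrow> S (u i)) \<Longrightarrow> S (\<lambda>P. \<Sum>i\<in>J. u i P)"
  by (induction J rule: infinite_finite_induct) (auto intro: S_const S_add)

lemma deriv_const: "is_deriv D \<Longrightarrow> P \<in> W \<Longrightarrow> D (\<lambda>P. 0) P = 0"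
  using deriv_cmult[OF _ S_const, of D P 0 0] by simp

lemma deriv_sum: 
  assumes "is_deriv D" "P \<in> W" "\<And>i. i \<in> J \<Longrightarrow> S (u i)"
  shows "D (\<lambda>P. \<Sum>i\<in>J. u i P) P = (\<Sum>i\<in>J. D (u i) P)"
  using assms(3)
proof (induction J rule: infinite_finite_induct)
  case (insert x F)
  then show ?case using deriv_add[OF assms(1) _ S_sum assms(2), of "u x" F u] by simp
qed (simp_all add: deriv_const assms)

lemma S_V: "i \<noteq> 0 \<Longrightarrow> S u \<Longrightarrow> S (Vf i u)" using deriv_S[OF derivation_V] .
lemma S_H: "S u \<Longrightarrow> S (Hf i u)" using deriv_S[OF derivation_H] .

definition L :: "('p \<Rightarrow> real) \<Rightarrow> 'p \<Rightarrow> real" where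
  "L u P = \<sigma>\<^sup>2 / 2 * (\<Sum>i\<in>nonzero. Vf i (Vf i u) P) + \<kappa> * Hf 0 u P"

lemma L_sum:
  assumes "P \<in> W" "\<And>i. i \<in> J \<Longrightarrow> S (u i)"
  shows "L (\<lambda>P. \<Sum>i\<in>J. u i P) P = (\<Sum>i\<in>J. L (u i) P)"
proof -
  have "Vf k (Vf k (\<lambda>P. \<Sum>i\<in>J. u i P)) P = (\<Sum>i\<in>J. Vf k (Vf k (u i)) P)" if "k \<noteq> 0" for k
  proof -
    have "Vf k (Vf k (\<lambda>P. \<Sum>i\<in>J. u i P)) P = Vf k (\<lambda>P. \<Sum>i\<in>J. Vf k (u i) P) P"
      using that assms by (intro deriv_cong[OF derivation_V] deriv_sum[OF derivation_V] S_V S_sum)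
    also have "\<dots> = (\<Sum>i\<in>J. Vf k (Vf k (u i)) P)"
      using that assms by (intro deriv_sum[OF derivation_V] S_V)
    finally show ?thesis .
  qed
  then have "(\<Sum>k\<in>nonzero. Vf k (Vf k (\<lambda>P. \<Sum>i\<in>J. u i P)) P) = (\<Sum>i\<in>J. \<Sum>k\<in>nonzero. Vf k (Vf k (u i)) P)"
    by (subst sum.swap) auto
  moreover have "Hf 0 (\<lambda>P. \<Sum>i\<in>J. u i P) P = (\<Sum>i\<in>J. Hf 0 (u i) P)"
    using assms by (intro deriv_sum[OF derivation_H])
  ultimately show ?thesis
    unfolding L_def by (simp add: sum.distrib sum_distrib_left)
qed

lemma L_mult:
  assumes "P \<in> W" "S u" "S w"
  shows "L (\<lambda>P. u P * w P) P = L u P * w P + u P * L w P + \<sigma>\<^sup>2 * (\<Sum>k\<in>nonzero. Vf k u P * Vf k w P)"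
proof -
  have "Vf k (Vf k (\<lambda>P. u P * w P)) P = Vf k (Vf k u) P * w P + u P * Vf k (Vf k w) P + 2 * (Vf k u P * Vf k w P)" 
    if k: "k \<in> nonzero" for k
  proof -
    have d: "is_deriv (Vf k)" using k by (intro derivation_V) auto
    note S = deriv_S[OF d assms(2)] deriv_S[OF d assms(3)]
    have "Vf k (Vf k (\<lambda>P. u P * w P)) P = Vf k (\<lambda>P. Vf k u P * w P + u P * Vf k w P) P"
      using assms by (intro deriv_cong[OF d] deriv_mult[OF d] deriv_S[OF d] S_mult)
    also have "\<dots> = Vf k (\<lambda>P. Vf k u P * w P) P + Vf k (\<lambda>P. u P * Vf k w P) P"
      using assms S by (intro deriv_add[OF d] S_mult)
    finally show ?thesis
      using deriv_mult[OF d S(1) assms(3,1)] deriv_mult[OF d assms(2) S(2) assms(1)] by simp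
  qed
  then show ?thesis
    unfolding L_def using deriv_mult[OF derivation_H[of 0] assms(2,3,1)]
    by (simp add: sum.distrib sum_distrib_left sum_distrib_right algebra_simps)
qed

text \<open>The operator \<open>\<Gamma>\<^sub>2\<close> of the symmetrised form \<open>\<Sum>i. X_i u * Y_i w\<close>, on the diagonal.\<close>

definition Gamma2_sum :: "('n \<Rightarrow> ('p \<Rightarrow> real) \<Rightarrow> 'p \<Rightarrow> real) \<Rightarrow> ('n \<Rightarrow> ('p \<Rightarrow> real) \<Rightarrow> 'p \<Rightarrow> real) \<Rightarrow> 
   'n set \<Rightarrow> ('p \<Rightarrow> real) \<Rightarrow> 'p \<Rightarrow> real" where
  "Gamma2_sum X Y J u P = 1 / 2 * (L (\<lambda>P. \<Sum>i\<in>J. X i u P * Y i u P) P 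
     - (\<Sum>i\<in>J. X i (L u) P * Y i u P) - (\<Sum>i\<in>J. X i u P * Y i (L u) P))"

text \<open>By \<open>L_mult\<close> the failure of the Leibniz rule for \<open>L\<close> is \<open>\<sigma>\<^sup>2 \<Sum>k. V_k u * V_k w\<close>. The remaining terms
combine to brackets with \<open>L\<close>.\<close>

lemma Gamma2_sum_eq:
  assumes "P \<in> W" "S u" and X: "\<And>i. i \<in> J \<Longrightarrow> is_deriv (X i)" and Y: "\<And>i. i \<in> J \<Longrightarrow> is_deriv (Y i)"
  shows "Gamma2_sum X Y J u P = 1 / 2 * (\<Sum>i\<in>J. X i u P * (L (Y i u) P - Y i (L u) P)
     + Y i u P * (L (X i u) P - X i (L u) P) + \<sigma>\<^sup>2 * (\<Sum>j\<in>nonzero. Vf j (X i u) P * Vf j (Y i u) P))"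
proof -
  have "L (\<lambda>P. \<Sum>i\<in>J. X i u P * Y i u P) P = (\<Sum>i\<in>J. L (X i u) P * Y i u P + X i u P * L (Y i u) P 
     + \<sigma>\<^sup>2 * (\<Sum>j\<in>nonzero. Vf j (X i u) P * Vf j (Y i u) P))"
    using assms by (subst L_sum) (auto intro!: S_mult deriv_S[OF X] deriv_S[OF Y] sum.cong L_mult)
  then show ?thesis unfolding Gamma2_sum_def
    by (simp add: sum_subtractf[symmetric] algebra_simps)
qed

lemma bracket_L:
  assumes "P \<in> W" "S u" "is_deriv D"
  shows "L (D u) P - D (L u) P = \<sigma>\<^sup>2 / 2 * (\<Sum>j\<in>nonzero. Vf j (Vf j (D u)) P - D (Vf j (Vf j u)) P)
    + \<kappa> * (Hf 0 (D u) P - D (Hf 0 u) P)"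
proof -
  have "D (L u) P = D (\<lambda>P. \<sigma>\<^sup>2 / 2 * (\<Sum>i\<in>nonzero. Vf i (Vf i u) P)) P + D (\<lambda>P. \<kappa> * Hf 0 u P) P"
    unfolding L_def[abs_def] using assms by (intro deriv_add S_cmult S_sum S_V S_H) auto
  also have "\<dots> = \<sigma>\<^sup>2 / 2 * D (\<lambda>P. \<Sum>i\<in>nonzero. Vf i (Vf i u) P) P + \<kappa> * D (Hf 0 u) P"
    by (intro arg_cong2[where f = "(+)"] deriv_cmult[OF assms(3)] S_sum S_V S_H assms) auto
  also have "D (\<lambda>P. \<Sum>i\<in>nonzero. Vf i (Vf i u) P) P = (\<Sum>i\<in>nonzero. D (Vf i (Vf i u)) P)"
    using assms by (intro deriv_sum S_V) auto
  finally show ?thesis unfolding L_def[of "D u" P] by (simp add: sum_subtractf algebra_simps)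
qed

text \<open>The sum appears because \<open>[V_j, H_0] = H_j\<close>, and the multiple of \<open>Hf 0 u\<close> because
exchanging \<open>H_j\<close> and \<open>V_j\<close> yields \<open>H_0\<close> once for each \<open>j\<close>.\<close>

lemma L_H0:
  assumes P: "P \<in> W" and u: "S u"
  shows "L (Hf 0 u) P - Hf 0 (L u) P = \<sigma>\<^sup>2 * (\<Sum>j\<in>nonzero. Vf j (Hf j u) P) + \<sigma>\<^sup>2 / 2 * (real (card nonzero) * Hf 0 u P)"
proof -
  have "Vf j (Vf j (Hf 0 u)) P - Hf 0 (Vf j (Vf j u)) P = 2 * Vf j (Hf j u) P + Hf 0 u P" if j: "j \<in> nonzero" for j
  proof -
    have j0: "j \<noteq> 0" using j by simp
    note d = derivation_V[OF j0]
    have "Vf j (Vf j (Hf 0 u)) P = Vf j (\<lambda>P. Hf 0 (Vf j u) P + Hf j u P) P"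
    proof (rule deriv_cong[OF d _ _ P])
      show "Vf j (Hf 0 u) Q = Hf 0 (Vf j u) Q + Hf j u Q" if "Q \<in> W" for Q
        using V_H[OF u that j0, of 0] by simp
    qed (intro S_V S_H u j0)
    also have "\<dots> = Vf j (Hf 0 (Vf j u)) P + Vf j (Hf j u) P"
      by (intro deriv_add[OF d] S_V S_H u j0 P)
    finally show ?thesis
      using V_H[OF S_V[OF j0 u] P j0, of 0] V_H[OF u P j0, of j] j0 by simp
  qed
  then have "(\<Sum>j\<in>nonzero. Vf j (Vf j (Hf 0 u)) P - Hf 0 (Vf j (Vf j u)) P) = (\<Sum>j\<in>nonzero. 2 * Vf j (Hf j u) P + Hf 0 u P)"
    by (intro sum.cong refl)
  also have "\<dots> = 2 * (\<Sum>j\<in>nonzero. Vf j (Hf j u) P) + real (card nonzero) * Hf 0 u P"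
    by (simp only: sum.distrib sum_distrib_left sum_constant)
  finally have eq: "(\<Sum>j\<in>nonzero. Vf j (Vf j (Hf 0 u)) P - Hf 0 (Vf j (Vf j u)) P) = \<dots>" .
  show ?thesis
    unfolding bracket_L[OF P u derivation_H] eq by (simp add: field_simps del: card_Diff_insert card_Diff_singleton)
qed

lemma L_Hi:
  assumes P: "P \<in> W" and u: "S u" and i: "i \<in> nonzero"
  shows "L (Hf i u) P - Hf i (L u) P = - \<sigma>\<^sup>2 * Vf i (Hf 0 u) P + \<sigma>\<^sup>2 / 2 * Hf i u P
     + \<kappa> * (Hf 0 (Hf i u) P - Hf i (Hf 0 u) P)"
proof -
  have i0: "i \<noteq> 0" using i by simp
  have "Vf j (Vf j (Hf i u)) P - Hf i (Vf j (Vf j u)) P = (if j = i then - 2 * Vf i (Hf 0 u) P + Hf i u P else 0)" 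
    if j: "j \<in> nonzero" for j
  proof -
    have j0: "j \<noteq> 0" using j by simp
    note d = derivation_V[OF j0]
    show ?thesis
    proof (cases "j = i")
      case False
      have "Vf j (Vf j (Hf i u)) P = Vf j (Hf i (Vf j u)) P"
      proof (rule deriv_cong[OF d _ _ P])
        show "Vf j (Hf i u) Q = Hf i (Vf j u) Q" if "Q \<in> W" for Q
          using V_H[OF u that j0, of i] False i0 by simp
      qed (intro S_V S_H u j0)
      then show ?thesis using V_H[OF S_V[OF j0 u] P j0, of i] False i0 by simp
    next
      case True
      have "Vf i (Vf i (Hf i u)) P = Vf i (\<lambda>P. Hf i (Vf i u) P + (- 1) * Hf 0 u P) P"
      proof (rule deriv_cong[OF derivation_V[OF i0] _ _ P])
        show "Vf i (Hf i u) Q = Hf i (Vf i u) Q + (- 1) * Hf 0 u Q" if "Q \<in> W" for Q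
          using V_H[OF u that i0, of i] i0 by simp
      qed (intro S_V S_H u i0)
      also have "\<dots> = Vf i (Hf i (Vf i u)) P + Vf i (\<lambda>P. (- 1) * Hf 0 u P) P"
        by (intro deriv_add[OF derivation_V[OF i0]] S_V S_H S_cmult u i0 P)
      also have "Vf i (\<lambda>P. (- 1) * Hf 0 u P) P = (- 1) * Vf i (Hf 0 u) P"
        by (intro deriv_cmult[OF derivation_V[OF i0]] S_H u P)
      finally show ?thesis
        using V_H[OF S_V[OF i0 u] P i0, of i] V_H[OF u P i0, of 0] i0 True by simp
    qed
  qed
  then have "(\<Sum>j\<in>nonzero. Vf j (Vf j (Hf i u)) P - Hf i (Vf j (Vf j u)) P) 
      = (\<Sum>j\<in>nonzero. if j = i then - 2 * Vf i (Hf 0 u) P + Hf i u P else 0)"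
    by (intro sum.cong) auto
  also have "\<dots> = - 2 * Vf i (Hf 0 u) P + Hf i u P" using i by (simp add: sum.delta)
  finally have eq: "(\<Sum>j\<in>nonzero. Vf j (Vf j (Hf i u)) P - Hf i (Vf j (Vf j u)) P) = \<dots>" .
  show ?thesis
    unfolding bracket_L[OF P u derivation_H] eq by (simp add: field_simps)
qed

text \<open>The term \<open>- \<kappa> * Hf i u\<close> is the source of the coercivity in the horizontal directions. The multiple of \<open>Vf i u\<close> comes from the
rotations in the planes of \<open>e^i\<close> and \<open>e^j\<close> for \<open>j \<noteq> i\<close>.\<close>

lemma L_V:
  assumes P: "P \<in> W" and u: "S u" and i: "i \<in> nonzero"
    and VV: "\<And>i j P. P \<in> W \<Longrightarrow> i \<in> nonzero \<Longrightarrow> j \<in> nonzero \<Longrightarrow> Vf j (Vf i u) P = Vf i (Vf j u) P"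
    and VVV: "\<And>i j P. P \<in> W \<Longrightarrow> i \<in> nonzero \<Longrightarrow> j \<in> nonzero \<Longrightarrow> i \<noteq> j \<Longrightarrow> 
      Vf j (Vf i (Vf j u)) P - Vf i (Vf j (Vf j u)) P = Vf i u P"
  shows "L (Vf i u) P - Vf i (L u) P = (real (card nonzero) - 1) * \<sigma>\<^sup>2 / 2 * Vf i u P - \<kappa> * Hf i u P"
proof -
  have i0: "i \<noteq> 0" using i by simp
  have "Vf j (Vf j (Vf i u)) P - Vf i (Vf j (Vf j u)) P = Vf i u P - (if j = i then Vf i u P else 0)" 
    if j: "j \<in> nonzero" for j
  proof (cases "j = i")
    case False
    have "Vf j (Vf j (Vf i u)) P = Vf j (Vf i (Vf j u)) P"
      using j i0 by (intro deriv_cong[OF derivation_V _ VV P] S_V u i) auto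
    then show ?thesis using VVV[OF P i j] False by simp
  qed simp
  then have "(\<Sum>j\<in>nonzero. Vf j (Vf j (Vf i u)) P - Vf i (Vf j (Vf j u)) P) 
      = (\<Sum>j\<in>nonzero. Vf i u P - (if j = i then Vf i u P else 0))"
    by (intro sum.cong) auto
  also have "\<dots> = real (card nonzero) * Vf i u P - Vf i u P" 
    using i by (simp only: sum_subtractf sum_constant) (simp add: sum.delta)
  finally have eq: "(\<Sum>j\<in>nonzero. Vf j (Vf j (Vf i u)) P - Vf i (Vf j (Vf j u)) P) = \<dots>" .
  have eq': "Hf 0 (Vf i u) P - Vf i (Hf 0 u) P = - Hf i u P" using V_H[OF u P i0, of 0] by simp
  show ?thesis
    unfolding bracket_L[OF P u derivation_V[OF i0]] eq eq'
    by (simp add: field_simps del: card_Diff_insert card_Diff_singleton)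
qed

end

section \<open>The quadratic inequality\<close>

text \<open>The inequality at one point, with \<open>s = \<sigma>\<^sup>2\<close>, \<open>v i = V_i F\<close>, \<open>h i = H_i F\<close>, \<open>h0 = H_0 F\<close>, \<open>q i = V_i H_0 F\<close>,
\<open>\<rho> i = [H_0, H_i] F\<close>, \<open>Am i j = V_j V_i F\<close>, \<open>Pm i j = V_j H_i F\<close>, and \<open>bV\<close>, \<open>bH\<close> the brackets with \<open>L\<close>. The constants are
chosen in the order \<open>d\<close>, \<open>c\<close>, \<open>b\<close>, \<open>a\<close>, \<open>K\<close>: \<open>d\<close> makes the coefficient of \<open>h0\<^sup>2\<close> large enough; \<open>c = 4 * d\<close> and
\<open>b\<^sup>2 = 2 * a * d\<close> leave a multiple of \<open>(Pm i j)\<^sup>2\<close> that absorbs \<open>h0 * Pm j j\<close>; \<open>b * \<kappa> = 68\<close> exceeds the \<open>64\<close> that is spent on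
\<open>h i * q i\<close> and leaves room for the products of \<open>h i\<close> with \<open>v i\<close> and \<open>\<rho> i\<close>; and \<open>K\<close> collects the coefficients of \<open>(v i)\<^sup>2\<close>.\<close>

lemma quadratic_bound:
  fixes v h q \<rho> :: "'i \<Rightarrow> real" and Am Pm :: "'i \<Rightarrow> 'i \<Rightarrow> real" and s \<kappa> B h0 :: real
  assumes fin: "finite J" and m_def: "m = real (card J)" and m: "1 \<le> m" and s: "0 < s" and \<kappa>: "0 < \<kappa>"
    and d_def: "d = 4 / s" and c_def: "c = 16 / s" and b_def: "b = 68 / \<kappa>" and a_def: "a = b\<^sup>2 * s / 8"
    and \<alpha>_def: "\<alpha> = a * \<kappa> + b * m * s / 2"
    and K_def: "K = b\<^sup>2 * s\<^sup>2 / 4 + \<alpha>\<^sup>2 / 4 + 1 + (1156 + (c * \<kappa>)\<^sup>2 / 4) * m\<^sup>2 * B\<^sup>2"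
    and \<rho>: "\<And>i. i \<in> J \<Longrightarrow> \<bar>\<rho> i\<bar> \<le> B * (\<Sum>k\<in>J. \<bar>v k\<bar>)"
    and bV: "\<And>i. i \<in> J \<Longrightarrow> bV i = (m - 1) * s / 2 * v i - \<kappa> * h i"
    and bH: "\<And>i. i \<in> J \<Longrightarrow> bH i = - s * q i + s / 2 * h i + \<kappa> * \<rho> i"
  shows "a * (\<Sum>i\<in>J. s / 2 * (\<Sum>j\<in>J. (Am i j)\<^sup>2) + v i * bV i)
     - b * (\<Sum>i\<in>J. h i * bV i + v i * bH i + s * (\<Sum>j\<in>J. Pm i j * Am i j))
     + c * (\<Sum>i\<in>J. s / 2 * (\<Sum>j\<in>J. (Pm i j)\<^sup>2) + h i * bH i)
     + d * (s / 2 * (\<Sum>j\<in>J. (q j)\<^sup>2) + h0 * (s * (\<Sum>j\<in>J. Pm j j) + s / 2 * (m * h0)))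
     \<ge> - K * (\<Sum>i\<in>J. (v i)\<^sup>2) + ((\<Sum>i\<in>J. (h i)\<^sup>2) + h0\<^sup>2)"
    (is "?lhs \<ge> _")
proof -
  define K1 where "K1 = b\<^sup>2 * s\<^sup>2 / 4 + \<alpha>\<^sup>2 / 4 + 1"
  define K2 where "K2 = 1156 + (c * \<kappa>)\<^sup>2 / 4"
  have ds: "d * s = 4" and cs: "c * s = 16" and b\<kappa>: "b * \<kappa> = 68" using s \<kappa> by (simp_all add: d_def c_def b_def)
  have pos: "0 \<le> a" using s by (simp add: a_def)
  \<comment> \<open>the form \<open>a A^2 - 2 b P A + c P^2\<close> has determinant \<open>a c - b^2 = a (c - 2 d)\<close> and dominates \<open>2 d P^2\<close>\<close>
  have AP: "s / 2 * (a * (Am i j)\<^sup>2 - 2 * b * (Pm i j * Am i j) + c * (Pm i j)\<^sup>2) \<ge> 4 * (Pm i j)\<^sup>2" for i j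
  proof -
    have "s / 2 * (a * (Am i j)\<^sup>2 - 2 * b * (Pm i j * Am i j) + c * (Pm i j)\<^sup>2) - 4 * (Pm i j)\<^sup>2
      = (b * s * Am i j / 4)\<^sup>2 - s * b * (Pm i j * Am i j) + (c * s / 2) * (Pm i j)\<^sup>2 - 4 * (Pm i j)\<^sup>2"
      by (simp add: a_def power2_eq_square algebra_simps)
    also have "\<dots> = (b * s * Am i j / 4 - 2 * Pm i j)\<^sup>2"
      unfolding cs by (simp add: power2_eq_square algebra_simps)
    finally show ?thesis using zero_le_power2[of "b * s * Am i j / 4 - 2 * Pm i j"] by linarith
  qed
  have row: "a * (v i * bV i) - b * (h i * bV i + v i * bH i) + c * (h i * bH i) + 2 * (q i)\<^sup>2
     \<ge> (h i)\<^sup>2 - K1 * (v i)\<^sup>2 - K2 * (\<rho> i)\<^sup>2" if i: "i \<in> J" for i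
  proof -
    have "a * (v i * bV i) - b * (h i * bV i + v i * bH i) + c * (h i * bH i) + 2 * (q i)\<^sup>2
       - ((h i)\<^sup>2 - K1 * (v i)\<^sup>2 - K2 * (\<rho> i)\<^sup>2)
      = a * (m - 1) * s / 2 * (v i)\<^sup>2 + (b * \<kappa> + c * s / 2 - 1) * (h i)\<^sup>2 - \<alpha> * (v i * h i) + b * s * (v i * q i)
       - (b * \<kappa>) * (v i * \<rho> i) - (c * s) * (h i * q i) + c * \<kappa> * (h i * \<rho> i) + 2 * (q i)\<^sup>2 + K1 * (v i)\<^sup>2 + K2 * (\<rho> i)\<^sup>2"
      unfolding bV[OF i] bH[OF i] \<alpha>_def by (simp add: power2_eq_square field_simps)
    also have "\<dots> = a * (m - 1) * s / 2 * (v i)\<^sup>2 + 9 * (h i)\<^sup>2 + (q i + b * s * v i / 2)\<^sup>2 + (q i - 8 * h i)\<^sup>2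
       + (h i - \<alpha> * v i / 2)\<^sup>2 + (v i - 34 * \<rho> i)\<^sup>2 + (h i + c * \<kappa> * \<rho> i / 2)\<^sup>2"
      unfolding b\<kappa> cs K1_def K2_def by (simp add: power2_eq_square field_simps)
    also have "\<dots> \<ge> 0" using pos m s by (intro add_nonneg_nonneg) simp_all
    finally show ?thesis by linarith
  qed
  have \<rho>2: "(\<Sum>i\<in>J. (\<rho> i)\<^sup>2) \<le> m\<^sup>2 * B\<^sup>2 * (\<Sum>i\<in>J. (v i)\<^sup>2)"
  proof -
    have "(\<rho> i)\<^sup>2 \<le> B\<^sup>2 * (m * (\<Sum>k\<in>J. (v k)\<^sup>2))" if "i \<in> J" for i
    proof -
      have "(\<rho> i)\<^sup>2 \<le> (B * (\<Sum>k\<in>J. \<bar>v k\<bar>))\<^sup>2" using \<rho>[OF that] by (metis abs_ge_zero abs_le_square_iff abs_of_nonneg order_trans)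
      also have "\<dots> = B\<^sup>2 * (\<Sum>k\<in>J. \<bar>v k\<bar>)\<^sup>2" by (simp add: power_mult_distrib)
      also have "\<dots> \<le> B\<^sup>2 * (m * (\<Sum>k\<in>J. (v k)\<^sup>2))"
        using sum_squared_le_sum_of_squares[of "\<lambda>k. \<bar>v k\<bar>"] 
        by (intro mult_left_mono) (simp_all add: m_def mult.commute)
      finally show ?thesis .
    qed
    then have "(\<Sum>i\<in>J. (\<rho> i)\<^sup>2) \<le> (\<Sum>i\<in>J. B\<^sup>2 * (m * (\<Sum>k\<in>J. (v k)\<^sup>2)))" by (rule sum_mono)
    then show ?thesis by (simp add: m_def power2_eq_square algebra_simps)
  qed
  have diag: "(\<Sum>i\<in>J. 4 * (Pm i i)\<^sup>2) \<le> (\<Sum>i\<in>J. \<Sum>j\<in>J. 4 * (Pm i j)\<^sup>2)"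
    using fin by (intro sum_mono member_le_sum) auto
  have h0: "(\<Sum>i\<in>J. 4 * (Pm i i)\<^sup>2) + 4 * h0 * (\<Sum>j\<in>J. Pm j j) + 2 * m * h0\<^sup>2 \<ge> h0\<^sup>2"
  proof -
    have "(\<Sum>i\<in>J. 4 * (Pm i i)\<^sup>2) + 4 * h0 * (\<Sum>j\<in>J. Pm j j) + 2 * m * h0\<^sup>2
      = (\<Sum>i\<in>J. 4 * (Pm i i)\<^sup>2 + 4 * h0 * Pm i i + 2 * h0\<^sup>2)"
      by (simp add: sum.distrib sum_distrib_left m_def)
    also have "\<dots> = (\<Sum>i\<in>J. 4 * (Pm i i + h0 / 2)\<^sup>2 + h0\<^sup>2)"
      by (intro sum.cong) (simp_all add: power2_eq_square algebra_simps)
    also have "\<dots> \<ge> (\<Sum>i\<in>J. h0\<^sup>2)" by (intro sum_mono) simp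
    finally have "(\<Sum>i\<in>J. 4 * (Pm i i)\<^sup>2) + 4 * h0 * (\<Sum>j\<in>J. Pm j j) + 2 * m * h0\<^sup>2 \<ge> m * h0\<^sup>2" 
      by (simp add: m_def)
    moreover have "1 * h0\<^sup>2 \<le> m * h0\<^sup>2" using m by (intro mult_right_mono) auto
    ultimately show ?thesis by linarith
  qed
  have "?lhs
    = (\<Sum>i\<in>J. \<Sum>j\<in>J. s / 2 * (a * (Am i j)\<^sup>2 - 2 * b * (Pm i j * Am i j) + c * (Pm i j)\<^sup>2))
     + (\<Sum>i\<in>J. a * (v i * bV i) - b * (h i * bV i + v i * bH i) + c * (h i * bH i))
     + (d * s) / 2 * (\<Sum>j\<in>J. (q j)\<^sup>2) + (d * s) * h0 * (\<Sum>j\<in>J. Pm j j) + (d * s) / 2 * m * h0\<^sup>2"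
    by (simp add: sum.distrib sum_subtractf sum_distrib_left algebra_simps power2_eq_square)
  also have "\<dots> = (\<Sum>i\<in>J. \<Sum>j\<in>J. s / 2 * (a * (Am i j)\<^sup>2 - 2 * b * (Pm i j * Am i j) + c * (Pm i j)\<^sup>2))
     + (\<Sum>i\<in>J. a * (v i * bV i) - b * (h i * bV i + v i * bH i) + c * (h i * bH i) + 2 * (q i)\<^sup>2)
     + 4 * h0 * (\<Sum>j\<in>J. Pm j j) + 2 * m * h0\<^sup>2"
    unfolding ds by (simp add: sum.distrib sum_distrib_left)
  also have "\<dots> \<ge> (\<Sum>i\<in>J. \<Sum>j\<in>J. 4 * (Pm i j)\<^sup>2) + (\<Sum>i\<in>J. (h i)\<^sup>2 - K1 * (v i)\<^sup>2 - K2 * (\<rho> i)\<^sup>2)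
     + 4 * h0 * (\<Sum>j\<in>J. Pm j j) + 2 * m * h0\<^sup>2"
    by (intro add_right_mono add_mono sum_mono AP row)
  also have "(\<Sum>i\<in>J. (h i)\<^sup>2 - K1 * (v i)\<^sup>2 - K2 * (\<rho> i)\<^sup>2) 
    = (\<Sum>i\<in>J. (h i)\<^sup>2) - K1 * (\<Sum>i\<in>J. (v i)\<^sup>2) - K2 * (\<Sum>i\<in>J. (\<rho> i)\<^sup>2)"
    by (simp add: sum_subtractf sum_distrib_left)
  finally have main: "?lhs
     \<ge> (\<Sum>i\<in>J. \<Sum>j\<in>J. 4 * (Pm i j)\<^sup>2) + ((\<Sum>i\<in>J. (h i)\<^sup>2) - K1 * (\<Sum>i\<in>J. (v i)\<^sup>2) - K2 * (\<Sum>i\<in>J. (\<rho> i)\<^sup>2))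
     + 4 * h0 * (\<Sum>j\<in>J. Pm j j) + 2 * m * h0\<^sup>2" .
  have "K2 * (\<Sum>i\<in>J. (\<rho> i)\<^sup>2) \<le> K2 * (m\<^sup>2 * B\<^sup>2 * (\<Sum>i\<in>J. (v i)\<^sup>2))"
    by (intro mult_left_mono \<rho>2) (simp add: K2_def)
  moreover have "K * (\<Sum>i\<in>J. (v i)\<^sup>2) = K1 * (\<Sum>i\<in>J. (v i)\<^sup>2) + K2 * (m\<^sup>2 * B\<^sup>2 * (\<Sum>i\<in>J. (v i)\<^sup>2))"
    unfolding K_def K1_def K2_def by (simp add: algebra_simps)
  ultimately show ?thesis using main diag h0 by linarith
qed

context frame_fields
begin

lemma Gamma2_bound:
  fixes a b c d K B \<alpha> m :: real
  assumes P: "P \<in> W" and u: "S u" and dim: "2 \<le> CARD('n)" and \<sigma>: "0 < \<sigma>" and \<kappa>: "0 < \<kappa>"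
    and m_def: "m = real (card nonzero)"
    and d_def: "d = 4 / \<sigma>\<^sup>2" and c_def: "c = 16 / \<sigma>\<^sup>2" and b_def: "b = 68 / \<kappa>" and a_def: "a = b\<^sup>2 * \<sigma>\<^sup>2 / 8"
    and \<alpha>_def: "\<alpha> = a * \<kappa> + b * m * \<sigma>\<^sup>2 / 2"
    and K_def: "K = b\<^sup>2 * (\<sigma>\<^sup>2)\<^sup>2 / 4 + \<alpha>\<^sup>2 / 4 + 1 + (1156 + (c * \<kappa>)\<^sup>2 / 4) * m\<^sup>2 * B\<^sup>2"
    and VV: "\<And>i j P. P \<in> W \<Longrightarrow> i \<in> nonzero \<Longrightarrow> j \<in> nonzero \<Longrightarrow> Vf j (Vf i u) P = Vf i (Vf j u) P"
    and VVV: "\<And>i j P. P \<in> W \<Longrightarrow> i \<in> nonzero \<Longrightarrow> j \<in> nonzero \<Longrightarrow> i \<noteq> j \<Longrightarrow> 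
      Vf j (Vf i (Vf j u)) P - Vf i (Vf j (Vf j u)) P = Vf i u P"
    and curv: "\<And>i. i \<in> nonzero \<Longrightarrow> \<bar>Hf 0 (Hf i u) P - Hf i (Hf 0 u) P\<bar> \<le> B * (\<Sum>k\<in>nonzero. \<bar>Vf k u P\<bar>)"
  shows "a * Gamma2_sum Vf Vf nonzero u P - 2 * b * Gamma2_sum Hf Vf nonzero u P
     + c * Gamma2_sum Hf Hf nonzero u P + d * Gamma2_sum Hf Hf {0} u P
     \<ge> - K * (\<Sum>i\<in>nonzero. (Vf i u P)\<^sup>2) + (\<Sum>i\<in>UNIV. (Hf i u P)\<^sup>2)"
proof -
  define s where "s = \<sigma>\<^sup>2"
  define v where "v i = Vf i u P" for i
  define h where "h i = Hf i u P" for i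
  define q where "q i = Vf i (Hf 0 u) P" for i
  define \<rho> where "\<rho> i = Hf 0 (Hf i u) P - Hf i (Hf 0 u) P" for i
  define Am where "Am i j = Vf j (Vf i u) P" for i j
  define Pm where "Pm i j = Vf j (Hf i u) P" for i j
  define bV where "bV i = L (Vf i u) P - Vf i (L u) P" for i
  define bH where "bH i = L (Hf i u) P - Hf i (L u) P" for i
  have s: "0 < s" using \<sigma> by (simp add: s_def)
  have m: "1 \<le> m" using dim by (simp add: m_def)
  have bV: "bV i = (m - 1) * s / 2 * v i - \<kappa> * h i" if "i \<in> nonzero" for i
    using L_V[OF P u that VV VVV] unfolding bV_def v_def h_def m_def s_def .
  have bH: "bH i = - s * q i + s / 2 * h i + \<kappa> * \<rho> i" if "i \<in> nonzero" for i
    using L_Hi[OF P u that] unfolding bH_def q_def h_def \<rho>_def s_def .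
  have bH0: "bH 0 = s * (\<Sum>j\<in>nonzero. Pm j j) + s / 2 * (m * h 0)"
    using L_H0[OF P u] unfolding bH_def Pm_def h_def m_def s_def .
  have DV: "i \<in> nonzero \<Longrightarrow> is_deriv (Vf i)" for i by (rule derivation_V) simp
  have 1: "Gamma2_sum Vf Vf nonzero u P = (\<Sum>i\<in>nonzero. s / 2 * (\<Sum>j\<in>nonzero. (Am i j)\<^sup>2) + v i * bV i)"
    unfolding bV_def v_def Am_def s_def
    by (subst Gamma2_sum_eq[OF P u DV DV]) (simp_all add: sum_distrib_left power2_eq_square algebra_simps sum.distrib)
  have 2: "Gamma2_sum Hf Vf nonzero u P = 1 / 2 * (\<Sum>i\<in>nonzero. h i * bV i + v i * bH i + s * (\<Sum>j\<in>nonzero. Pm i j * Am i j))"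
    unfolding bV_def bH_def v_def h_def Am_def Pm_def s_def
    by (rule Gamma2_sum_eq[OF P u derivation_H DV])
  have 3: "Gamma2_sum Hf Hf nonzero u P = (\<Sum>i\<in>nonzero. s / 2 * (\<Sum>j\<in>nonzero. (Pm i j)\<^sup>2) + h i * bH i)"
    unfolding bH_def h_def Pm_def s_def
    by (subst Gamma2_sum_eq[OF P u derivation_H derivation_H]) 
      (simp_all add: sum_distrib_left power2_eq_square algebra_simps sum.distrib)
  have 4: "Gamma2_sum Hf Hf {0} u P = s / 2 * (\<Sum>j\<in>nonzero. (q j)\<^sup>2) + h 0 * bH 0"
    unfolding bH_def h_def q_def s_def
    by (subst Gamma2_sum_eq[OF P u derivation_H derivation_H]) (simp_all add: power2_eq_square algebra_simps)
  have \<rho>: "\<bar>\<rho> i\<bar> \<le> B * (\<Sum>k\<in>nonzero. \<bar>v k\<bar>)" if "i \<in> nonzero" for i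
    using curv[OF that] by (simp add: \<rho>_def v_def)
  have split: "(\<Sum>i\<in>UNIV. (Hf i u P)\<^sup>2) = (\<Sum>i\<in>nonzero. (h i)\<^sup>2) + (h 0)\<^sup>2"
    by (subst sum.remove[of UNIV 0]) (simp_all add: h_def)
  have "- K * (\<Sum>i\<in>nonzero. (v i)\<^sup>2) + ((\<Sum>i\<in>nonzero. (h i)\<^sup>2) + (h 0)\<^sup>2) \<le>
     a * (\<Sum>i\<in>nonzero. s / 2 * (\<Sum>j\<in>nonzero. (Am i j)\<^sup>2) + v i * bV i)
     - b * (\<Sum>i\<in>nonzero. h i * bV i + v i * bH i + s * (\<Sum>j\<in>nonzero. Pm i j * Am i j))
     + c * (\<Sum>i\<in>nonzero. s / 2 * (\<Sum>j\<in>nonzero. (Pm i j)\<^sup>2) + h i * bH i)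
     + d * (s / 2 * (\<Sum>j\<in>nonzero. (q j)\<^sup>2) + h 0 * (s * (\<Sum>j\<in>nonzero. Pm j j) + s / 2 * (m * h 0)))"
    by (rule quadratic_bound[OF finite m_def m s \<kappa> d_def[folded s_def] c_def[folded s_def] b_def 
          a_def[folded s_def] \<alpha>_def[folded s_def] K_def[folded s_def] \<rho> bV bH])
  then show ?thesis
    unfolding 1 2 3 4 bH0 split by (simp add: v_def)
qed

end

section \<open>Functions that descend and rotations of frames\<close>

lemma derivation_on_lie:
  fixes X :: "'v::euclidean_space \<Rightarrow> 'v"
  assumes "open W" "smooth_on W X"
  shows "derivation_on W (smooth_on W) (lie X)"
  unfolding derivation_on_def
proof (intro conjI allI impI ballI)
  show "lie X u P = lie X w P" if "smooth_on W u" "\<forall>P\<in>W. u P = w P" "P \<in> W" for u w :: "'v \<Rightarrow> real" and P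
    using lie_cong[OF assms(1) that(1) _ that(3)] that(2) by simp
qed (rule smooth_on_lie[OF assms] lie_add lie_mult lie_cmult; assumption)+

lemma frechet_derivative_within_cong:
  assumes "x \<in> S" "\<And>y. y \<in> S \<Longrightarrow> f y = h y"
  shows "frechet_derivative f (at x within S) = frechet_derivative h (at x within S)"
proof -
  have "(f has_derivative f') (at x within S) \<longleftrightarrow> (h has_derivative f') (at x within S)" for f'
    using has_derivative_transform[OF assms(1), of h f f'] has_derivative_transform[OF assms(1), of f h f'] assms(2)
    by auto
  then show ?thesis unfolding frechet_derivative_def by simp
qed

context riemannian
begin

abbreviation "nonzero \<equiv> UNIV - {0 :: 'n}"

text \<open>The relations hold on all of \<open>W\<close>, since they are brackets of fields on an open set of coordinates.\<close>

lemma frame_fields_lie: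
  assumes c: "c \<in> A" and W: "open W" "W \<subseteq> U c \<times> UNIV"
  shows "frame_fields W (smooth_on W) lieV (lieH c)"
proof
  show "derivation_on W (smooth_on W) (lieV i)" for i
    by (intro derivation_on_lie smooth_on_linear bounded_linear_V_coords W)
  show "derivation_on W (smooth_on W) (lieH c i)" for i
    by (intro derivation_on_lie smooth_on_antimono[OF smooth_H_coords[OF c]] W)
qed (rule smooth_on_add[OF W(1)] smooth_on_mult[OF W(1)] smooth_on_const[OF W(1)] lie_V_H[OF c W]; assumption)+

lemma frame_deriv_cong:
  assumes p: "p \<in> FB" and "\<And>p. p \<in> FB \<Longrightarrow> F p = F' p"
  shows "frame_deriv A g F p = frame_deriv A g F' p"
proof -
  let ?c = "chart_at A (fst p)"
  have c: "?c \<in> A" "fst p \<in> cdom ?c" using chart_at[OF p] by auto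
  have "frechet_derivative (F \<circ> frame_param A ?c) (at (frame_coords ?c p) within frame_set ?c)
      = frechet_derivative (F' \<circ> frame_param A ?c) (at (frame_coords ?c p) within frame_set ?c)"
    using frame_coords_in[OF c(1) p c(2)] assms(2) frame_param_in[OF c(1)]
    by (intro frechet_derivative_within_cong) auto
  then show ?thesis by (simp add: frame_deriv_def[abs_def] Let_def frame_coords_image[OF c(1)])
qed

lemma V_cong: "p \<in> FB \<Longrightarrow> (\<And>p. p \<in> FB \<Longrightarrow> F p = F' p) \<Longrightarrow> V A g i F p = V A g i F' p"
  by (simp add: V_def frame_deriv_cong[of p F F'])

lemma H_cong: "p \<in> FB \<Longrightarrow> (\<And>p. p \<in> FB \<Longrightarrow> F p = F' p) \<Longrightarrow> H A g i F p = H A g i F' p"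
  by (simp add: H_def Let_def frame_deriv_cong[of p F F'])

lemma rep_cong: "rep c W F \<Phi> \<Longrightarrow> (\<And>p. p \<in> FB \<Longrightarrow> F p = F' p) \<Longrightarrow> rep c W F' \<Phi>"
  by (simp add: rep_def)

lemma rep_value: "rep c W F \<Phi> \<Longrightarrow> p \<in> FB \<Longrightarrow> fst p \<in> cdom c \<Longrightarrow> frame_coords c p \<in> W \<Longrightarrow> 
    F p = \<Phi> (frame_coords c p)"
  by (simp add: rep_def)

lemma rep_add: "rep c W F \<Phi> \<Longrightarrow> rep c W K \<Psi> \<Longrightarrow> rep c W (\<lambda>p. F p + K p) (\<lambda>P. \<Phi> P + \<Psi> P)"
  by (auto simp: rep_def intro: smooth_on_add)

lemma rep_mult: "rep c W F \<Phi> \<Longrightarrow> rep c W K \<Psi> \<Longrightarrow> rep c W (\<lambda>p. F p * K p) (\<lambda>P. \<Phi> P * \<Psi> P)"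
  by (auto simp: rep_def intro: smooth_on_mult)

lemma rep_cmult: "rep c W F \<Phi> \<Longrightarrow> rep c W (\<lambda>p. k * F p) (\<lambda>P. k * \<Phi> P)"
  by (auto simp: rep_def intro: smooth_on_mult smooth_on_const)

lemma rep_sum: 
  assumes "rep c W F0 \<Phi>0" "\<And>i. i \<in> J \<Longrightarrow> rep c W (F i) (\<Phi> i)"
  shows "rep c W (\<lambda>p. \<Sum>i\<in>J. F i p) (\<lambda>P. \<Sum>i\<in>J. \<Phi> i P)"
proof -
  have "open W" "W \<subseteq> U c \<times> UNIV" using assms by (auto simp: rep_def)
  then show ?thesis using assms(2)
    unfolding rep_def by (auto intro!: smooth_on_sum sum.cong)
qed

definition frame_smooth :: "('a, 'n) frame_fun \<Rightarrow> bool" where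
  "frame_smooth F \<longleftrightarrow> (\<forall>p\<in>FB. \<exists>W \<Phi>. frame_coords (chart_at A (fst p)) p \<in> W \<and> rep (chart_at A (fst p)) W F \<Phi>)"

definition basic :: "('a, 'n) frame_fun \<Rightarrow> bool" where
  "basic F \<longleftrightarrow> (\<forall>p\<in>FB. \<forall>p'\<in>FB. frame_proj p = frame_proj p' \<longrightarrow> F p = F p')"

lemma descend_basic:
  assumes "basic F" "p \<in> FB" shows "descend A g F (frame_proj p) = F p"
  unfolding descend_def
proof (rule the_equality)
  show "\<forall>p'\<in>FB. frame_proj p' = frame_proj p \<longrightarrow> F p = F p'"
    using assms unfolding basic_def by metis
qed (use assms(2) in blast)

text \<open>The orthogonal matrices that fix \<open>e^0\<close>. Both components of this group are needed, as the fibres of \<open>frame_proj\<close>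
contain frames of either orientation.\<close>

definition rotation :: "('n coords, 'n) vec \<Rightarrow> bool" where
  "rotation R \<longleftrightarrow> R ** transpose R = mat 1 \<and> (\<forall>j. R $ 0 $ j = (if j = 0 then 1 else 0)) \<and>
     (\<forall>j. R $ j $ 0 = (if j = 0 then 1 else 0))"

definition rotate_frame :: "('n coords, 'n) vec \<Rightarrow> 'a \<times> ('n \<Rightarrow> ('a, 'n) tvec) \<Rightarrow> 'a \<times> ('n \<Rightarrow> ('a, 'n) tvec)" where
  "rotate_frame R p = (fst p, \<lambda>i d. \<Sum>j\<in>UNIV. R $ i $ j *\<^sub>R snd p j d)"

definition rotate_coords :: "('n coords, 'n) vec \<Rightarrow> 'n fcoords \<Rightarrow> 'n fcoords" where
  "rotate_coords R P = (fst P, \<chi> i. \<Sum>j\<in>UNIV. R $ i $ j *\<^sub>R snd P $ j)"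

lemma fst_rotate_frame [simp]: "fst (rotate_frame R p) = fst p"
  by (simp add: rotate_frame_def)

lemma frame_coords_rotate: "frame_coords c (rotate_frame R p) = rotate_coords R (frame_coords c p)"
  by (simp add: frame_coords_def rotate_frame_def rotate_coords_def)

lemma bounded_linear_rotate_coords: "bounded_linear (rotate_coords R)"
  unfolding linear_linear
  by (rule linearI) (auto simp: rotate_coords_def vec_eq_iff algebra_simps sum.distrib sum_distrib_left)

lemma rotation_orth:
  assumes "rotation R"
  shows "(\<Sum>j\<in>UNIV. R $ i $ j * R $ k $ j) = (if i = k then 1 else 0)"
    and "(\<Sum>j\<in>UNIV. R $ j $ i * R $ j $ k) = (if i = k then 1 else 0)"
proof -
  have 1: "R ** transpose R = mat 1" using assms by (simp add: rotation_def)
  then have 2: "transpose R ** R = mat 1" by (simp add: matrix_left_right_inverse)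
  show "(\<Sum>j\<in>UNIV. R $ i $ j * R $ k $ j) = (if i = k then 1 else 0)"
    using arg_cong[OF 1, of "\<lambda>M. M $ i $ k"] by (simp add: matrix_matrix_mult_def transpose_def mat_def)
  show "(\<Sum>j\<in>UNIV. R $ j $ i * R $ j $ k) = (if i = k then 1 else 0)"
    using arg_cong[OF 2, of "\<lambda>M. M $ i $ k"] by (simp add: matrix_matrix_mult_def transpose_def mat_def)
qed

lemma tangent_space_sum:
  assumes "\<And>j. j \<in> J \<Longrightarrow> v j \<in> tangent_space A x"
  shows "(\<lambda>d. \<Sum>j\<in>J. k j *\<^sub>R v j d) \<in> tangent_space A x"
proof -
  have "(\<Sum>j\<in>J. k j *\<^sub>R v j d) = dtr c d (cmap c x) (\<Sum>j\<in>J. k j *\<^sub>R v j c)"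
    if "c \<in> A" "d \<in> A" "x \<in> cdom c" "x \<in> cdom d" for c d
  proof -
    note l = linear_dtr[OF that]
    have "dtr c d (cmap c x) (\<Sum>j\<in>J. k j *\<^sub>R v j c) = (\<Sum>j\<in>J. k j *\<^sub>R dtr c d (cmap c x) (v j c))"
      by (simp add: linear_sum[OF l] linear_cmul[OF l])
    also have "\<dots> = (\<Sum>j\<in>J. k j *\<^sub>R v j d)"
      using that assms by (intro sum.cong refl) (simp add: tangent_space_trans[of _ x c d])
    finally show ?thesis by simp
  qed
  moreover have "(\<Sum>j\<in>J. k j *\<^sub>R v j c) = 0" if "\<not> (c \<in> A \<and> x \<in> cdom c)" for c
  proof (rule sum.neutral, rule ballI)
    fix j assume "j \<in> J"
    then have "v j c = 0" using assms[of j] that unfolding tangent_space_def by blast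
    then show "k j *\<^sub>R v j c = 0" by simp
  qed
  ultimately show ?thesis unfolding tangent_space_def by blast
qed

lemma rotate_in_FB:
  assumes R: "rotation R" and p: "p \<in> FB" shows "rotate_frame R p \<in> FB"
proof -
  let ?c = "chart_at A (fst p)"
  have c: "?c \<in> A" "fst p \<in> cdom ?c" using chart_at[OF p] by auto
  have t: "snd p j \<in> tangent_space A (fst p)" for j using p by (simp add: FB_iff)
  have t': "snd (rotate_frame R p) j \<in> tangent_space A (fst p)" for j
    unfolding rotate_frame_def using tangent_space_sum[OF t] by simp
  have E: "snd p j ?c \<bullet> (G ?c (cmap ?c (fst p)) *v snd p k ?c) = (if j = k then 1 else 0)" for j k
    using p metric_tangent[OF c t t] by (simp add: FB_iff)
  have "g (fst p) (snd (rotate_frame R p) i) (snd (rotate_frame R p) k) = (if i = k then 1 else 0)" for i k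
  proof -
    have "g (fst p) (snd (rotate_frame R p) i) (snd (rotate_frame R p) k) 
      = (\<Sum>j\<in>UNIV. \<Sum>l\<in>UNIV. R $ i $ j * (R $ k $ l * (if j = l then 1 else 0)))"
      unfolding metric_tangent[OF c t' t'] E[symmetric] 
      by (simp add: rotate_frame_def inner_sum_left inner_sum_right linear_sum[OF matrix_vector_mul_linear] 
          matrix_vector_mult_scaleR sum_distrib_left)
        (subst sum.swap, simp add: mult.left_commute)
    also have "\<dots> = (\<Sum>j\<in>UNIV. R $ i $ j * R $ k $ j)" by (simp add: mult_delta_right sum.delta)
    finally show ?thesis using rotation_orth(1)[OF R] by simp
  qed
  then show ?thesis using p t' by (simp add: FB_iff)
qed

lemma frame_proj_rotate: "rotation R \<Longrightarrow> frame_proj (rotate_frame R p) = frame_proj p"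
  by (simp add: frame_proj_def rotate_frame_def rotation_def if_distrib[where f = "\<lambda>k. k *\<^sub>R _"] cong: if_cong)

text \<open>The entries of \<open>R\<close> are the inner products of the vectors of the two frames.\<close>

lemma rotation_exists:
  assumes p: "p \<in> FB" and p': "p' \<in> FB" and proj: "frame_proj p = frame_proj p'"
  obtains R where "rotation R" "p' = rotate_frame R p"
proof -
  let ?c = "chart_at A (fst p)"
  have c: "?c \<in> A" "fst p \<in> cdom ?c" using chart_at[OF p] by auto
  have x: "fst p' = fst p" and e0: "snd p' 0 = snd p 0" using proj by (simp_all add: frame_proj_def)
  have t: "snd p j \<in> tangent_space A (fst p)" "snd p' j \<in> tangent_space A (fst p)" for j 
    using p p' x by (simp_all add: FB_iff)
  define G0 where "G0 = G ?c (cmap ?c (fst p))"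
  define R where "R = (\<chi> i j. snd p j ?c \<bullet> (G0 *v snd p' i ?c))"
  have E: "snd p j ?c \<bullet> (G0 *v snd p k ?c) = (if j = k then 1 else 0)" for j k
    using p metric_tangent[OF c t(1) t(1)] by (simp add: FB_iff G0_def)
  have E': "snd p' j ?c \<bullet> (G0 *v snd p' k ?c) = (if j = k then 1 else 0)" for j k
    using p' metric_tangent[OF c t(2) t(2)] x by (simp add: FB_iff G0_def)
  have ex: "snd p' i ?c = (\<Sum>j\<in>UNIV. R $ i $ j *\<^sub>R snd p j ?c)" for i
    using frame_expand[OF frame_coords_in[OF c(1) p c(2)], of "snd p' i ?c"] 
    by (simp add: frame_coords_def R_def G0_def)
  have "(\<Sum>j\<in>UNIV. R $ i $ j * R $ k $ j) = (if i = k then 1 else 0)" for i k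
  proof -
    have "(if i = k then 1 else 0) = snd p' i ?c \<bullet> (G0 *v snd p' k ?c)" by (simp add: E')
    also have "\<dots> = (\<Sum>j\<in>UNIV. R $ i $ j * (snd p j ?c \<bullet> (G0 *v snd p' k ?c)))"
      by (subst ex[of i]) (simp add: inner_sum_left)
    finally show ?thesis by (simp add: R_def)
  qed
  then have "R ** transpose R = mat 1"
    by (simp add: matrix_matrix_mult_def transpose_def mat_def vec_eq_iff)
  moreover have "R $ 0 $ j = (if j = 0 then 1 else 0)" "R $ j $ 0 = (if j = 0 then 1 else 0)" for j
    using E[of j 0] E'[of 0 j] by (auto simp: R_def e0)
  ultimately have "rotation R" by (simp add: rotation_def)
  moreover have "snd p' i = (\<lambda>d. \<Sum>j\<in>UNIV. R $ i $ j *\<^sub>R snd p j d)" for i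
  proof -
    have "tvec_of A ?c (fst p) (snd p' i ?c) = snd p' i" by (rule tvec_of_tangent[OF t(2) c])
    moreover have "tvec_of A ?c (fst p) (\<Sum>j\<in>UNIV. R $ i $ j *\<^sub>R snd p j ?c) = (\<lambda>d. \<Sum>j\<in>UNIV. R $ i $ j *\<^sub>R snd p j d)"
      using tvec_of_tangent[OF tangent_space_sum[where v = "snd p" and k = "\<lambda>j. R $ i $ j" and J = UNIV, OF t(1)] c] .
    ultimately show ?thesis using ex[of i] by simp
  qed
  then have "p' = rotate_frame R p" by (auto simp: rotate_frame_def prod_eq_iff x fun_eq_iff)
  ultimately show thesis by (rule that)
qed

text \<open>\<open>V_i\<close> moves \<open>e^0\<close> towards the \<open>i\<close>-th vector, which is \<open>\<Sum>j. R_{ij} e^j\<close> in the rotated frame.\<close>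

lemma V_coords_rotate:
  fixes P :: "'n fcoords"
  assumes R: "rotation R" and i: "i \<noteq> 0"
  shows "V_coords i (rotate_coords R P) = rotate_coords R (\<Sum>j\<in>nonzero. R $ i $ j *\<^sub>R V_coords j P)"
proof -
  define Y where "Y = (\<Sum>j\<in>nonzero. R $ i $ j *\<^sub>R V_coords j P)"
  have R0: "R $ 0 $ j = (if j = 0 then 1 else 0)" "R $ j $ 0 = (if j = 0 then 1 else 0)" for j
    using R by (auto simp: rotation_def)
  have Y0: "snd Y $ 0 = (\<Sum>j\<in>UNIV. R $ i $ j *\<^sub>R snd P $ j)"
    unfolding Y_def using i by (subst sum.remove[of UNIV 0]) (simp_all add: snd_sum V_coords_eq R0)
  have Yl: "snd Y $ l = - R $ i $ l *\<^sub>R snd P $ 0" if "l \<noteq> 0" for l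
  proof -
    have "snd Y $ l = (\<Sum>j\<in>nonzero. if j = l then - R $ i $ j *\<^sub>R snd P $ 0 else 0)"
      unfolding Y_def snd_sum sum_component using that by (intro sum.cong) (auto simp: V_coords_eq)
    then show ?thesis using that by (simp add: sum.delta)
  qed
  have "(\<Sum>j\<in>UNIV. R $ k $ j *\<^sub>R snd Y $ j) = (if k = 0 then (\<Sum>j\<in>UNIV. R $ i $ j *\<^sub>R snd P $ j) 
     else if k = i then - (snd P $ 0) else 0)" for k
  proof (cases "k = 0")
    case True
    then show ?thesis by (simp add: R0 Y0 if_distrib[where f = "\<lambda>k. k *\<^sub>R _"] cong: if_cong)
  next
    case False
    have "(\<Sum>j\<in>UNIV. R $ k $ j *\<^sub>R snd Y $ j) = (\<Sum>j\<in>nonzero. R $ k $ j *\<^sub>R snd Y $ j)"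
      using False by (subst sum.remove[of UNIV 0]) (simp_all add: R0)
    also have "\<dots> = (\<Sum>j\<in>nonzero. - (R $ k $ j * R $ i $ j) *\<^sub>R snd P $ 0)"
      by (intro sum.cong refl) (simp add: Yl)
    also have "\<dots> = - (\<Sum>j\<in>nonzero. R $ k $ j * R $ i $ j) *\<^sub>R snd P $ 0"
      by (simp add: scaleR_left.sum sum_negf)
    also have "(\<Sum>j\<in>nonzero. R $ k $ j * R $ i $ j) = (\<Sum>j\<in>UNIV. R $ k $ j * R $ i $ j)"
      using False sum.remove[of UNIV 0 "\<lambda>j. R $ k $ j * R $ i $ j"] by (simp add: R0)
    finally show ?thesis using False by (simp add: rotation_orth(1)[OF R])
  qed
  moreover have "fst Y = 0" by (simp add: Y_def fst_sum V_coords_eq)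
  moreover have "snd (rotate_coords R P) $ i = (\<Sum>j\<in>UNIV. R $ i $ j *\<^sub>R snd P $ j)" 
    "snd (rotate_coords R P) $ 0 = snd P $ 0"
    by (simp_all add: rotate_coords_def R0 if_distrib[where f = "\<lambda>k. k *\<^sub>R _"] cong: if_cong)
  ultimately show ?thesis
    unfolding Y_def[symmetric] V_coords_eq[of i] rotate_coords_def[of R Y] by (simp cong: if_cong)
qed

lemma H_coords_rotate:
  "H_coords A g c i (rotate_coords R P) = rotate_coords R (\<Sum>j\<in>UNIV. R $ i $ j *\<^sub>R H_coords A g c j P)"
proof -
  note l1 = linear_sum[OF linear_Gam(1)] linear_cmul[OF linear_Gam(1)]
  note l2 = linear_sum[OF linear_Gam(2)] linear_cmul[OF linear_Gam(2)]
  have "Gam c y (\<Sum>l\<in>UNIV. R $ k $ l *\<^sub>R E $ l) (\<Sum>j\<in>UNIV. R $ i $ j *\<^sub>R E $ j) = 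
    (\<Sum>l\<in>UNIV. R $ k $ l *\<^sub>R (\<Sum>j\<in>UNIV. R $ i $ j *\<^sub>R Gam c y (E $ l) (E $ j)))" for k y and E :: "('n coords, 'n) vec"
    by (simp add: l2) (simp add: l1)
  then show ?thesis
    by (simp add: rotate_coords_def H_coords_eq prod_eq_iff fst_sum snd_sum vec_eq_iff sum_component sum_negf)
qed

lemma rep_rotate:
  assumes R: "rotation R" and rep: "rep c W F \<Phi>"
  shows "rep c (rotate_coords R -` W) (\<lambda>p. F (rotate_frame R p)) (\<lambda>P. \<Phi> (rotate_coords R P))"
proof -
  have W: "open W" "W \<subseteq> U c \<times> UNIV" and s: "smooth_on W \<Phi>"
    and F: "\<And>p. p \<in> FB \<Longrightarrow> fst p \<in> cdom c \<Longrightarrow> frame_coords c p \<in> W \<Longrightarrow> F p = \<Phi> (frame_coords c p)"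
    using rep by (auto simp: rep_def)
  note bl = bounded_linear_rotate_coords[of R]
  have o: "open (rotate_coords R -` W)"
    using continuous_open_vimage[OF W(1)] linear_continuous_at[OF bl] by blast
  have "rotate_coords R -` W \<subseteq> U c \<times> UNIV"
  proof
    fix P assume "P \<in> rotate_coords R -` W"
    then have "fst (rotate_coords R P) \<in> U c" using W(2) by auto
    then show "P \<in> U c \<times> UNIV" by (cases P) (simp add: rotate_coords_def)
  qed
  moreover have "smooth_on (rotate_coords R -` W) (\<lambda>P. \<Phi> (rotate_coords R P))"
    by (rule smooth_on_compose[OF o s smooth_on_linear[OF o bl]]) auto
  ultimately show ?thesis
    unfolding rep_def using o F rotate_in_FB[OF R] by (simp add: frame_coords_rotate)
qed

text \<open>A family of operators, given by fields \<open>Xf\<close>, that rotations of the frame transform linearly and orthogonally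
among themselves. The instances are \<open>V_i\<close> and \<open>H_i\<close> for \<open>i \<noteq> 0\<close>, and \<open>H_0\<close> alone.\<close>

definition frame_op :: "('n \<Rightarrow> ('a, 'n) frame_fun \<Rightarrow> ('a, 'n) frame_fun) \<Rightarrow>
   (('a, 'n) chart \<Rightarrow> 'n \<Rightarrow> 'n fcoords \<Rightarrow> 'n fcoords) \<Rightarrow> 'n set \<Rightarrow> bool" where
  "frame_op X Xf J \<longleftrightarrow> 
     (\<forall>c\<in>A. \<forall>W F \<Phi>. rep c W F \<Phi> \<longrightarrow> (\<forall>i\<in>J. rep c W (X i F) (lie (Xf c i) \<Phi>))) \<and>
     (\<forall>c\<in>A. \<forall>R P. rotation R \<longrightarrow> (\<forall>i\<in>J. Xf c i (rotate_coords R P) = rotate_coords R (\<Sum>j\<in>J. R $ i $ j *\<^sub>R Xf c j P))) \<and>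
     (\<forall>F F' p. p \<in> FB \<longrightarrow> (\<forall>p\<in>FB. F p = F' p) \<longrightarrow> (\<forall>i\<in>J. X i F p = X i F' p)) \<and>
     (J = nonzero \<or> J = {0})"

lemma frame_opD:
  assumes "frame_op X Xf J"
  shows frame_op_rep: "c \<in> A \<Longrightarrow> rep c W F \<Phi> \<Longrightarrow> i \<in> J \<Longrightarrow> rep c W (X i F) (lie (Xf c i) \<Phi>)"
    and frame_op_rotate: "c \<in> A \<Longrightarrow> rotation R \<Longrightarrow> i \<in> J \<Longrightarrow> 
      Xf c i (rotate_coords R P) = rotate_coords R (\<Sum>j\<in>J. R $ i $ j *\<^sub>R Xf c j P)"
    and frame_op_cong: "p \<in> FB \<Longrightarrow> i \<in> J \<Longrightarrow> (\<And>p. p \<in> FB \<Longrightarrow> F p = F' p) \<Longrightarrow> X i F p = X i F' p"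
    and frame_op_index: "J = nonzero \<or> J = {0}"
  using assms unfolding frame_op_def by blast+

lemma frame_opI:
  assumes "\<And>c W F \<Phi> i. c \<in> A \<Longrightarrow> rep c W F \<Phi> \<Longrightarrow> i \<in> J \<Longrightarrow> rep c W (X i F) (lie (Xf c i) \<Phi>)"
    and "\<And>c R P i. c \<in> A \<Longrightarrow> rotation R \<Longrightarrow> i \<in> J \<Longrightarrow> 
      Xf c i (rotate_coords R P) = rotate_coords R (\<Sum>j\<in>J. R $ i $ j *\<^sub>R Xf c j P)"
    and "\<And>F F' p i. p \<in> FB \<Longrightarrow> (\<And>p. p \<in> FB \<Longrightarrow> F p = F' p) \<Longrightarrow> i \<in> J \<Longrightarrow> X i F p = X i F' p"
    and "J = nonzero \<or> J = {0}"
  shows "frame_op X Xf J"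
  unfolding frame_op_def using assms by blast

lemma frame_op_V: "frame_op (V A g) (\<lambda>c. V_coords) nonzero"
proof (rule frame_opI)
  show "rep c W (V A g i F) (lieV i \<Phi>)" if "c \<in> A" "rep c W F \<Phi>" "i \<in> nonzero" for c W F \<Phi> i
    using rep_V[OF _ that(1,2)] that(3) by blast
  show "V_coords i (rotate_coords R P) = rotate_coords R (\<Sum>j\<in>nonzero. R $ i $ j *\<^sub>R V_coords j P)"
    if "rotation R" "i \<in> nonzero" for R i P
    using V_coords_rotate[OF that(1)] that(2) by blast
qed (erule V_cong, blast+)

lemma frame_op_H: "frame_op (H A g) (H_coords A g) nonzero" "frame_op (H A g) (H_coords A g) {0}"
proof -
  show "frame_op (H A g) (H_coords A g) nonzero"
  proof (rule frame_opI)
    show "H_coords A g c i (rotate_coords R P) = rotate_coords R (\<Sum>j\<in>nonzero. R $ i $ j *\<^sub>R H_coords A g c j P)"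
      if "rotation R" "i \<in> nonzero" for c R i P
      unfolding H_coords_rotate using that by (subst sum.remove[of UNIV 0]) (simp_all add: rotation_def)
  qed (erule (1) rep_H, erule H_cong, blast+)
  show "frame_op (H A g) (H_coords A g) {0}"
  proof (rule frame_opI)
    show "H_coords A g c i (rotate_coords R P) = rotate_coords R (\<Sum>j\<in>{0}. R $ i $ j *\<^sub>R H_coords A g c j P)"
      if "rotation R" "i \<in> {0}" for c R i P
      unfolding H_coords_rotate using that by (subst sum.remove[of UNIV 0]) (simp_all add: rotation_def)
  qed (erule (1) rep_H, erule H_cong, blast+)
qed

text \<open>The rows and columns of \<open>R\<close> indexed by \<open>J\<close> form an orthogonal matrix, so traces over \<open>J\<close> are invariant.\<close>

lemma rotation_contract:
  assumes R: "rotation R" and J: "J = nonzero \<or> J = {0}"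
  shows "(\<Sum>i\<in>J. \<Sum>j\<in>J. \<Sum>k\<in>J. R $ i $ j * (R $ i $ k * B j k)) = (\<Sum>j\<in>J. B j j)"
proof -
  have R0: "R $ 0 $ j = (if j = 0 then 1 else 0)" "R $ j $ 0 = (if j = 0 then 1 else 0)" for j
    using R by (auto simp: rotation_def)
  have col: "(\<Sum>i\<in>J. R $ i $ j * R $ i $ k) = (if j = k then 1 else 0)" if "j \<in> J" "k \<in> J" for j k
  proof (cases "J = {0}")
    case False
    then have "(\<Sum>i\<in>J. R $ i $ j * R $ i $ k) = (\<Sum>i\<in>UNIV. R $ i $ j * R $ i $ k)"
      using J that sum.remove[of UNIV 0 "\<lambda>i. R $ i $ j * R $ i $ k"] by (auto simp: R0)
    then show ?thesis by (simp add: rotation_orth(2)[OF R])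
  qed (use that in \<open>simp add: R0\<close>)
  have fin: "finite J" by simp
  have "(\<Sum>i\<in>J. \<Sum>j\<in>J. \<Sum>k\<in>J. R $ i $ j * (R $ i $ k * B j k)) 
    = (\<Sum>j\<in>J. \<Sum>k\<in>J. \<Sum>i\<in>J. R $ i $ j * (R $ i $ k * B j k))"
    by (rule sum3_rotate[symmetric])
  also have "\<dots> = (\<Sum>j\<in>J. \<Sum>k\<in>J. (\<Sum>i\<in>J. R $ i $ j * R $ i $ k) * B j k)"
    by (simp add: sum_distrib_right mult.assoc)
  also have "\<dots> = (\<Sum>j\<in>J. \<Sum>k\<in>J. if j = k then B j k else 0)"
    by (intro sum.cong refl) (simp add: col)
  also have "\<dots> = (\<Sum>j\<in>J. B j j)" using fin by (simp add: sum.delta')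
  finally show ?thesis .
qed

lemma frame_smoothE:
  assumes "frame_smooth F" "p \<in> FB"
  obtains W \<Phi> where "frame_coords (chart_at A (fst p)) p \<in> W" "rep (chart_at A (fst p)) W F \<Phi>"
  using assms unfolding frame_smooth_def by blast

lemma frame_smooth_op: "frame_op X Xf J \<Longrightarrow> i \<in> J \<Longrightarrow> frame_smooth F \<Longrightarrow> frame_smooth (X i F)"
  unfolding frame_smooth_def using frame_op_rep chart_at by meson

lemma op_rotate:
  assumes X: "frame_op X Xf J" and i: "i \<in> J" and R: "rotation R" and F: "frame_smooth F" and p: "p \<in> FB"
  shows "X i F (rotate_frame R p) = (\<Sum>j\<in>J. R $ i $ j * X j (\<lambda>p. F (rotate_frame R p)) p)"
proof -
  let ?c = "chart_at A (fst p)" and ?P = "frame_coords (chart_at A (fst p)) p"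
  have c: "?c \<in> A" "fst p \<in> cdom ?c" using chart_at[OF p] by auto
  have rp: "rotate_frame R p \<in> FB" by (rule rotate_in_FB[OF R p])
  obtain W \<Phi> where W: "rotate_coords R ?P \<in> W" and rep: "rep ?c W F \<Phi>"
    using frame_smoothE[OF F rp] by (auto simp: frame_coords_rotate)
  have s: "smooth_on W \<Phi>" using rep by (simp add: rep_def)
  have d: "der (\<lambda>P. \<Phi> (rotate_coords R P)) ?P Y = der \<Phi> (rotate_coords R ?P) (rotate_coords R Y)" for Y
    by (subst der_eqI[OF has_derivative_compose[OF bounded_linear_imp_has_derivative[OF bounded_linear_rotate_coords] smooth_on_has_derivative[OF s W]]])
      simp
  note rr = rep_rotate[OF R rep]
  have l: "linear (der (\<lambda>P. \<Phi> (rotate_coords R P)) ?P)"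
    using rr W by (intro smooth_on_linear_der[of "rotate_coords R -` W"]) (simp_all add: rep_def)
  have "X i F (rotate_frame R p) = lie (Xf ?c i) \<Phi> (rotate_coords R ?P)"
    using rep_value[OF frame_op_rep[OF X c(1) rep i] rp] c W by (simp add: frame_coords_rotate)
  also have "\<dots> = der (\<lambda>P. \<Phi> (rotate_coords R P)) ?P (\<Sum>j\<in>J. R $ i $ j *\<^sub>R Xf ?c j ?P)"
    unfolding lie_def d frame_op_rotate[OF X c(1) R i] ..
  also have "\<dots> = (\<Sum>j\<in>J. R $ i $ j * lie (Xf ?c j) (\<lambda>P. \<Phi> (rotate_coords R P)) ?P)"
    by (simp add: linear_sum[OF l] linear_cmul[OF l] lie_def)
  also have "\<dots> = (\<Sum>j\<in>J. R $ i $ j * X j (\<lambda>p. F (rotate_frame R p)) p)"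
    using rep_value[OF frame_op_rep[OF X c(1) rr] p c(2)] W by (intro sum.cong refl) simp
  finally show ?thesis .
qed

lemma basic_rotate: "basic F \<Longrightarrow> rotation R \<Longrightarrow> p \<in> FB \<Longrightarrow> F (rotate_frame R p) = F p"
  using rotate_in_FB frame_proj_rotate unfolding basic_def by metis

lemma basicI:
  assumes "\<And>R p. rotation R \<Longrightarrow> p \<in> FB \<Longrightarrow> F (rotate_frame R p) = F p" shows "basic F"
  unfolding basic_def using assms rotation_exists by metis

lemma op_rotate_basic:
  assumes X: "frame_op X Xf J" and i: "i \<in> J" and R: "rotation R" 
    and F: "frame_smooth F" "basic F" and p: "p \<in> FB"
  shows "X i F (rotate_frame R p) = (\<Sum>j\<in>J. R $ i $ j * X j F p)"
  unfolding op_rotate[OF X i R F(1) p]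
  by (intro sum.cong refl arg_cong2[where f = "(*)"] frame_op_cong[OF X p] basic_rotate[OF F(2) R])

lemma op_sum:
  assumes X: "frame_op X Xf J" and Y: "frame_op Y Yf J'" and i: "i \<in> J" and F: "frame_smooth F" and p: "p \<in> FB"
  shows "X i (\<lambda>p. \<Sum>k\<in>J'. r k * Y k F p) p = (\<Sum>k\<in>J'. r k * X i (Y k F) p)"
proof -
  let ?c = "chart_at A (fst p)" and ?P = "frame_coords (chart_at A (fst p)) p"
  have c: "?c \<in> A" "fst p \<in> cdom ?c" using chart_at[OF p] by auto
  obtain W \<Phi> where W: "?P \<in> W" and rep: "rep ?c W F \<Phi>" using frame_smoothE[OF F p] by blast
  have repY: "k \<in> J' \<Longrightarrow> rep ?c W (Y k F) (lie (Yf ?c k) \<Phi>)" for k by (rule frame_op_rep[OF Y c(1) rep])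
  then have s: "k \<in> J' \<Longrightarrow> smooth_on W (lie (Yf ?c k) \<Phi>)" and o: "open W" for k using rep by (auto simp: rep_def)
  have "rep ?c W (\<lambda>p. \<Sum>k\<in>J'. r k * Y k F p) (\<lambda>P. \<Sum>k\<in>J'. r k * lie (Yf ?c k) \<Phi> P)"
    by (intro rep_sum[OF rep] rep_cmult repY)
  from rep_value[OF frame_op_rep[OF X c(1) this i] p c(2) W]
  have "X i (\<lambda>p. \<Sum>k\<in>J'. r k * Y k F p) p = lie (Xf ?c i) (\<lambda>P. \<Sum>k\<in>J'. r k * lie (Yf ?c k) \<Phi> P) ?P" .
  also have "\<dots> = (\<Sum>k\<in>J'. lie (Xf ?c i) (\<lambda>P. r k * lie (Yf ?c k) \<Phi> P) ?P)"
    using W s by (intro lie_sum[where S = W] smooth_on_mult smooth_on_const o)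
  also have "\<dots> = (\<Sum>k\<in>J'. r k * lie (Xf ?c i) (lie (Yf ?c k) \<Phi>) ?P)"
    using W s by (intro sum.cong refl lie_cmult[where S = W])
  also have "\<dots> = (\<Sum>k\<in>J'. r k * X i (Y k F) p)"
    using rep_value[OF frame_op_rep[OF X c(1) repY i] p c(2) W] by (intro sum.cong refl) simp
  finally show ?thesis .
qed

section \<open>The forms and the generator in coordinates\<close>

text \<open>All four forms of the theorem are instances, with \<open>(X, Y)\<close> equal to \<open>(V, V)\<close>, \<open>(H, V)\<close>, \<open>(H, H)\<close> over \<open>i \<noteq> 0\<close>, and
\<open>(H, H)\<close> over \<open>i = 0\<close>. The symmetrisation is only visible for \<open>(H, V)\<close>.\<close>

definition frame_form :: "('n \<Rightarrow> ('a, 'n) frame_fun \<Rightarrow> ('a, 'n) frame_fun) \<Rightarrow>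
   ('n \<Rightarrow> ('a, 'n) frame_fun \<Rightarrow> ('a, 'n) frame_fun) \<Rightarrow> 'n set \<Rightarrow>
   ('a, 'n) frame_fun \<Rightarrow> ('a, 'n) frame_fun \<Rightarrow> ('a, 'n) frame_fun" where
  "frame_form X Y J F K p = 1 / 2 * (\<Sum>i\<in>J. X i F p * Y i K p + X i K p * Y i F p)"

lemma rep_form:
  assumes "frame_op X Xf J" "frame_op Y Yf J" "c \<in> A" "rep c W F \<Phi>" "rep c W K \<Psi>"
  shows "rep c W (frame_form X Y J F K) (\<lambda>P. 1 / 2 * (\<Sum>i\<in>J. lie (Xf c i) \<Phi> P * lie (Yf c i) \<Psi> P 
    + lie (Xf c i) \<Psi> P * lie (Yf c i) \<Phi> P))"
  unfolding frame_form_def[abs_def]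
  by (intro rep_cmult rep_sum[OF assms(4)] rep_add rep_mult frame_op_rep[OF assms(1,3)] frame_op_rep[OF assms(2,3)] assms)

lemma basic_form:
  assumes X: "frame_op X Xf J" and Y: "frame_op Y Yf J" 
    and F: "frame_smooth F" "basic F" and K: "frame_smooth K" "basic K"
  shows "basic (frame_form X Y J F K)"
proof (rule basicI)
  fix R p assume R: "rotation R" and p: "p \<in> FB"
  let ?B = "\<lambda>j k. X j F p * Y k K p + X j K p * Y k F p"
  have "frame_form X Y J F K (rotate_frame R p) = 1 / 2 * (\<Sum>i\<in>J. (\<Sum>j\<in>J. R $ i $ j * X j F p) * (\<Sum>k\<in>J. R $ i $ k * Y k K p) 
      + (\<Sum>j\<in>J. R $ i $ j * X j K p) * (\<Sum>k\<in>J. R $ i $ k * Y k F p))"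
    unfolding frame_form_def
    by (simp add: op_rotate_basic[OF X _ R F p] op_rotate_basic[OF Y _ R F p] 
        op_rotate_basic[OF X _ R K p] op_rotate_basic[OF Y _ R K p])
  also have "\<dots> = 1 / 2 * (\<Sum>i\<in>J. \<Sum>j\<in>J. \<Sum>k\<in>J. R $ i $ j * (R $ i $ k * ?B j k))"
    by (simp add: sum_product sum.distrib[symmetric] algebra_simps)
  also have "\<dots> = frame_form X Y J F K p"
    unfolding rotation_contract[OF R frame_op_index[OF X]] frame_form_def ..
  finally show "frame_form X Y J F K (rotate_frame R p) = frame_form X Y J F K p" .
qed

definition frame_gen :: "real \<Rightarrow> real \<Rightarrow> ('a, 'n) frame_fun \<Rightarrow> ('a, 'n) frame_fun" where
  "frame_gen \<sigma> \<kappa> F p = \<sigma>\<^sup>2 / 2 * (\<Sum>i\<in>nonzero. V A g i (V A g i F) p) + \<kappa> * H A g 0 F p"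

definition coords_gen :: "('a, 'n) chart \<Rightarrow> real \<Rightarrow> real \<Rightarrow> ('n fcoords \<Rightarrow> real) \<Rightarrow> 'n fcoords \<Rightarrow> real" where
  "coords_gen c \<sigma> \<kappa> = frame_fields.L lieV (lieH c) \<sigma> \<kappa>"

lemma rep_gen:
  assumes c: "c \<in> A" and rep: "rep c W F \<Phi>"
  shows "rep c W (frame_gen \<sigma> \<kappa> F) (coords_gen c \<sigma> \<kappa> \<Phi>)"
proof -
  have W: "open W" "W \<subseteq> U c \<times> UNIV" using rep by (auto simp: rep_def)
  interpret ff: frame_fields W "smooth_on W" lieV "lieH c" \<sigma> \<kappa>
    by (rule frame_fields_lie[OF c W])
  show ?thesis
    unfolding coords_gen_def ff.L_def[abs_def] frame_gen_def[abs_def]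
    by (intro rep_add rep_cmult rep_sum[OF rep] rep_V rep_H c rep) auto
qed

lemma frame_smooth_gen: "frame_smooth F \<Longrightarrow> frame_smooth (frame_gen \<sigma> \<kappa> F)"
  unfolding frame_smooth_def using rep_gen chart_at by meson

lemma frame_smooth_form: 
  assumes "frame_op X Xf J" "frame_op Y Yf J" "frame_smooth F" shows "frame_smooth (frame_form X Y J F F)"
  unfolding frame_smooth_def
proof
  fix p assume p: "p \<in> FB"
  obtain W \<Phi> where "frame_coords (chart_at A (fst p)) p \<in> W" "rep (chart_at A (fst p)) W F \<Phi>"
    using frame_smoothE[OF assms(3) p] by blast
  then show "\<exists>W \<Phi>. frame_coords (chart_at A (fst p)) p \<in> W \<and> rep (chart_at A (fst p)) W (frame_form X Y J F F) \<Phi>"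
    using rep_form[OF assms(1,2) conjunct1[OF chart_at[OF p]]] by blast
qed

text \<open>\<open>V_i F\<close> does not descend, so the second derivative is transformed in two steps; the two factors \<open>R_{ij}\<close> and
\<open>R_{ik}\<close> then contract.\<close>

lemma basic_gen:
  assumes F: "frame_smooth F" "basic F" shows "basic (frame_gen \<sigma> \<kappa> F)"
proof (rule basicI)
  fix R p assume R: "rotation R" and p: "p \<in> FB"
  note VV = frame_op_V
  have "(\<Sum>i\<in>nonzero. V A g i (V A g i F) (rotate_frame R p)) = (\<Sum>i\<in>nonzero. \<Sum>j\<in>nonzero. \<Sum>k\<in>nonzero. 
      R $ i $ j * (R $ i $ k * V A g j (V A g k F) p))"
  proof (rule sum.cong[OF refl])
    fix i :: 'n assume i: "i \<in> nonzero"
    have "V A g i (V A g i F) (rotate_frame R p) = (\<Sum>j\<in>nonzero. R $ i $ j * V A g j (\<lambda>p. V A g i F (rotate_frame R p)) p)"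
      by (rule op_rotate[OF VV i R frame_smooth_op[OF VV i F(1)] p])
    also have "\<dots> = (\<Sum>j\<in>nonzero. R $ i $ j * V A g j (\<lambda>p. \<Sum>k\<in>nonzero. R $ i $ k * V A g k F p) p)"
      by (intro sum.cong refl arg_cong2[where f = "(*)"] V_cong[OF p] op_rotate_basic[OF VV i R F])
    also have "\<dots> = (\<Sum>j\<in>nonzero. R $ i $ j * (\<Sum>k\<in>nonzero. R $ i $ k * V A g j (V A g k F) p))"
      by (intro sum.cong refl arg_cong2[where f = "(*)"] op_sum[OF VV VV _ F(1) p])
    finally show "V A g i (V A g i F) (rotate_frame R p) = (\<Sum>j\<in>nonzero. \<Sum>k\<in>nonzero. 
      R $ i $ j * (R $ i $ k * V A g j (V A g k F) p))" by (simp add: sum_distrib_left)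
  qed
  also have "\<dots> = (\<Sum>i\<in>nonzero. V A g i (V A g i F) p)"
    by (rule rotation_contract[OF R]) simp
  finally have 1: "(\<Sum>i\<in>nonzero. V A g i (V A g i F) (rotate_frame R p)) = \<dots>" .
  have "H A g 0 F (rotate_frame R p) = H A g 0 F p"
    using op_rotate_basic[OF frame_op_H(2) _ R F p, of 0] R by (simp add: rotation_def)
  then show "frame_gen \<sigma> \<kappa> F (rotate_frame R p) = frame_gen \<sigma> \<kappa> F p"
    unfolding frame_gen_def 1 by simp
qed

lemma basic_lift: "basic (f \<circ> frame_proj)" by (simp add: basic_def)

lemma generator_lift:
  assumes "frame_smooth (f \<circ> frame_proj)" "p \<in> FB"
  shows "generator A g \<sigma> \<kappa> f (frame_proj p) = frame_gen \<sigma> \<kappa> (f \<circ> frame_proj) p"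
proof -
  have "generator A g \<sigma> \<kappa> f = descend A g (frame_gen \<sigma> \<kappa> (f \<circ> frame_proj))"
    by (simp add: generator_def frame_gen_def[abs_def])
  then show ?thesis using descend_basic[OF basic_gen[OF assms(1) basic_lift] assms(2)] by simp
qed

lemma frame_smooth_cong: "frame_smooth F \<Longrightarrow> (\<And>p. p \<in> FB \<Longrightarrow> F p = F' p) \<Longrightarrow> frame_smooth F'"
  unfolding frame_smooth_def using rep_cong by meson

text \<open>The functions \<open>L f\<close> and \<open>\<Gamma>(f, f)\<close> on unit vectors never have to be examined themselves: their lifts agree on frames with
expressions in the frame fields, which have representatives on the same open set as the lift of \<open>f\<close>.\<close>

lemma Gamma2_coords:
  fixes \<Gamma> :: "('a \<times> ('a, 'n) tvec \<Rightarrow> real) \<Rightarrow> ('a \<times> ('a, 'n) tvec \<Rightarrow> real) \<Rightarrow> 'a \<times> ('a, 'n) tvec \<Rightarrow> real"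
  assumes X: "frame_op X Xf J" and Y: "frame_op Y Yf J"
    and \<Gamma>: "\<And>f h. \<Gamma> f h = descend A g (frame_form X Y J (f \<circ> frame_proj) (h \<circ> frame_proj))"
    and f: "frame_smooth (f \<circ> frame_proj)" and p: "p \<in> FB"
    and c: "c \<in> A" "fst p \<in> cdom c" and rep: "rep c W (f \<circ> frame_proj) \<Phi>" and P: "frame_coords c p \<in> W"
  shows "Gamma2 (generator A g \<sigma> \<kappa>) \<Gamma> f f (frame_proj p) = 
    frame_fields.Gamma2_sum lieV (lieH c) \<sigma> \<kappa> 
      (\<lambda>i. lie (Xf c i)) (\<lambda>i. lie (Yf c i)) J \<Phi> (frame_coords c p)"
proof -
  have W: "open W" "W \<subseteq> U c \<times> UNIV" using rep by (auto simp: rep_def)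
  interpret ff: frame_fields W "smooth_on W" lieV "lieH c" \<sigma> \<kappa>
    by (rule frame_fields_lie[OF c(1) W])
  let ?L = "generator A g \<sigma> \<kappa>" and ?F = "f \<circ> frame_proj" and ?P = "frame_coords c p"
  have \<Gamma>_lift: "\<Gamma> h k (frame_proj p) = frame_form X Y J (h \<circ> frame_proj) (k \<circ> frame_proj) p"
    if "frame_smooth (h \<circ> frame_proj)" "frame_smooth (k \<circ> frame_proj)" "p \<in> FB" for h k p
    unfolding \<Gamma> by (rule descend_basic[OF basic_form[OF X Y that(1) basic_lift that(2) basic_lift] that(3)])
  have sL: "frame_smooth (?L f \<circ> frame_proj)"
    by (rule frame_smooth_cong[OF frame_smooth_gen[OF f]]) (simp add: generator_lift[OF f])
  have s\<Gamma>: "frame_smooth (\<Gamma> f f \<circ> frame_proj)"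
    by (rule frame_smooth_cong[OF frame_smooth_form[OF X Y f]]) (simp add: \<Gamma>_lift[OF f f])
  have repL: "rep c W (?L f \<circ> frame_proj) (coords_gen c \<sigma> \<kappa> \<Phi>)"
    by (rule rep_cong[OF rep_gen[OF c(1) rep]]) (simp add: generator_lift[OF f])
  have rep\<Gamma>: "rep c W (\<Gamma> f f \<circ> frame_proj) (\<lambda>P. 1 / 2 * (\<Sum>i\<in>J. lie (Xf c i) \<Phi> P * lie (Yf c i) \<Phi> P 
    + lie (Xf c i) \<Phi> P * lie (Yf c i) \<Phi> P))"
    by (rule rep_cong[OF rep_form[OF X Y c(1) rep rep]]) (simp add: \<Gamma>_lift[OF f f])
  note val = rep_value[OF _ p c(2) P]
  have half: "1 / 2 * (\<Sum>i\<in>J. u i + u i) = sum u J" for u :: "'n \<Rightarrow> real"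
    unfolding sum.distrib by simp
  have 1: "?L (\<Gamma> f f) (frame_proj p) = ff.L (\<lambda>P. \<Sum>i\<in>J. lie (Xf c i) \<Phi> P * lie (Yf c i) \<Phi> P) ?P"
    using val[OF rep_gen[OF c(1) rep\<Gamma>]] by (simp only: generator_lift[OF s\<Gamma> p] coords_gen_def half)
  have 2: "\<Gamma> (?L f) f (frame_proj p) = 1 / 2 * (\<Sum>i\<in>J. lie (Xf c i) (ff.L \<Phi>) ?P * lie (Yf c i) \<Phi> ?P 
     + lie (Xf c i) \<Phi> ?P * lie (Yf c i) (ff.L \<Phi>) ?P)"
    using val[OF rep_form[OF X Y c(1) repL rep]] by (simp only: \<Gamma>_lift[OF sL f p] coords_gen_def)
  have 3: "\<Gamma> f (?L f) (frame_proj p) = 1 / 2 * (\<Sum>i\<in>J. lie (Xf c i) \<Phi> ?P * lie (Yf c i) (ff.L \<Phi>) ?P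
     + lie (Xf c i) (ff.L \<Phi>) ?P * lie (Yf c i) \<Phi> ?P)"
    using val[OF rep_form[OF X Y c(1) rep repL]] by (simp only: \<Gamma>_lift[OF f sL p] coords_gen_def)
  show ?thesis
    unfolding Gamma2_def ff.Gamma2_sum_def 1 2 3 by (simp add: sum.distrib algebra_simps)
qed

text \<open>An orthonormal family of fewer than \<open>n\<close> vectors can be enlarged: the vectors \<open>G e_i\<close> do not span, and a vector that is
orthogonal to them in the Euclidean sense is orthogonal to the \<open>e_i\<close> for the metric.\<close>

lemma orthonormal_extend:
  assumes c: "c \<in> A" and y: "y \<in> U c" and u: "u \<bullet> (G c y *v u) = 1"
  obtains E where "(y, E) \<in> frame_set c" "E $ 0 = u"
proof -
  have "\<exists>e. e 0 = u \<and> (\<forall>i\<in>insert 0 J. \<forall>j\<in>insert 0 J. e i \<bullet> (G c y *v e j) = (if i = j then 1 else 0))" 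
    if "finite J" for J :: "'n set"
    using that
  proof (induction J)
    case empty
    show ?case by (rule exI[of _ "\<lambda>_. u"]) (simp add: u)
  next
    case (insert k J)
    then obtain e where e: "e 0 = u" "\<forall>i\<in>insert 0 J. \<forall>j\<in>insert 0 J. e i \<bullet> (G c y *v e j) = (if i = j then 1 else 0)" by blast
    show ?case
    proof (cases "k = 0")
      case True
      then show ?thesis using e by auto
    next
      case False
      then have k: "k \<notin> insert 0 J" using insert.hyps by simp
      let ?S = "(\<lambda>i. G c y *v e i) ` insert 0 J"
      have "dim ?S \<le> card ?S" by (rule dim_le_card') (use insert.hyps in simp)
      also have "\<dots> \<le> card (insert 0 J)" by (rule card_image_le) (use insert.hyps in simp)
      also have "\<dots> < CARD('n)" by (rule psubset_card_mono) (use k in auto)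
      finally have "dim ?S < DIM('n coords)" by simp
      then obtain w where w: "w \<noteq> 0" "\<And>z. z \<in> span ?S \<Longrightarrow> orthogonal w z"
        by (rule orthogonal_to_subspace_exists) blast
      have we: "w \<bullet> (G c y *v e i) = 0" if "i \<in> insert 0 J" for i
        using w(2)[OF span_base[of "G c y *v e i"]] that by (auto simp: orthogonal_def)
      define N where "N = w \<bullet> (G c y *v w)"
      have N: "0 < N" using G_pos[OF c y w(1)] by (simp add: N_def)
      define w' where "w' = (1 / sqrt N) *\<^sub>R w"
      have w'e: "w' \<bullet> (G c y *v e i) = 0" "e i \<bullet> (G c y *v w') = 0" if "i \<in> insert 0 J" for i
        using we[OF that] matrix_form_commute[OF G_sym[OF c y], of "e i" w]
        by (simp_all add: w'_def matrix_vector_mult_scaleR)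
      have "w' \<bullet> (G c y *v w') = (1 / sqrt N) * (1 / sqrt N) * N"
        by (simp add: w'_def N_def matrix_vector_mult_scaleR)
      then have w'w': "w' \<bullet> (G c y *v w') = 1" using N by simp
      have "(e(k := w')) 0 = u" using False e by simp
      moreover have "(e(k := w')) i \<bullet> (G c y *v (e(k := w')) j) = (if i = j then 1 else 0)"
        if "i \<in> insert 0 (insert k J)" "j \<in> insert 0 (insert k J)" for i j
        using that e(2) w'e w'w' k by (cases "i = k"; cases "j = k") auto
      ultimately show ?thesis by blast
    qed
  qed
  from this[OF finite[of UNIV]] have "\<exists>e :: 'n \<Rightarrow> _. e 0 = u \<and> (\<forall>i j. e i \<bullet> (G c y *v e j) = (if i = j then 1 else 0))"
    by (simp only: insert_UNIV ball_UNIV)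
  then obtain e :: "'n \<Rightarrow> _" where "e 0 = u" "\<forall>i j. e i \<bullet> (G c y *v e j) = (if i = j then 1 else 0)"
    by blast
  then show thesis using that[of "\<chi> i. e i"] y by (simp add: frame_set_def)
qed

lemma frame_proj_surj:
  assumes "q \<in> unit_tangent_bundle A g"
  obtains p where "p \<in> FB" "frame_proj p = q"
proof -
  obtain x v where q: "q = (x, v)" "x \<in> (\<Union>c\<in>A. cdom c)" "v \<in> tangent_space A x" "g x v v = 1"
    using assms by (auto simp: unit_tangent_bundle_def unit_tangent_space_def)
  then obtain c where c: "c \<in> A" "x \<in> cdom c" by blast
  have "v c \<bullet> (G c (cmap c x) *v v c) = 1" using metric_tangent[OF c q(3) q(3)] q(4) by simp
  then obtain E where E: "(cmap c x, E) \<in> frame_set c" "E $ 0 = v c"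
    using orthonormal_extend[OF c(1) imageI[OF c(2)]] by metis
  have "frame_proj (frame_param A c (cmap c x, E)) = q"
    using c E q by (simp add: frame_proj_def frame_param_def tvec_of_tangent)
  then show thesis using that frame_param_in(1)[OF c(1) E(1)] by blast
qed

text \<open>A local extension of \<open>f\<close> off the unit vectors, composed with the projection \<open>(y, E) \<mapsto> (y, E_0)\<close>.\<close>

lemma smooth_unit_tangent_rep:
  assumes f: "smooth_unit_tangent A g f" and p: "p \<in> FB" and c: "c \<in> A" "fst p \<in> cdom c"
  obtains W \<Phi> where "frame_coords c p \<in> W" "rep c W (f \<circ> frame_proj) \<Phi>" "e0_function W \<Phi>"
proof -
  let ?S = "{(y, u). y \<in> U c \<and> tvec_of A c (cinv c y) u \<in> unit_tangent_space A g (cinv c y)}"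
  let ?e0 = "\<lambda>P :: 'n fcoords. (fst P, snd P $ 0)"
  have inS: "?e0 (frame_coords c p) \<in> ?S" and val: "f (cinv c (fst (frame_coords c p)), tvec_of A c (cinv c (fst (frame_coords c p))) (snd (frame_coords c p) $ 0)) = f (frame_proj p)"
    if "p \<in> FB" "fst p \<in> cdom c" for p
    using that c(1) by (auto simp: frame_coords_def FB_iff unit_tangent_space_def tvec_of_tangent frame_proj_def)
  have "smooth_on_subset ?S (\<lambda>(y, u). f (cinv c y, tvec_of A c (cinv c y) u))"
    using f c(1) unfolding smooth_unit_tangent_def by blast
  from bspec[OF this[unfolded smooth_on_subset_def] inS[OF p c(2)]]
  obtain W0 h where W0: "open W0" "?e0 (frame_coords c p) \<in> W0" "smooth_on W0 h"
    and h: "\<forall>q\<in>W0 \<inter> ?S. h q = (\<lambda>(y, u). f (cinv c y, tvec_of A c (cinv c y) u)) q"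
    by (elim exE conjE)
  define W where "W = ?e0 -` W0 \<inter> U c \<times> UNIV"
  define \<Phi> where "\<Phi> P = h (?e0 P)" for P
  have bl: "bounded_linear ?e0"
    by (intro bounded_linear_Pair bounded_linear_fst bounded_linear_compose[OF bounded_linear_vec_nth bounded_linear_snd])
  have o: "open W" unfolding W_def
    using c by (intro open_Int open_Times open_U open_UNIV continuous_open_vimage[OF W0(1)] linear_continuous_at[OF bl])
  have "smooth_on W \<Phi>" unfolding \<Phi>_def[abs_def]
    by (rule smooth_on_compose[OF o W0(3) smooth_on_linear[OF o bl]]) (auto simp: W_def)
  moreover have "f (frame_proj p) = \<Phi> (frame_coords c p)" if "p \<in> FB" "fst p \<in> cdom c" "frame_coords c p \<in> W" for p
  proof -
    have "?e0 (frame_coords c p) \<in> W0 \<inter> ?S" using inS[OF that(1,2)] that(3) by (simp add: W_def)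
    from bspec[OF h this] show ?thesis using val[OF that(1,2)] by (simp add: \<Phi>_def)
  qed
  ultimately have "rep c W (f \<circ> frame_proj) \<Phi>"
    unfolding rep_def using o by (auto simp: W_def)
  moreover have "e0_function W \<Phi>" unfolding e0_function_def
  proof (intro ballI allI impI)
    fix P X :: "'n fcoords" assume P: "P \<in> W" and X: "fst X = 0" "snd X $ 0 = 0"
    have "?e0 P \<in> W0" using P by (simp add: W_def)
    note d = smooth_on_has_derivative[OF W0(3) this]
    have "der \<Phi> P X = der h (?e0 P) (?e0 X)"
      unfolding \<Phi>_def[abs_def]
      by (subst der_eqI[OF has_derivative_compose[OF bounded_linear_imp_has_derivative[OF bl] d]]) simp
    also have "\<dots> = 0" using X linear_0[OF has_derivative_linear[OF d]] by (simp add: zero_prod_def)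
    finally show "der \<Phi> P X = 0" .
  qed
  moreover have "frame_coords c p \<in> W" using W0(2) c(2) by (simp add: W_def frame_coords_def mem_Times_iff)
  ultimately show thesis using that by blast
qed

lemma Gamma_eq_form:
  "Gamma_v A g f h = descend A g (frame_form (V A g) (V A g) nonzero (f \<circ> frame_proj) (h \<circ> frame_proj))"
  "Gamma_vh A g f h = descend A g (frame_form (H A g) (V A g) nonzero (f \<circ> frame_proj) (h \<circ> frame_proj))"
  "Gamma_h A g f h = descend A g (frame_form (H A g) (H A g) nonzero (f \<circ> frame_proj) (h \<circ> frame_proj))"
  "Gamma_xi A g f h = descend A g (frame_form (H A g) (H A g) {0} (f \<circ> frame_proj) (h \<circ> frame_proj))"
  unfolding Gamma_v_def Gamma_vh_def Gamma_h_def Gamma_xi_def frame_form_def[abs_def]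
  by (simp_all add: mult.commute sum_distrib_left[symmetric])

lemma basic_add:
  assumes "basic F" "basic K" shows "basic (\<lambda>p. F p + K p)"
  unfolding basic_def
proof (intro ballI impI)
  fix p p' assume "p \<in> FB" "p' \<in> FB" "frame_proj p = frame_proj p'"
  then have "F p = F p'" "K p = K p'" using assms unfolding basic_def by blast+
  then show "F p + K p = F p' + K p'" by simp
qed

lemma grad_coords:
  assumes f: "frame_smooth (f \<circ> frame_proj)" and p: "p \<in> FB"
    and c: "c \<in> A" "fst p \<in> cdom c" and rep: "rep c W (f \<circ> frame_proj) \<Phi>" and P: "frame_coords c p \<in> W"
  shows "grad_v_sq A g f (frame_proj p) = (\<Sum>i\<in>nonzero. (lieV i \<Phi> (frame_coords c p))\<^sup>2)"
    and "grad_h_sq A g f (frame_proj p) = (\<Sum>i\<in>UNIV. (lieH c i \<Phi> (frame_coords c p))\<^sup>2)"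
proof -
  let ?F = "f \<circ> frame_proj"
  have v: "frame_form (V A g) (V A g) nonzero ?F ?F = (\<lambda>p. \<Sum>i\<in>nonzero. (V A g i ?F p)\<^sup>2)"
    by (simp add: frame_form_def fun_eq_iff power2_eq_square sum_distrib_left[symmetric])
  have h: "(\<Sum>i\<in>UNIV. (H A g i ?F p)\<^sup>2) = frame_form (H A g) (H A g) nonzero ?F ?F p + frame_form (H A g) (H A g) {0} ?F ?F p" for p
    by (subst sum.remove[of UNIV 0]) (simp_all add: frame_form_def power2_eq_square sum_distrib_left[symmetric])
  have bv: "basic (\<lambda>p. \<Sum>i\<in>nonzero. (V A g i ?F p)\<^sup>2)"
    using basic_form[OF frame_op_V frame_op_V f basic_lift f basic_lift] unfolding v .
  have bh: "basic (\<lambda>p. \<Sum>i\<in>UNIV. (H A g i ?F p)\<^sup>2)"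
    unfolding h
    by (intro basic_add basic_form[OF frame_op_H(1) frame_op_H(1)] basic_form[OF frame_op_H(2) frame_op_H(2)] 
        f basic_lift)
  have Vv: "V A g i ?F p = lieV i \<Phi> (frame_coords c p)" if "i \<in> nonzero" for i
    using rep_value[OF frame_op_rep[OF frame_op_V c(1) rep that] p c(2) P] .
  have Hv: "H A g i ?F p = lieH c i \<Phi> (frame_coords c p)" for i
    using rep_value[OF rep_H[OF c(1) rep] p c(2) P] .
  show "grad_v_sq A g f (frame_proj p) = (\<Sum>i\<in>nonzero. (lieV i \<Phi> (frame_coords c p))\<^sup>2)"
    unfolding grad_v_sq_def descend_basic[OF bv p] by (simp add: Vv)
  show "grad_h_sq A g f (frame_proj p) = (\<Sum>i\<in>UNIV. (lieH c i \<Phi> (frame_coords c p))\<^sup>2)"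
    unfolding grad_h_sq_def descend_basic[OF bh p] by (simp add: Hv)
qed

lemma frame_smooth_lift: 
  assumes "smooth_unit_tangent A g f" shows "frame_smooth (f \<circ> frame_proj)"
  unfolding frame_smooth_def
proof
  fix p assume p: "p \<in> FB"
  then have "chart_at A (fst p) \<in> A" "fst p \<in> cdom (chart_at A (fst p))" using chart_at by auto
  from smooth_unit_tangent_rep[OF assms p this]
  show "\<exists>W \<Phi>. frame_coords (chart_at A (fst p)) p \<in> W \<and> rep (chart_at A (fst p)) W (f \<circ> frame_proj) \<Phi>"
    by metis
qed

lemma Gamma2_inequality:
  fixes a b c d K B \<alpha> m \<sigma> \<kappa> :: real
  assumes dim: "2 \<le> CARD('n)" and \<sigma>: "0 < \<sigma>" and \<kappa>: "0 < \<kappa>"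
    and m_def: "m = real (card nonzero)"
    and d_def: "d = 4 / \<sigma>\<^sup>2" and c_def: "c = 16 / \<sigma>\<^sup>2" and b_def: "b = 68 / \<kappa>" and a_def: "a = b\<^sup>2 * \<sigma>\<^sup>2 / 8"
    and \<alpha>_def: "\<alpha> = a * \<kappa> + b * m * \<sigma>\<^sup>2 / 2"
    and K_def: "K = b\<^sup>2 * (\<sigma>\<^sup>2)\<^sup>2 / 4 + \<alpha>\<^sup>2 / 4 + 1 + (1156 + (c * \<kappa>)\<^sup>2 / 4) * m\<^sup>2 * B\<^sup>2"
    and B: "\<And>x u v w h. x \<in> topspace M \<Longrightarrow> u \<in> unit_tangent_space A g x \<Longrightarrow> v \<in> unit_tangent_space A g x \<Longrightarrow>
      w \<in> unit_tangent_space A g x \<Longrightarrow> h \<in> unit_tangent_space A g x \<Longrightarrow> \<bar>g x u (curvature A g x v w h)\<bar> \<le> B"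
    and f: "smooth_unit_tangent A g f" and q: "q \<in> unit_tangent_bundle A g"
  shows "a * Gamma2 (generator A g \<sigma> \<kappa>) (Gamma_v A g) f f q
       - 2 * b * Gamma2 (generator A g \<sigma> \<kappa>) (Gamma_vh A g) f f q
       + c * Gamma2 (generator A g \<sigma> \<kappa>) (Gamma_h A g) f f q
       + d * Gamma2 (generator A g \<sigma> \<kappa>) (Gamma_xi A g) f f q
       \<ge> - K * grad_v_sq A g f q + grad_h_sq A g f q"
proof -
  obtain p where p: "p \<in> FB" "q = frame_proj p" using frame_proj_surj[OF q] by metis
  define ch where "ch = chart_at A (fst p)"
  have ch: "ch \<in> A" "fst p \<in> cdom ch" using chart_at[OF p(1)] by (auto simp: ch_def)
  define P where "P = frame_coords ch p"
  obtain W \<Phi> where PW: "frame_coords ch p \<in> W" and rep: "rep ch W (f \<circ> frame_proj) \<Phi>" and e0: "e0_function W \<Phi>"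
    by (rule smooth_unit_tangent_rep[OF f p(1) ch])
  have W: "open W" "W \<subseteq> U ch \<times> UNIV" and \<Phi>: "smooth_on W \<Phi>" using rep by (auto simp: rep_def)
  interpret ff: frame_fields W "smooth_on W" lieV "lieH ch" \<sigma> \<kappa>
    by (rule frame_fields_lie[OF ch(1) W])
  have F: "frame_smooth (f \<circ> frame_proj)" by (rule frame_smooth_lift[OF f])
  have Pin: "P \<in> W" "P \<in> frame_set ch" using PW frame_coords_in[OF ch(1) p(1) ch(2)] by (auto simp: P_def)
  have curv: "\<bar>lieH ch 0 (lieH ch i \<Phi>) P - lieH ch i (lieH ch 0 \<Phi>) P\<bar>
     \<le> B * (\<Sum>k\<in>nonzero. \<bar>lieV k \<Phi> P\<bar>)" for i
    unfolding lie_H_H[OF ch(1) W \<Phi> e0 Pin] abs_minus_cancel sum_distrib_left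
    by (rule order_trans[OF sum_abs], rule sum_mono)
      (simp add: abs_mult mult_right_mono curvature_bound[OF p(1) ch_def P_def B])
  have VV: "lieV j (lieV i \<Phi>) Q = lieV i (lieV j \<Phi>) Q"
    if "Q \<in> W" "i \<in> nonzero" "j \<in> nonzero" for i j Q
    using lie_V_V[OF W(1) \<Phi> e0 that(1)] that(2,3) by blast
  have VVV: "lieV j (lieV i (lieV j \<Phi>)) Q 
    - lieV i (lieV j (lieV j \<Phi>)) Q = lieV i \<Phi> Q"
    if "Q \<in> W" "i \<in> nonzero" "j \<in> nonzero" "i \<noteq> j" for i j Q
    using lie_V_V_V[OF W(1) \<Phi> e0 that(1)] that(2-) by blast
  note G2 = Gamma2_coords[OF _ _ _ F p(1) ch rep PW]
  have "- K * (\<Sum>i\<in>nonzero. (lieV i \<Phi> P)\<^sup>2) + (\<Sum>i\<in>UNIV. (lieH ch i \<Phi> P)\<^sup>2) \<le>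
     a * ff.Gamma2_sum lieV lieV nonzero \<Phi> P
     - 2 * b * ff.Gamma2_sum (lieH ch) lieV nonzero \<Phi> P
     + c * ff.Gamma2_sum (lieH ch) (lieH ch) nonzero \<Phi> P
     + d * ff.Gamma2_sum (lieH ch) (lieH ch) {0} \<Phi> P"
    by (rule ff.Gamma2_bound[OF Pin(1) \<Phi> dim \<sigma> \<kappa> m_def d_def c_def b_def a_def \<alpha>_def K_def VV VVV curv])
  then show ?thesis
    unfolding p(2) P_def
      G2[OF frame_op_V frame_op_V Gamma_eq_form(1)] G2[OF frame_op_H(1) frame_op_V Gamma_eq_form(2)]
      G2[OF frame_op_H(1) frame_op_H(1) Gamma_eq_form(3)] G2[OF frame_op_H(2) frame_op_H(2) Gamma_eq_form(4)]
      grad_coords[OF F p(1) ch rep PW] .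
qed

end

theorem proposition1:
  fixes M :: "'a topology"
    and A :: "('a, 'n::{finite,zero}) chart set"
    and g :: "('a, 'n) metric"
    and \<sigma> \<kappa> :: real
  assumes dim: "2 \<le> CARD('n)"
    and manifold: "smooth_manifold M A"
    and connected: "connected_space M"
    and oriented: "oriented_atlas A"
    and metric: "riemannian_metric A g"
    and complete: "geodesically_complete M A g"
    and curvature: "bounded_curvature M A g"
    and "0 < \<sigma>" and "0 < \<kappa>"
  shows "\<exists>a b c d K :: real. 0 < a \<and> 0 < b \<and> 0 < c \<and> 0 < d \<and> b\<^sup>2 < a * c \<and>
    (\<forall>f. smooth_unit_tangent A g f \<longrightarrow> (\<forall>q \<in> unit_tangent_bundle A g.
       a * Gamma2 (generator A g \<sigma> \<kappa>) (Gamma_v A g) f f q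
       - 2 * b * Gamma2 (generator A g \<sigma> \<kappa>) (Gamma_vh A g) f f q
       + c * Gamma2 (generator A g \<sigma> \<kappa>) (Gamma_h A g) f f q
       + d * Gamma2 (generator A g \<sigma> \<kappa>) (Gamma_xi A g) f f q
       \<ge> - K * grad_v_sq A g f q + grad_h_sq A g f q))"
proof -
  interpret riemannian M A g by unfold_locales (rule manifold, rule metric)
  obtain B where B: "\<And>x u v w h. x \<in> topspace M \<Longrightarrow> u \<in> unit_tangent_space A g x \<Longrightarrow> v \<in> unit_tangent_space A g x \<Longrightarrow>
      w \<in> unit_tangent_space A g x \<Longrightarrow> h \<in> unit_tangent_space A g x \<Longrightarrow> \<bar>g x u (curvature A g x v w h)\<bar> \<le> B"
    using curvature unfolding bounded_curvature_def by blast
  \<comment> \<open>the order of these choices is explained at \<open>quadratic_bound\<close>\<close>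
  define b d c where "b = 68 / \<kappa>" and "d = 4 / \<sigma>\<^sup>2" and "c = 16 / \<sigma>\<^sup>2"
  define a where "a = b\<^sup>2 * \<sigma>\<^sup>2 / 8"
  define m where "m = real (card (UNIV - {0 :: 'n}))"
  define \<alpha> where "\<alpha> = a * \<kappa> + b * m * \<sigma>\<^sup>2 / 2"
  define K where "K = b\<^sup>2 * (\<sigma>\<^sup>2)\<^sup>2 / 4 + \<alpha>\<^sup>2 / 4 + 1 + (1156 + (c * \<kappa>)\<^sup>2 / 4) * m\<^sup>2 * B\<^sup>2"
  have pos: "0 < a" "0 < b" "0 < c" "0 < d" 
    using \<open>0 < \<sigma>\<close> \<open>0 < \<kappa>\<close> by (simp_all add: a_def b_def c_def d_def)
  have "a * c = 2 * b\<^sup>2" using \<open>0 < \<sigma>\<close> by (simp add: a_def c_def)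
  then have "b\<^sup>2 < a * c" using pos(2) by simp
  moreover note Gamma2_inequality[OF dim \<open>0 < \<sigma>\<close> \<open>0 < \<kappa>\<close> m_def d_def c_def b_def a_def \<alpha>_def K_def B]
  ultimately show ?thesis using pos by blast
qed

end
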